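(* Let $f\colon M\to\mathbb{R}$ be a Morse function on a closed manifold $M$, and let $\mathcal{F}$ be the decomposition of $M$ into connected components of level sets of $f$. Then the Reeb graph of $f$ is, as an abstract multi-graph, the abstract weak element space $M/[\mathcal{F}]$. That is, the abstract weak elements of $\mathcal{F}$ are exactly the vertices and edges of the Reeb graph, viewed as subsets of $M$, with the same incidence.
   Context: A level set of $f$ is a set $f^{-1}(c)$, $c\in\mathbb{R}$. The Reeb graph of $f$ is the quotient space of $M$ in which $x,y$ are identified iff they lie in the same connected component of some level set; for a Morse function on a closed manifold it is a finite graph. Its vertices are the elements of $\mathcal{F}$ containing a critical point of $f$, and its (open) edges correspond to the connected components of the complement in $M$ of the union of those elements. An abstract multi-graph is a triple of sets $V,E$ and a map $A\colon E\to\{\{x,y\}\mid x,y\in V\}$; here $A$ sends an edge to the set of vertices in its closure. A decomposition of a space $X$ is a family of pairwise disjoint non-empty subsets with union $X$. For a decomposition $\mathcal{F}$ of $X$, let $q\colon X\to X/\mathcal{F}$ be the quotient map (quotient topology) and $\mathcal{F}(x)$ the element containing $x$. An element $L$ is closed if $\overline{L}=L$ and proper if $\overline{L}\setminus L$ is closed. The abstract weak element $[L]$ of $L\in\mathcal{F}$ is: if $L$ is proper (in particular if it is closed), the inverse image under $q$ of the connected component containing $L$ of $\{L'\in X/\mathcal{F}\mid L'\text{ homeomorphic to }L,\ \overline{L}\setminus L=\overline{L'}\setminus L'\}$; if $L$ is not proper, the inverse image under $q$ of the connected component containing $L$ of $\{L'\in X/\mathcal{F}\mid L'\text{ homeomorphic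 to }L,\ \overline{L}=\overline{L'}\}$. Put $[x]=[\mathcal{F}(x)]$; the abstract weak element space $X/[\mathcal{F}]$ is the quotient space of $X$ identifying $x,y$ when $[x]=[y]$.
   Formalization: The closed manifold is assumed to have dimension other than 1: on a circle all components of level sets are points, so the only abstract weak element is the whole circle, while the Reeb graph has at least two vertices, and the claim fails. *)

theory Defs
  imports "HOL-Analysis.Analysis"
begin

section \<open>Quotient spaces, decompositions and abstract weak elements\<close>

text \<open>The quotient of \<open>X\<close> identifying \<open>x\<close> and \<open>y\<close> when \<open>q x = q y\<close>; the class of \<open>x\<close>
  is represented by the value \<open>q x\<close>.\<close>

definition quotient_topology :: "'a topology \<Rightarrow> ('a \<Rightarrow> 'b) \<Rightarrow> 'b topology" where
  "quotient_topology X q =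
     topology (\<lambda>U. U \<subseteq> q ` topspace X \<and> openin X {x \<in> topspace X. q x \<in> U})"

lemma openin_quotient_topology:
  "openin (quotient_topology X q) U \<longleftrightarrow>
     U \<subseteq> q ` topspace X \<and> openin X {x \<in> topspace X. q x \<in> U}"
proof -
  let ?P = "\<lambda>U. U \<subseteq> q ` topspace X \<and> openin X {x \<in> topspace X. q x \<in> U}"
  have "istopology ?P"
    unfolding istopology_def
  proof (intro conjI allI impI)
    fix S T assume "?P S" "?P T"
    moreover have "{x \<in> topspace X. q x \<in> S \<inter> T} =
        {x \<in> topspace X. q x \<in> S} \<inter> {x \<in> topspace X. q x \<in> T}" by auto
    ultimately show "S \<inter> T \<subseteq> q ` topspace X" "openin X {x \<in> topspace X. q x \<in> S \<inter> T}"
      by auto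
  next
    fix K assume "\<forall>S\<in>K. ?P S"
    moreover have "{x \<in> topspace X. q x \<in> \<Union>K} = (\<Union>S\<in>K. {x \<in> topspace X. q x \<in> S})" by auto
    ultimately show "\<Union>K \<subseteq> q ` topspace X" "openin X {x \<in> topspace X. q x \<in> \<Union>K}"
      by auto
  qed
  then show ?thesis
    by (simp add: quotient_topology_def topology_inverse')
qed

lemma topspace_quotient_topology [simp]: "topspace (quotient_topology X q) = q ` topspace X"
proof -
  have "{x \<in> topspace X. q x \<in> q ` topspace X} = topspace X" by auto
  then have "openin (quotient_topology X q) (q ` topspace X)"
    by (simp add: openin_quotient_topology)
  then show ?thesis
    by (meson openin_quotient_topology openin_subset openin_topspace subset_antisym)
qed

lemma quotient_map_quotient_topology: "quotient_map X (quotient_topology X q) q"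
  by (auto simp: quotient_map_def openin_quotient_topology)

text \<open>A decomposition of \<open>X\<close> is a family \<open>F\<close> with \<open>partition_on (topspace X) F\<close>.\<close>

definition element_of :: "'a set set \<Rightarrow> 'a \<Rightarrow> 'a set" where
  "element_of F x = (THE L. L \<in> F \<and> x \<in> L)"

definition decomposition_space :: "'a topology \<Rightarrow> 'a set set \<Rightarrow> 'a set topology" where
  "decomposition_space X F = quotient_topology X (element_of F)"

definition proper_element :: "'a topology \<Rightarrow> 'a set \<Rightarrow> bool" where
  "proper_element X L \<longleftrightarrow> closedin X (X closure_of L - L)"

definition similar_elements :: "'a topology \<Rightarrow> 'a set set \<Rightarrow> 'a set \<Rightarrow> 'a set set" where
  "similar_elements X F L =
     (if proper_element X L
      then {L' \<in> F. subtopology X L' homeomorphic_space subtopology X L \<and>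
                    X closure_of L - L = X closure_of L' - L'}
      else {L' \<in> F. subtopology X L' homeomorphic_space subtopology X L \<and>
                    X closure_of L = X closure_of L'})"

definition abstract_weak_element :: "'a topology \<Rightarrow> 'a set set \<Rightarrow> 'a set \<Rightarrow> 'a set" where
  "abstract_weak_element X F L =
     {x \<in> topspace X. element_of F x \<in>
        connected_component_of_set
          (subtopology (decomposition_space X F) (similar_elements X F L)) L}"

definition abstract_weak_element_space :: "'a topology \<Rightarrow> 'a set set \<Rightarrow> 'a set topology" where
  "abstract_weak_element_space X F =
     quotient_topology X (\<lambda>x. abstract_weak_element X F (element_of F x))"


section \<open>Closed manifolds and Morse functions\<close>

text \<open>Manifolds are modelled on \<open>\<real>\<^sup>n\<close>, rendered as a Euclidean space type \<open>'b\<close> with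
  \<open>DIM('b) = n\<close>. Since \<open>DIM('b) > 0\<close> for every such type, \<open>\<real>\<^sup>0\<close> is rendered as the
  subspace \<open>{0}\<close> of \<open>'b\<close>.\<close>

definition model_space :: "nat \<Rightarrow> 'b::euclidean_space set" where
  "model_space n = (if n = 0 then {0} else UNIV)"

text \<open>Derivatives are taken within \<open>S\<close>, so that only values on \<open>S\<close> matter. For open \<open>S\<close>
  the derivative \<open>f'\<close> is unique and this is the usual class \<open>C\<^sup>k\<close>; on a subset of
  \<open>{0} = \<real>\<^sup>0\<close> every function is \<open>C\<^sup>k\<close>.\<close>

fun Ck_on :: "nat \<Rightarrow> 'b::euclidean_space set \<Rightarrow> ('b \<Rightarrow> 'c::real_normed_vector) \<Rightarrow> bool" where
  "Ck_on 0 S f \<longleftrightarrow> continuous_on S f"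
| "Ck_on (Suc k) S f \<longleftrightarrow>
     (\<exists>f'. (\<forall>x\<in>S. (f has_derivative f' x) (at x within S)) \<and>
           (\<forall>v. Ck_on k S (\<lambda>x. f' x v)))"

definition smooth_on :: "'b::euclidean_space set \<Rightarrow> ('b \<Rightarrow> 'c::real_normed_vector) \<Rightarrow> bool" where
  "smooth_on S f \<longleftrightarrow> (\<forall>k. Ck_on k S f)"

text \<open>A chart is a pair \<open>(U, \<phi>)\<close>; its inverse on \<open>\<phi> ` U\<close> is \<open>inv_into U \<phi>\<close>.
  Second countability follows from compactness, and the boundary is empty because the
  charts have images open in \<open>\<real>\<^sup>n\<close>. Connectedness is not required.\<close>

definition closed_manifold ::
    "nat \<Rightarrow> 'a topology \<Rightarrow> ('a set \<times> ('a \<Rightarrow> 'b::euclidean_space)) set \<Rightarrow> bool" where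
  "closed_manifold n M A \<longleftrightarrow>
     (n = 0 \<or> n = DIM('b)) \<and>
     Hausdorff_space M \<and> compact_space M \<and>
     topspace M = (\<Union>(U, \<phi>)\<in>A. U) \<and>
     (\<forall>(U, \<phi>)\<in>A. openin M U \<and>
        openin (top_of_set (model_space n)) (\<phi> ` U) \<and>
        homeomorphic_map (subtopology M U) (top_of_set (\<phi> ` U)) \<phi>) \<and>
     (\<forall>(U, \<phi>)\<in>A. \<forall>(V, \<psi>)\<in>A. smooth_on (\<psi> ` (U \<inter> V)) (\<phi> \<circ> inv_into V \<psi>))"

definition smooth_function ::
    "('a set \<times> ('a \<Rightarrow> 'b::euclidean_space)) set \<Rightarrow> ('a \<Rightarrow> real) \<Rightarrow> bool" where
  "smooth_function A f \<longleftrightarrow> (\<forall>(U, \<phi>)\<in>A. smooth_on (\<phi> ` U) (f \<circ> inv_into U \<phi>))"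

text \<open>In dimension \<open>0\<close> the filter \<open>at 0 within {0}\<close> is trivial, so every point is critical,
  as it should be.\<close>

definition critical_point ::
    "('a set \<times> ('a \<Rightarrow> 'b::euclidean_space)) set \<Rightarrow> ('a \<Rightarrow> real) \<Rightarrow> 'a \<Rightarrow> bool" where
  "critical_point A f p \<longleftrightarrow>
     (\<exists>(U, \<phi>)\<in>A. p \<in> U \<and>
        ((f \<circ> inv_into U \<phi>) has_derivative (\<lambda>v. 0)) (at (\<phi> p) within \<phi> ` U))"

text \<open>Here \<open>H v w\<close> is the Hessian of \<open>f\<close> in the chart \<open>(U, \<phi>)\<close> at \<open>\<phi> p\<close>, the derivative in
  direction \<open>w\<close> of the derivative \<open>f' _ v\<close> in direction \<open>v\<close>.\<close>

definition nondegenerate_at ::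
    "nat \<Rightarrow> ('a set \<times> ('a \<Rightarrow> 'b::euclidean_space)) set \<Rightarrow> ('a \<Rightarrow> real) \<Rightarrow> 'a \<Rightarrow> bool" where
  "nondegenerate_at n A f p \<longleftrightarrow>
     (\<exists>(U, \<phi>)\<in>A. p \<in> U \<and>
        (\<exists>f' H.
           (\<forall>x\<in>\<phi> ` U. ((f \<circ> inv_into U \<phi>) has_derivative f' x) (at x within \<phi> ` U)) \<and>
           (\<forall>v. ((\<lambda>x. f' x v) has_derivative H v) (at (\<phi> p) within \<phi> ` U)) \<and>
           (\<forall>v\<in>model_space n. v \<noteq> 0 \<longrightarrow> (\<exists>w\<in>model_space n. H v w \<noteq> 0))))"

definition morse_function ::
    "nat \<Rightarrow> 'a topology \<Rightarrow> ('a set \<times> ('a \<Rightarrow> 'b::euclidean_space)) set \<Rightarrow> ('a \<Rightarrow> real) \<Rightarrow> bool" where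
  "morse_function n M A f \<longleftrightarrow> smooth_function A f \<and>
     (\<forall>p\<in>topspace M. critical_point A f p \<longrightarrow> nondegenerate_at n A f p)"


section \<open>The Reeb graph as an abstract multi-graph\<close>

definition abstract_multigraph :: "'v set \<Rightarrow> 'e set \<Rightarrow> ('e \<Rightarrow> 'v set) \<Rightarrow> bool" where
  "abstract_multigraph V E A \<longleftrightarrow> (\<forall>e\<in>E. A e \<in> {{x, y} | x y. x \<in> V \<and> y \<in> V})"

definition level_components :: "'a topology \<Rightarrow> ('a \<Rightarrow> real) \<Rightarrow> 'a set set" where
  "level_components M f =
     (\<Union>c. connected_components_of (subtopology M {x \<in> topspace M. f x = c}))"

definition reeb_graph :: "'a topology \<Rightarrow> ('a \<Rightarrow> real) \<Rightarrow> 'a set topology" where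
  "reeb_graph M f = decomposition_space M (level_components M f)"

definition reeb_vertices ::
    "'a topology \<Rightarrow> ('a set \<times> ('a \<Rightarrow> 'b::euclidean_space)) set \<Rightarrow> ('a \<Rightarrow> real) \<Rightarrow> 'a set set" where
  "reeb_vertices M A f = {L \<in> level_components M f. \<exists>p\<in>L. critical_point A f p}"

text \<open>An edge is represented by its inverse image in \<open>M\<close>.\<close>

definition reeb_edges ::
    "'a topology \<Rightarrow> ('a set \<times> ('a \<Rightarrow> 'b::euclidean_space)) set \<Rightarrow> ('a \<Rightarrow> real) \<Rightarrow> 'a set set" where
  "reeb_edges M A f =
     connected_components_of (subtopology M (topspace M - \<Union>(reeb_vertices M A f)))"

text \<open>The closure is taken in the Reeb graph, not in \<open>M\<close>: a vertex, viewed as a subset of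
  \<open>M\<close>, need not be contained in the closure in \<open>M\<close> of an edge ending there.\<close>

definition reeb_incidence ::
    "'a topology \<Rightarrow> ('a set \<times> ('a \<Rightarrow> 'b::euclidean_space)) set \<Rightarrow> ('a \<Rightarrow> real) \<Rightarrow> 'a set \<Rightarrow> 'a set set" where
  "reeb_incidence M A f e =
     reeb_vertices M A f \<inter>
     reeb_graph M f closure_of (element_of (level_components M f) ` e)"

end

(* The level components are closed, so the weak element of L is the saturation of the component
   of L inside the set of level components homeomorphic to L.

   A component through a critical point is not homeomorphic to a regular one, because it is not
   locally Euclidean of dimension n - 1. At a nondegenerate critical point split R^n into the
   negative space N and the positive space P of the Hessian. If both are nonzero, the critical
   level is near the point a union of graphs x |-> x + s(x) y over N, one for each unit vector
   y of P. Such a graph sends a small sphere of N into the punctured level set, and projection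
   along P retracts the punctured level set back to that sphere; in a punctured (n-1)-ball the
   map would be nullhomotopic when dim N < n - 1. Exchanging N and P covers dim P < n - 1, and
   only a cross of four arms in the plane remains. This needs no Morse lemma.

   A regular component L has a neighbourhood fibred into homeomorphic components, one for each
   nearby value. Instead of flowing, L is pushed from f = c to f = c + eps in finitely many
   steps through hypersurfaces f = c + eps sigma, each time along parallel lines of one chart.

   Two such tubes that meet have a tube as union, so every edge is a tube over an open interval.
   By compactness it accumulates at each end of the interval, and only at one critical component
   there. *)
theory Submission
  imports Defs
begin

section \<open>Splitting a nondegenerate symmetric form\<close>

text \<open>Dimension 1 has to be left out: on a circle every level component is a single point, so
  critical and regular components are homeomorphic and the weak element of any of them is the whole
  circle. Dimension 0 is treated apart, since every point is critical there and no edge exists. From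
  dimension 2 on, the homeomorphisms to be excluded respect neither \<open>f\<close> nor charts, so
  a critical component has to be recognised from its topology alone. At an extremum this is easy,
  because the level is locally one point. The maps that would usually come from a gradient flow or
  from the implicit function theorem are obtained here from compactness: a unique zero in a compact
  interval depends continuously on parameters, and a closed relation on \<open>M \<times> M\<close>
  that pairs the points of two closed sets uniquely is a homeomorphism between them. The pushing
  steps work with Lipschitz heights, because \<open>f\<close> grows along the chart lines at a
  positive rate, which a small multiple of a Lipschitz function cannot reverse.\<close>

lemma quadratic_form_definite_bound:
  fixes H :: "'b::euclidean_space \<Rightarrow> 'b \<Rightarrow> real"
  assumes H: "bilinear H" and T: "subspace T" and pos: "\<And>y. y \<in> T \<Longrightarrow> y \<noteq> 0 \<Longrightarrow> H y y > 0"
  obtains m where "m > 0" "\<And>y. y \<in> T \<Longrightarrow> H y y \<ge> m * (norm y)\<^sup>2"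
proof -
  let ?S = "T \<inter> sphere 0 1"
  show ?thesis
  proof (cases "?S = {}")
    case True
    have "y = 0" if "y \<in> T" for y
    proof (rule ccontr)
      assume "y \<noteq> 0"
      then have "y /\<^sub>R norm y \<in> ?S" using that T by (auto simp: subspace_scale)
      with True show False by auto
    qed
    then have "H y y \<ge> 1 * (norm y)\<^sup>2" if "y \<in> T" for y
      using that bilinear_lzero[OF H, of 0] by force
    then show ?thesis
      using that[of 1] by simp
  next
    case False
    have comp: "compact ?S"
      by (simp add: T closed_subspace closed_Int_compact)
    have "bounded_bilinear H"
      using H bilinear_conv_bounded_bilinear by blast
    then have cont: "continuous_on ?S (\<lambda>y. H y y)"
      by (rule bounded_bilinear.continuous_on[OF _ continuous_on_id continuous_on_id])
    obtain y0 where y0: "y0 \<in> ?S" "\<And>y. y \<in> ?S \<Longrightarrow> H y0 y0 \<le> H y y"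
      using continuous_attains_inf[OF comp False cont] by (metis (no_types, lifting))
    show ?thesis
    proof
      show "H y0 y0 > 0"
        using y0(1) pos[of y0] by fastforce
      fix y assume y: "y \<in> T"
      show "H y y \<ge> H y0 y0 * (norm y)\<^sup>2"
      proof (cases "y = 0")
        case True then show ?thesis using bilinear_lzero[OF H] by auto
      next
        case False
        then have "y /\<^sub>R norm y \<in> ?S" using y T by (auto simp: subspace_scale)
        then have "H y0 y0 \<le> H (y /\<^sub>R norm y) (y /\<^sub>R norm y)"
          using y0 by blast
        also have "\<dots> = H y y / (norm y)\<^sup>2"
          by (simp add: bilinear_lmul[OF H] bilinear_rmul[OF H] power2_eq_square divide_inverse)
        finally show ?thesis using False by (simp add: field_simps)
      qed
    qed
  qed
qed

text \<open>\<open>N\<close> is spanned by a largest \<open>H\<close>-orthogonal family of vectors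
  with \<open>H e e = -1\<close>, and \<open>P\<close> is its \<open>H\<close>-orthogonal
  complement. Such a family is independent, which bounds its size. Maximality makes \<open>H\<close>
  nonnegative on \<open>P\<close>, and nondegeneracy turns this into positivity.\<close>

lemma nondegenerate_form_splitting:
  fixes H :: "'b::euclidean_space \<Rightarrow> 'b \<Rightarrow> real"
  assumes H: "bilinear H" and sym: "\<And>u v. H u v = H v u"
    and nondeg: "\<And>v. v \<noteq> 0 \<Longrightarrow> \<exists>w. H v w \<noteq> 0"
  obtains N P m where "subspace N" "subspace P" "N \<inter> P = {0}"
    "\<And>z. \<exists>x\<in>N. \<exists>y\<in>P. z = x + y" "\<And>x y. x \<in> N \<Longrightarrow> y \<in> P \<Longrightarrow> H x y = 0"
    "m > 0" "\<And>x. x \<in> N \<Longrightarrow> H x x \<le> - m * (norm x)\<^sup>2"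
    "\<And>y. y \<in> P \<Longrightarrow> H y y \<ge> m * (norm y)\<^sup>2"
proof -
  note Hl = bilinear_ladd[OF H] bilinear_radd[OF H] bilinear_lmul[OF H] bilinear_rmul[OF H]
    bilinear_lzero[OF H] bilinear_rzero[OF H] bilinear_lneg[OF H] bilinear_rneg[OF H]
    bilinear_lsub[OF H] bilinear_rsub[OF H]
  have linr: "linear (H v)" for v using H by (simp add: bilinear_def)
  define ok where "ok S \<longleftrightarrow> finite S \<and> (\<forall>e\<in>S. H e e = -1) \<and> (\<forall>e\<in>S. \<forall>e'\<in>S. e \<noteq> e' \<longrightarrow> H e e' = 0)" for S
  have Hsum: "H e (\<Sum>a\<in>S. c a *\<^sub>R a) = - c e" if "ok S" "e \<in> S" for S e c
  proof -
    have "H e (\<Sum>a\<in>S. c a *\<^sub>R a) = (\<Sum>a\<in>S. c a * H e a)"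
      by (simp add: linear_sum[OF linr] Hl)
    also have "\<dots> = (\<Sum>a\<in>S. if a = e then - c e else 0)"
      by (rule sum.cong) (use that in \<open>auto simp: ok_def\<close>)
    finally show ?thesis using that by (simp add: ok_def)
  qed
  have indep: "independent S" if "ok S" for S
  proof (rule independent_if_scalars_zero)
    show "finite S" using that ok_def by auto
    fix f x assume "(\<Sum>x\<in>S. f x *\<^sub>R x) = 0" "x \<in> S"
    then show "f x = 0" using Hsum[OF that \<open>x \<in> S\<close>, of f] by (simp add: Hl)
  qed
  have "ok {}" by (simp add: ok_def)
  moreover have "\<forall>S. ok S \<longrightarrow> card S < Suc (DIM('b))"
    using indep independent_bound by (auto simp: less_Suc_eq_le)
  ultimately obtain S where S: "ok S" and max: "\<And>S'. ok S' \<Longrightarrow> card S' \<le> card S"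
    using ex_has_greatest_nat[of ok "{}" card "Suc (DIM('b))"] by auto
  have finS: "finite S" using S ok_def by auto
  define N where "N = span S"
  define P where "P = {y. \<forall>e\<in>S. H e y = 0}"
  \<comment> \<open>The \<open>H\<close>-orthogonal projection onto \<open>N\<close>; the sign
    compensates \<open>H e e = -1\<close>.\<close>
  define p where "p z = - (\<Sum>e\<in>S. H e z *\<^sub>R e)" for z
  have pN: "p z \<in> N" for z
    unfolding p_def N_def by (intro span_neg span_sum span_scale span_base)
  have pP: "z - p z \<in> P" for z
    using Hsum[OF S, of _ "\<lambda>e. H e z"] by (auto simp: P_def p_def Hl)
  have sP: "subspace P"
    by (auto simp: subspace_def P_def Hl)
  have orth: "H x y = 0" if "x \<in> N" "y \<in> P" for x y
    using that(1) unfolding N_def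
  proof (induction rule: span_induct_alt)
    case (step c e z) then show ?case using that(2) by (auto simp: P_def Hl)
  qed (simp add: Hl)
  have NP0: "x = 0" if x: "x \<in> N" "x \<in> P" for x
  proof -
    obtain c where c: "x = (\<Sum>a\<in>S. c a *\<^sub>R a)"
      using x(1) unfolding N_def span_finite[OF finS] by blast
    have "c e = 0" if "e \<in> S" for e
      using Hsum[OF S that, of c] \<open>x \<in> P\<close> that by (simp add: c P_def)
    then show ?thesis using c by simp
  qed
  have Pnn: "H y y \<ge> 0" if "y \<in> P" for y
  proof (rule ccontr)
    assume neg: "\<not> H y y \<ge> 0"
    \<comment> \<open>Normalised to \<open>H e e = -1\<close>, the vector would enlarge the maximal
      family \<open>S\<close>.\<close>
    define e where "e = y /\<^sub>R sqrt (- H y y)"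
    have "sqrt (- H y y) > 0" using neg by simp
    have ee: "H e e = -1"
    proof -
      have "H e e = H y y / (sqrt (- H y y))\<^sup>2"
        unfolding e_def Hl by (simp only: power2_eq_square divide_inverse inverse_mult_distrib) simp
      also have "\<dots> = -1" using neg by simp
      finally show ?thesis .
    qed
    have e0: "H a e = 0" if "a \<in> S" for a
      using \<open>y \<in> P\<close> that by (simp add: e_def Hl P_def)
    have "e \<notin> S" using e0 ee by force
    have "ok (insert e S)"
      using S ee e0 sym by (auto simp: ok_def)
    then show False using max[of "insert e S"] finS \<open>e \<notin> S\<close> by simp
  qed
  have Ppos: "H y y > 0" if y: "y \<in> P" "y \<noteq> 0" for y
  proof (rule ccontr)
    assume "\<not> H y y > 0"
    then have yy: "H y y = 0" using Pnn[OF y(1)] by simp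
    have wy: "H y w = 0" if w: "w \<in> P" for w
    proof (rule ccontr)
      assume ne: "H y w \<noteq> 0"
      \<comment> \<open>On the line \<open>w + t *\<^sub>R y\<close> the form is affine in
        \<open>t\<close> because \<open>H y y = 0\<close>; this \<open>t\<close> gives it the value
        -1, against \<open>Pnn\<close>.\<close>
      define t where "t = - (H w w + 1) / (2 * H y w)"
      have "w + t *\<^sub>R y \<in> P" using w \<open>y \<in> P\<close> sP by (simp add: subspace_add subspace_scale)
      then have "0 \<le> H (w + t *\<^sub>R y) (w + t *\<^sub>R y)" by (rule Pnn)
      also have "\<dots> = H w w + 2 * t * H y w"
        by (simp add: Hl yy sym[of w y])
      also have "\<dots> = -1"
      proof -
        have "t * H y w = - (H w w + 1) / 2" using ne by (simp add: t_def)
        then show ?thesis by (simp add: field_simps)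
      qed
      finally show False by simp
    qed
    obtain v where "H y v \<noteq> 0" using nondeg[OF y(2)] by auto
    moreover have "H y v = H y (p v) + H y (v - p v)" by (simp add: Hl)
    ultimately show False
      using wy[OF pP] orth[OF pN y(1)] by (simp add: sym)
  qed
  have Nneg: "H x x < 0" if x: "x \<in> N" "x \<noteq> 0" for x
  proof -
    obtain c where c: "x = (\<Sum>a\<in>S. c a *\<^sub>R a)"
      using x(1) unfolding N_def span_finite[OF finS] by blast
    have "H x x = (\<Sum>a\<in>S. c a * H x a)"
      by (subst (2) c) (simp add: linear_sum[OF linr] Hl)
    also have "\<dots> = (\<Sum>a\<in>S. - (c a)\<^sup>2)"
      by (rule sum.cong) (simp_all add: sym[of x] Hsum[OF S, of _ c, folded c] power2_eq_square)
    finally have e: "H x x = - (\<Sum>a\<in>S. (c a)\<^sup>2)" by (simp add: sum_negf)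
    have "\<exists>a\<in>S. c a \<noteq> 0"
    proof (rule ccontr)
      assume "\<not> (\<exists>a\<in>S. c a \<noteq> 0)"
      then have "x = 0" unfolding c by (intro sum.neutral) auto
      with x(2) show False by simp
    qed
    then obtain a where "a \<in> S" "c a \<noteq> 0"
      by auto
    then have "0 < (\<Sum>a\<in>S. (c a)\<^sup>2)"
      by (intro sum_pos2[OF finS]) auto
    with e show ?thesis by simp
  qed
  obtain m1 where m1: "m1 > 0" "\<And>y. y \<in> P \<Longrightarrow> H y y \<ge> m1 * (norm y)\<^sup>2"
    using quadratic_form_definite_bound[OF H sP Ppos] by auto
  have H': "bilinear (\<lambda>x y. - H x y)"
    using H by (auto simp: bilinear_def linear_compose_neg)
  have sN: "subspace N" by (simp add: N_def)
  obtain m2 where m2: "m2 > 0" "\<And>y. y \<in> N \<Longrightarrow> - H y y \<ge> m2 * (norm y)\<^sup>2"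
    by (rule quadratic_form_definite_bound[OF H' sN]) (use Nneg in auto)
  show ?thesis
  proof (rule that[of N P "min m1 m2"])
    show "subspace N" "subspace P" by fact+
    show "N \<inter> P = {0}" using NP0 sN sP by (auto simp: subspace_0)
    show "\<exists>x\<in>N. \<exists>y\<in>P. z = x + y" for z
      by (rule bexI[OF _ pN[of z]], rule bexI[OF _ pP[of z]]) simp
    show "H x y = 0" if "x \<in> N" "y \<in> P" for x y using orth that .
    show "min m1 m2 > 0" using m1 m2 by simp
    show "H x x \<le> - min m1 m2 * (norm x)\<^sup>2" if "x \<in> N" for x
      using m2(2)[OF that] mult_right_mono[of "min m1 m2" m2 "(norm x)\<^sup>2"] by simp
    show "H y y \<ge> min m1 m2 * (norm y)\<^sup>2" if "y \<in> P" for y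
      using m1(2)[OF that] mult_right_mono[of "min m1 m2" m1 "(norm y)\<^sup>2"] by simp
  qed
qed

section \<open>Second order approximation\<close>

lemma has_derivative_along_line:
  fixes g :: "'b::real_normed_vector \<Rightarrow> real"
  assumes "(g has_derivative g') (at (x + s *\<^sub>R v))"
  shows "((\<lambda>s. g (x + s *\<^sub>R v)) has_real_derivative g' v) (at s)"
proof -
  have lin: "linear g'" using assms has_derivative_linear by blast
  have "((\<lambda>s. x + s *\<^sub>R v) has_derivative (\<lambda>h. h *\<^sub>R v)) (at s)"
    by (auto intro!: derivative_eq_intros)
  from has_derivative_compose[OF this assms]
  have "((\<lambda>s. g (x + s *\<^sub>R v)) has_derivative (\<lambda>h. g' (h *\<^sub>R v))) (at s)" .
  then show ?thesis
    by (simp add: has_field_derivative_def linear_cmul[OF lin] mult_commute_abs)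
qed

context
  fixes g :: "'b::euclidean_space \<Rightarrow> real" and g' H :: "'b \<Rightarrow> 'b \<Rightarrow> real" and S z0
  assumes S: "open S" "z0 \<in> S"
    and g': "\<And>x. x \<in> S \<Longrightarrow> (g has_derivative g' x) (at x)"
    and H: "\<And>v. ((\<lambda>x. g' x v) has_derivative H v) (at z0)"
begin

lemma linear_gradient: "x \<in> S \<Longrightarrow> linear (g' x)"
  using g' has_derivative_linear by blast

lemma bilinear_hessian: "bilinear H"
proof -
  have r: "linear (H v)" for v using H has_derivative_linear by blast
  have add: "H (u + v) = (\<lambda>w. H u w + H v w)" for u v
  proof (rule has_derivative_unique[OF H])
    have "((\<lambda>x. g' x u + g' x v) has_derivative (\<lambda>w. H u w + H v w)) (at z0)"
      by (intro has_derivative_add H)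
    then show "((\<lambda>x. g' x (u + v)) has_derivative (\<lambda>w. H u w + H v w)) (at z0)"
      by (rule has_derivative_transform_within_open[OF _ S]) (simp add: linear_add[OF linear_gradient])
  qed
  have scl: "H (c *\<^sub>R u) = (\<lambda>w. c *\<^sub>R H u w)" for c u
  proof (rule has_derivative_unique[OF H])
    have "((\<lambda>x. c *\<^sub>R g' x u) has_derivative (\<lambda>w. c *\<^sub>R H u w)) (at z0)"
      by (intro has_derivative_scaleR_right H)
    then show "((\<lambda>x. g' x (c *\<^sub>R u)) has_derivative (\<lambda>w. c *\<^sub>R H u w)) (at z0)"
      by (rule has_derivative_transform_within_open[OF _ S]) (simp add: linear_cmul[OF linear_gradient])
  qed
  show ?thesis
    unfolding bilinear_def by (auto intro!: r linearI simp: add scl)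
qed

text \<open>Differentiability at \<open>z0\<close> is known for one direction \<open>v\<close> at a
  time. Linearity in \<open>v\<close> reduces the uniform estimate to the finitely many basis
  vectors, each of which gets the share \<open>\<epsilon> / DIM('b)\<close> of the error.\<close>

lemma gradient_hessian_approx:
  assumes "\<epsilon> > 0"
  obtains r where "r > 0" "ball z0 r \<subseteq> S"
    "\<And>z v. norm z < r \<Longrightarrow> \<bar>g' (z0 + z) v - g' z0 v - H v z\<bar> \<le> \<epsilon> * norm z * norm v"
proof -
  define e where "e = \<epsilon> / DIM('b)"
  have e: "e > 0" using assms by (simp add: e_def)
  have "\<exists>r>0. \<forall>z. norm z < r \<longrightarrow> \<bar>g' (z0 + z) b - g' z0 b - H b z\<bar> \<le> e * norm z" for b
  proof -
    obtain d where "d > 0" "\<And>y. norm (y - z0) < d \<Longrightarrow>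
        norm (g' y b - g' z0 b - H b (y - z0)) \<le> e * norm (y - z0)"
      using H[of b, unfolded has_derivative_at_alt] e by blast
    from this(1) this(2)[of "z0 + _"] show ?thesis by auto
  qed
  then obtain r where r: "\<And>b. r b > 0"
    "\<And>b z. norm z < r b \<Longrightarrow> \<bar>g' (z0 + z) b - g' z0 b - H b z\<bar> \<le> e * norm z"
    by metis
  obtain r0 where r0: "r0 > 0" "ball z0 r0 \<subseteq> S" using S openE by blast
  define R where "R = min r0 (Min (r ` Basis))"
  show ?thesis
  proof
    show "R > 0" using r0 r by (simp add: R_def)
    show "ball z0 R \<subseteq> S" using r0 by (auto simp: R_def)
    fix z v :: 'b assume z: "norm z < R"
    then have "z0 + z \<in> S" using r0(2) by (auto simp: R_def dist_norm subset_iff)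
    define D where "D = (\<lambda>v. g' (z0 + z) v - g' z0 v - H v z)"
    have "linear D"
    proof -
      have "linear (\<lambda>v. H v z)" using bilinear_hessian by (simp add: bilinear_def)
      then show ?thesis
        unfolding D_def by (intro linear_compose_sub linear_gradient \<open>z0 + z \<in> S\<close> S)
    qed
    then have "D v = (\<Sum>b\<in>Basis. (v \<bullet> b) * D b)"
      using Linear_Algebra.linear_componentwise[of D v 1] by simp
    then have "\<bar>D v\<bar> \<le> (\<Sum>b\<in>Basis. \<bar>(v \<bullet> b) * D b\<bar>)" by simp
    also have "\<dots> \<le> (\<Sum>b\<in>(Basis::'b set). norm v * (e * norm z))"
    proof (rule sum_mono)
      fix b :: 'b assume b: "b \<in> Basis"
      then have "norm z < r b" using z by (simp add: R_def)
      then show "\<bar>(v \<bullet> b) * D b\<bar> \<le> norm v * (e * norm z)"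
        unfolding abs_mult D_def using b r(2) by (intro mult_mono) (auto simp: Basis_le_norm)
    qed
    also have "\<dots> = \<epsilon> * norm z * norm v" by (simp add: e_def)
    finally show "\<bar>g' (z0 + z) v - g' z0 v - H v z\<bar> \<le> \<epsilon> * norm z * norm v"
      by (simp add: D_def)
  qed
qed

text \<open>Both values of the Hessian approximate the same second difference quotient of \<open>g\<close>.\<close>

lemma hessian_symmetric: "H u v = H v u"
proof -
  define B where "B = norm u + norm v"
  have Bn: "norm u \<le> B" "norm v \<le> B" "0 \<le> B" by (auto simp: B_def)
  note Hl = bilinear_ladd[OF bilinear_hessian] bilinear_radd[OF bilinear_hessian]
    bilinear_lmul[OF bilinear_hessian] bilinear_rmul[OF bilinear_hessian]
  have main: "\<bar>H u v - H v u\<bar> \<le> \<epsilon> * (6 * B\<^sup>2)" if e: "\<epsilon> > 0" for \<epsilon>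
  proof -
    obtain r where r: "r > 0" "ball z0 r \<subseteq> S"
      "\<And>z v. norm z < r \<Longrightarrow> \<bar>g' (z0 + z) v - g' z0 v - H v z\<bar> \<le> \<epsilon> * norm z * norm v"
      using gradient_hessian_approx[OF e] by metis
    \<comment> \<open>Small enough for the whole parallelogram spanned by
      \<open>t *\<^sub>R u\<close> and \<open>t *\<^sub>R v\<close> at \<open>z0\<close> to lie in
      the ball; the summand 1 avoids a zero denominator when \<open>u\<close> and \<open>v\<close>
      vanish.\<close>
    define t where "t = r / (2 * (B + 1))"
    have t: "t > 0" using r Bn by (simp add: t_def)
    have tB: "t * B < r"
    proof -
      have "t * B \<le> t * (B + 1)" using t by simp
      also have "\<dots> < r" using r(1) Bn(3) by (simp add: t_def field_simps add_pos_nonneg)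
      finally show ?thesis .
    qed
    have est: "\<bar>g (z0 + t *\<^sub>R u + t *\<^sub>R v) - g (z0 + t *\<^sub>R u) - g (z0 + t *\<^sub>R v) + g z0 - t\<^sup>2 * H u v\<bar>
        \<le> 3 * \<epsilon> * t\<^sup>2 * B\<^sup>2" if B: "norm u + norm v = B" for u v
    proof -
      \<comment> \<open>The second difference is \<open>h 1 - h 0\<close>, so one use of the mean
        value theorem expresses it by two gradient values. Their Hessian approximations differ by
        exactly \<open>t\<^sup>2 * H u v\<close>.\<close>
      define h where "h s = g (z0 + t *\<^sub>R v + s *\<^sub>R (t *\<^sub>R u)) - g (z0 + s *\<^sub>R (t *\<^sub>R u))" for s
      have uB: "norm u \<le> B" using B norm_ge_zero[of v] by linarith
      have le: "norm (t *\<^sub>R v + s *\<^sub>R (t *\<^sub>R u)) \<le> t * B" "norm (s *\<^sub>R (t *\<^sub>R u)) \<le> t * B"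
        if "0 \<le> s" "s \<le> 1" for s
      proof -
        have "norm (s *\<^sub>R (t *\<^sub>R u)) \<le> t * norm u"
          using that t by (simp add: mult_left_le_one_le)
        moreover have "norm (t *\<^sub>R v) = t * norm v" using t by simp
        moreover have "t * norm u + t * norm v = t * B" by (simp add: B[symmetric] distrib_left)
        moreover have "0 \<le> t * norm v" using t by simp
        ultimately show "norm (t *\<^sub>R v + s *\<^sub>R (t *\<^sub>R u)) \<le> t * B" "norm (s *\<^sub>R (t *\<^sub>R u)) \<le> t * B"
          using norm_triangle_ineq[of "t *\<^sub>R v" "s *\<^sub>R (t *\<^sub>R u)"] by linarith+
      qed
      have inS: "z0 + w \<in> S" if "norm w \<le> t * B" for w
        using r(2) that tB by (auto simp: dist_norm subset_iff)
      have "\<exists>\<xi>>0. \<xi> < 1 \<and> h 1 - h 0 = (1 - 0) * (g' (z0 + t *\<^sub>R v + \<xi> *\<^sub>R (t *\<^sub>R u)) (t *\<^sub>R u) - g' (z0 + \<xi> *\<^sub>R (t *\<^sub>R u)) (t *\<^sub>R u))"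
        unfolding h_def
      proof (rule MVT2)
        fix s :: real assume s: "0 \<le> s" "s \<le> 1"
        show "((\<lambda>s. g (z0 + t *\<^sub>R v + s *\<^sub>R (t *\<^sub>R u)) - g (z0 + s *\<^sub>R (t *\<^sub>R u))) has_real_derivative
           g' (z0 + t *\<^sub>R v + s *\<^sub>R (t *\<^sub>R u)) (t *\<^sub>R u) - g' (z0 + s *\<^sub>R (t *\<^sub>R u)) (t *\<^sub>R u)) (at s)"
          using inS[OF le(1)[OF s]] inS[OF le(2)[OF s]]
          by (intro DERIV_diff has_derivative_along_line g') (auto simp: add.assoc)
      qed simp
      then obtain \<xi> where xi: "0 < \<xi>" "\<xi> < 1" and h: "h 1 - h 0 =
          g' (z0 + t *\<^sub>R v + \<xi> *\<^sub>R (t *\<^sub>R u)) (t *\<^sub>R u) - g' (z0 + \<xi> *\<^sub>R (t *\<^sub>R u)) (t *\<^sub>R u)" by auto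
      define a b where "a = t *\<^sub>R v + \<xi> *\<^sub>R (t *\<^sub>R u)" and "b = \<xi> *\<^sub>R (t *\<^sub>R u)"
      have ab: "norm a \<le> t * B" "norm b \<le> t * B" using le[of \<xi>] xi by (auto simp: a_def b_def)
      have small: "\<bar>g' (z0 + w) (t *\<^sub>R u) - g' z0 (t *\<^sub>R u) - H (t *\<^sub>R u) w\<bar> \<le> \<epsilon> * t\<^sup>2 * B\<^sup>2"
        if "norm w \<le> t * B" for w
      proof -
        have "\<bar>g' (z0 + w) (t *\<^sub>R u) - g' z0 (t *\<^sub>R u) - H (t *\<^sub>R u) w\<bar> \<le> \<epsilon> * norm w * norm (t *\<^sub>R u)"
          using r(3)[of w "t *\<^sub>R u"] that tB by linarith
        also have "\<dots> \<le> \<epsilon> * (t * B) * (t * B)"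
          using that e t uB Bn(3) by (intro mult_mono) auto
        finally show ?thesis by (simp add: power2_eq_square mult_ac)
      qed
      have "H (t *\<^sub>R u) a - H (t *\<^sub>R u) b = t\<^sup>2 * H u v"
        by (simp add: a_def b_def Hl power2_eq_square algebra_simps)
      then have "\<bar>h 1 - h 0 - t\<^sup>2 * H u v\<bar> \<le> 2 * (\<epsilon> * t\<^sup>2 * B\<^sup>2)"
        using small[OF ab(1)] small[OF ab(2)] h by (simp add: a_def b_def add.assoc)
      moreover have "h 1 - h 0 = g (z0 + t *\<^sub>R u + t *\<^sub>R v) - g (z0 + t *\<^sub>R u) - g (z0 + t *\<^sub>R v) + g z0"
        by (simp add: h_def algebra_simps)
      moreover have "0 \<le> \<epsilon> * t\<^sup>2 * B\<^sup>2" using e by simp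
      ultimately show ?thesis by (simp add: mult_ac)
    qed
    have "\<bar>t\<^sup>2 * H u v - t\<^sup>2 * H v u\<bar> \<le> 6 * \<epsilon> * t\<^sup>2 * B\<^sup>2"
      using est[of u v] est[of v u] by (simp add: B_def algebra_simps)
    moreover have "\<bar>t\<^sup>2 * H u v - t\<^sup>2 * H v u\<bar> = t\<^sup>2 * \<bar>H u v - H v u\<bar>"
      unfolding right_diff_distrib[symmetric] abs_mult by simp
    ultimately have "t\<^sup>2 * \<bar>H u v - H v u\<bar> \<le> t\<^sup>2 * (\<epsilon> * (6 * B\<^sup>2))"
      by (simp add: mult_ac)
    then show ?thesis using t by simp
  qed
  have "\<bar>H u v - H v u\<bar> \<le> 0"
  proof (rule ccontr)
    assume ne: "\<not> ?thesis"
    define C where "C = 6 * B\<^sup>2 + 1"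
    have C: "C > 0" by (simp add: C_def add_nonneg_pos)
    define \<epsilon> where "\<epsilon> = \<bar>H u v - H v u\<bar> / (2 * C)"
    have e: "\<epsilon> > 0" using ne C by (simp add: \<epsilon>_def)
    have "\<epsilon> * (6 * B\<^sup>2) < 2 * (\<epsilon> * C)"
      using e by (simp add: C_def algebra_simps add_pos_nonneg)
    also have "2 * (\<epsilon> * C) = \<bar>H u v - H v u\<bar>" using C by (simp add: \<epsilon>_def)
    finally show False using main[OF e] by simp
  qed
  then show ?thesis by simp
qed

text \<open>The mean value theorem for
  \<open>g (z0 + s *\<^sub>R z) - s\<^sup>2 * (H z z / 2)\<close> as a function of \<open>s\<close>
  turns the gradient estimate into an estimate of values on the same ball.\<close>

lemma quadratic_approx:
  assumes crit: "\<And>v. g' z0 v = 0" and e: "\<epsilon> > 0"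
  obtains r where "r > 0"
    "\<And>z. norm z < r \<Longrightarrow> z0 + z \<in> S"
    "\<And>z v. norm z < r \<Longrightarrow> \<bar>g' (z0 + z) v - H v z\<bar> \<le> \<epsilon> * norm z * norm v"
    "\<And>z. norm z < r \<Longrightarrow> \<bar>g (z0 + z) - g z0 - H z z / 2\<bar> \<le> \<epsilon> * (norm z)\<^sup>2"
proof -
  obtain r where r: "r > 0" "ball z0 r \<subseteq> S"
      "\<And>z v. norm z < r \<Longrightarrow> \<bar>g' (z0 + z) v - g' z0 v - H v z\<bar> \<le> \<epsilon> * norm z * norm v"
      using gradient_hessian_approx[OF e] by metis
  show ?thesis
  proof
    show "r > 0" by fact
    show inS: "z0 + z \<in> S" if "norm z < r" for z
      using r(2) that by (auto simp: dist_norm subset_iff)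
    show "\<bar>g' (z0 + z) v - H v z\<bar> \<le> \<epsilon> * norm z * norm v" if "norm z < r" for z v
      using r(3)[OF that, of v] crit by simp
    fix z :: 'b assume z: "norm z < r"
    have sz: "norm (s *\<^sub>R z) \<le> norm z" "norm (s *\<^sub>R z) < r" if "0 \<le> s" "s \<le> 1" for s
      using that z mult_left_le_one_le[of "norm z" s] by auto
    have "\<exists>\<xi>>0. \<xi> < 1 \<and> (g (z0 + 1 *\<^sub>R z) - 1\<^sup>2 * (H z z / 2)) - (g (z0 + 0 *\<^sub>R z) - 0\<^sup>2 * (H z z / 2))
       = (1 - 0) * (g' (z0 + \<xi> *\<^sub>R z) z - \<xi> * H z z)"
    proof (rule MVT2)
      fix s :: real assume s: "0 \<le> s" "s \<le> 1"
      show "((\<lambda>s. g (z0 + s *\<^sub>R z) - s\<^sup>2 * (H z z / 2)) has_real_derivative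
          g' (z0 + s *\<^sub>R z) z - s * H z z) (at s)"
        by (rule derivative_eq_intros has_derivative_along_line g' inS sz[OF s] refl | simp)+
    qed simp
    then obtain \<xi> where xi: "0 < \<xi>" "\<xi> < 1"
      and eq: "g (z0 + z) - g z0 - H z z / 2 = g' (z0 + \<xi> *\<^sub>R z) z - \<xi> * H z z" by auto
    have "\<xi> * H z z = H z (\<xi> *\<^sub>R z)" by (simp add: bilinear_rmul[OF bilinear_hessian])
    then have "\<bar>g (z0 + z) - g z0 - H z z / 2\<bar> \<le> \<epsilon> * norm (\<xi> *\<^sub>R z) * norm z"
      using r(3)[of "\<xi> *\<^sub>R z" z] sz(2)[of \<xi>] xi crit eq by simp
    also have "\<dots> \<le> \<epsilon> * norm z * norm z"
      using sz(1)[of \<xi>] xi e by (intro mult_mono) auto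
    finally show "\<bar>g (z0 + z) - g z0 - H z z / 2\<bar> \<le> \<epsilon> * (norm z)\<^sup>2"
      by (simp add: power2_eq_square mult_ac)
  qed
qed

end

section \<open>Level sets at nondegenerate critical points\<close>

text \<open>The zeros form a relatively closed set, which is the graph of \<open>s\<close>, and a
  function into a compact interval with closed graph is continuous. This takes the place of the
  implicit function theorem.\<close>

lemma unique_zero_continuous:
  fixes F :: "'b::euclidean_space \<Rightarrow> real \<Rightarrow> real"
  assumes cont: "continuous_on (X \<times> {a..b}) (\<lambda>p. F (fst p) (snd p))"
    and uniq: "\<And>x. x \<in> X \<Longrightarrow> \<exists>!s. s \<in> {a..b} \<and> F x s = 0"
  obtains s where "continuous_on X s" "\<And>x. x \<in> X \<Longrightarrow> s x \<in> {a..b}" "\<And>x. x \<in> X \<Longrightarrow> F x (s x) = 0"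
    "\<And>x t. x \<in> X \<Longrightarrow> t \<in> {a..b} \<Longrightarrow> F x t = 0 \<Longrightarrow> t = s x"
proof -
  from uniq obtain s where s: "\<And>x. x \<in> X \<Longrightarrow> s x \<in> {a..b} \<and> F x (s x) = 0"
    and u: "\<And>x t. x \<in> X \<Longrightarrow> t \<in> {a..b} \<Longrightarrow> F x t = 0 \<Longrightarrow> t = s x"
    by metis
  have eq: "(\<lambda>x. (x, s x)) ` X = (X \<times> {a..b}) \<inter> (\<lambda>p. F (fst p) (snd p)) -` {0}"
  proof safe
    fix x t assume "x \<in> X" "t \<in> {a..b}" "F (fst (x, t)) (snd (x, t)) = 0"
    then have "t = s x" using u by simp
    with \<open>x \<in> X\<close> show "(x, t) \<in> (\<lambda>x. (x, s x)) ` X" by blast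
  qed (use s in auto)
  have "closedin (top_of_set (X \<times> {a..b})) ((\<lambda>x. (x, s x)) ` X)"
    unfolding eq by (rule continuous_closedin_preimage[OF cont]) simp
  then have "continuous_on X s"
    by (subst continuous_closed_graph_eq[of "{a..b}"]) (use s in auto)
  with that s u show ?thesis by blast
qed

text \<open>The theorems on extending and contracting maps of spheres speak of relative frontiers of
  convex sets; this presents the round sphere of a linear subspace in that form.\<close>

lemma rel_frontier_subspace_Int_cball:
  fixes N :: "'b::euclidean_space set"
  assumes "subspace N" "r > 0"
  shows "rel_frontier (N \<inter> cball 0 r) = N \<inter> sphere 0 r" "aff_dim (N \<inter> cball 0 r) = int (dim N)"
proof -
  have "0 \<in> ball 0 r \<inter> N" using assms subspace_0 by auto
  then have "interior (cball 0 r) \<inter> N \<noteq> {}" by (metis empty_iff interior_cball)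
  then have "rel_frontier (cball 0 r \<inter> N) = frontier (cball 0 r) \<inter> N"
    by (intro convex_affine_rel_frontier_Int) (use assms in \<open>auto simp only: subspace_imp_affine convex_cball\<close>)
  then show "rel_frontier (N \<inter> cball 0 r) = N \<inter> sphere 0 r"
    using assms by (simp add: Int_commute)
  have "aff_dim (N \<inter> cball 0 r) = aff_dim N"
    using \<open>0 \<in> ball 0 r \<inter> N\<close> assms
    by (intro aff_dim_convex_Int_nonempty_interior) (auto simp: subspace_imp_convex interior_cball)
  then show "aff_dim (N \<inter> cball 0 r) = int (dim N)"
    using aff_dim_subspace assms by simp
qed

text \<open>A contraction would extend the identity of the sphere to a retraction \<open>g\<close>
  of the whole space onto it, and the negative of \<open>g\<close> would map the ball to itself. Its
  Brouwer fixed point lies on the sphere, where \<open>g\<close> is the identity, and so equals its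
  own negative. This includes the sphere of a line, which is a pair of points.\<close>

lemma not_contractible_subspace_sphere:
  fixes N :: "'b::euclidean_space set"
  assumes N: "subspace N" "N \<noteq> {0}" and r: "r > 0"
  shows "\<not> contractible (N \<inter> sphere 0 r)"
proof
  let ?S = "N \<inter> sphere 0 r"
  let ?B = "N \<inter> cball 0 r"
  assume "contractible ?S"
  then obtain a where a: "homotopic_with_canon (\<lambda>x. True) ?S ?S id (\<lambda>x. a)"
    by (auto simp: contractible_def)
  have fr: "rel_frontier ?B = ?S" by (rule rel_frontier_subspace_Int_cball[OF N(1) r])
  obtain v where "v \<in> N" "v \<noteq> 0" using N subspace_0 by blast
  then have "(r / norm v) *\<^sub>R v \<in> ?S" using N r by (auto simp: subspace_scale)
  then have ne: "?S \<noteq> {}" by blast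
  have comp: "compact ?B" by (simp add: N closed_subspace closed_Int_compact)
  have "closed ?S" by (simp add: N closed_subspace closed_Int)
  have "\<exists>g. continuous_on UNIV g \<and> range g \<subseteq> rel_frontier ?B \<and> (\<forall>x \<in> ?S. g x = id x)"
    using a \<open>closed ?S\<close> ne N(1) compact_imp_bounded[OF comp]
    by (subst nullhomotopic_into_rel_frontier_extension[symmetric])
      (simp_all add: fr subspace_imp_convex convex_Int, metis)
  then obtain g where g: "continuous_on UNIV g" "range g \<subseteq> ?S" "\<And>x. x \<in> ?S \<Longrightarrow> g x = x"
    unfolding fr by auto
  have "continuous_on ?B (\<lambda>x. - g x)"
    using g(1) by (intro continuous_on_minus) (rule continuous_on_subset, auto)
  moreover have mS: "- x \<in> ?S" if "x \<in> ?S" for x using that N by (auto simp: subspace_neg)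
  have gS: "- g x \<in> ?S" for x using g(2) by (intro mS) blast
  then have "(\<lambda>x. - g x) \<in> ?B \<rightarrow> ?B" using sphere_cball by blast
  moreover have "convex ?B" using N by (simp add: subspace_imp_convex convex_Int)
  moreover have "?B \<noteq> {}" using ne sphere_cball[of 0 r] by blast
  ultimately obtain x where x: "x \<in> ?B" "- g x = x"
    using brouwer[OF comp, of "\<lambda>x. - g x"] by metis
  then have "x \<in> ?S" using gS by metis
  then have "- x = x" using g(3) x by simp
  then have "x = 0" by (metis add.right_inverse scaleR_2 scaleR_eq_0_iff zero_neq_numeral)
  with \<open>x \<in> ?S\<close> r show False by auto
qed

text \<open>A nondegenerate critical point moved to 0, with critical value 0. Only
  \<open>approx\<close> ties \<open>g\<close> to \<open>H\<close>; stating it for every \<epsilon>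
  lets each lemma choose its own accuracy. The assumptions are symmetric under negating
  \<open>g\<close> and \<open>H\<close> and exchanging \<open>N\<close> and \<open>P\<close>, so one
  of two mirror cases suffices later.\<close>

locale quadratic_saddle =
  fixes g :: "'b::euclidean_space \<Rightarrow> real" and g' H :: "'b \<Rightarrow> 'b \<Rightarrow> real" and N P :: "'b set" and m :: real
  assumes bil: "bilinear H" and sN: "subspace N" and sP: "subspace P" and NP: "N \<inter> P = {0}"
    and sum: "\<And>z. \<exists>x\<in>N. \<exists>y\<in>P. z = x + y"
    and orth: "\<And>x y. x \<in> N \<Longrightarrow> y \<in> P \<Longrightarrow> H x y = 0" "\<And>x y. x \<in> N \<Longrightarrow> y \<in> P \<Longrightarrow> H y x = 0"
    and m: "m > 0"
    and neg: "\<And>x. x \<in> N \<Longrightarrow> H x x \<le> - m * (norm x)\<^sup>2"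
    and pos: "\<And>y. y \<in> P \<Longrightarrow> H y y \<ge> m * (norm y)\<^sup>2"
    and approx: "\<And>\<epsilon>. \<epsilon> > 0 \<Longrightarrow> \<exists>r>0. \<forall>z. norm z < r \<longrightarrow> (g has_derivative g' z) (at z) \<and>
      (\<forall>v. \<bar>g' z v - H v z\<bar> \<le> \<epsilon> * norm z * norm v) \<and> \<bar>g z - H z z / 2\<bar> \<le> \<epsilon> * (norm z)\<^sup>2"
begin

lemmas H_simps = bilinear_ladd[OF bil] bilinear_radd[OF bil] bilinear_lmul[OF bil] bilinear_rmul[OF bil]
    bilinear_lzero[OF bil] bilinear_rzero[OF bil] bilinear_lneg[OF bil] bilinear_rneg[OF bil]
    bilinear_lsub[OF bil] bilinear_rsub[OF bil]

lemma dual: "quadratic_saddle (\<lambda>z. - g z) (\<lambda>z v. - g' z v) (\<lambda>u v. - H u v) P N m"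
proof
  show "bilinear (\<lambda>u v. - H u v)" using bil by (auto simp: bilinear_def linear_compose_neg)
  show "P \<inter> N = {0}" using NP by auto
  show "\<exists>x\<in>P. \<exists>y\<in>N. z = x + y" for z using sum[of z] by (metis add.commute)
  show "- H x x \<le> - m * (norm x)\<^sup>2" if "x \<in> P" for x using pos[OF that] by simp
  show "- H x x \<ge> m * (norm x)\<^sup>2" if "x \<in> N" for x using neg[OF that] by simp
  fix \<epsilon> :: real assume "\<epsilon> > 0"
  from approx[OF this] obtain r where "r > 0" and r: "\<And>z. norm z < r \<Longrightarrow> (g has_derivative g' z) (at z) \<and>
      (\<forall>v. \<bar>g' z v - H v z\<bar> \<le> \<epsilon> * norm z * norm v) \<and> \<bar>g z - H z z / 2\<bar> \<le> \<epsilon> * (norm z)\<^sup>2" by blast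
  have "((\<lambda>z. - g z) has_derivative (\<lambda>v. - g' z v)) (at z) \<and>
      (\<forall>v. \<bar>- g' z v - - H v z\<bar> \<le> \<epsilon> * norm z * norm v) \<and> \<bar>- g z - - H z z / 2\<bar> \<le> \<epsilon> * (norm z)\<^sup>2"
    if "norm z < r" for z
    using r[OF that] has_derivative_minus[of g "g' z" "at z"]
    by (auto simp: abs_minus_commute)
  then show "\<exists>r>0. \<forall>z. norm z < r \<longrightarrow> ((\<lambda>z. - g z) has_derivative (\<lambda>v. - g' z v)) (at z) \<and>
      (\<forall>v. \<bar>- g' z v - - H v z\<bar> \<le> \<epsilon> * norm z * norm v) \<and> \<bar>- g z - - H z z / 2\<bar> \<le> \<epsilon> * (norm z)\<^sup>2"
    using \<open>r > 0\<close> by blast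
qed (use sP sN m orth in auto)

lemma value_at_0: "g 0 = 0"
proof -
  obtain r where "r > 0" "\<And>z. norm z < r \<Longrightarrow> \<bar>g z - H z z / 2\<bar> \<le> 1 * (norm z)\<^sup>2"
    using approx[of 1] by auto
  from this(1) this(2)[of 0] show ?thesis by (simp add: H_simps)
qed

lemma dim_sum: "dim N + dim P = DIM('b)"
proof -
  have "{x + y |x y. x \<in> N \<and> y \<in> P} = UNIV" using sum by blast
  then show ?thesis using dim_sums_Int[OF sN sP] NP by simp
qed

text \<open>On \<open>N\<close> and on \<open>P\<close> the form has absolute value at least
  \<open>m * (norm z)\<^sup>2\<close>, whereas at a zero of \<open>g\<close> the estimate allows at
  most half of that.\<close>

lemma zero_set:
  obtains r where "r > 0" "\<And>x y. x \<in> N \<Longrightarrow> y \<in> P \<Longrightarrow> norm (x + y) < r \<Longrightarrow> x + y \<noteq> 0 \<Longrightarrow>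
    g (x + y) = 0 \<Longrightarrow> x \<noteq> 0 \<and> y \<noteq> 0"
proof -
  obtain r where "r > 0" and r: "\<And>z. norm z < r \<Longrightarrow> \<bar>g z - H z z / 2\<bar> \<le> m / 4 * (norm z)\<^sup>2"
    using approx[of "m / 4"] m by auto
  show ?thesis
  proof (rule that[OF \<open>r > 0\<close>])
    fix x y assume *: "x \<in> N" "y \<in> P" "norm (x + y) < r" "x + y \<noteq> 0" "g (x + y) = 0"
    have e: "\<bar>H (x + y) (x + y)\<bar> \<le> m / 2 * (norm (x + y))\<^sup>2" using r[OF *(3)] *(5) by simp
    have p: "m / 2 * (norm (x + y))\<^sup>2 > 0" using m *(4) by simp
    show "x \<noteq> 0 \<and> y \<noteq> 0"
      using e p pos[OF *(2)] neg[OF *(1)] by auto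
  qed
qed

text \<open>The direction \<open>y - x\<close> is decisive at \<open>x + y\<close>: orthogonality
  gives \<open>H (y - x) (x + y) = H y y - H x x\<close>, which is at least \<open>m\<close> times
  the sum of the squared norms. The accuracy \<open>m / 4\<close> keeps the error within half of
  this.\<close>

lemma gradient_nonzero:
  obtains r where "r > 0" "\<And>z. z \<noteq> 0 \<Longrightarrow> norm z < r \<Longrightarrow> g' z \<noteq> (\<lambda>v. 0)"
proof -
  obtain r where "r > 0" and r: "\<And>z v. norm z < r \<Longrightarrow> \<bar>g' z v - H v z\<bar> \<le> m / 4 * norm z * norm v"
    using approx[of "m / 4"] m by auto
  show ?thesis
  proof (rule that[OF \<open>r > 0\<close>])
    fix z :: 'b assume z: "z \<noteq> 0" "norm z < r"
    obtain x y where xy: "x \<in> N" "y \<in> P" "z = x + y" using sum by blast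
    define q where "q = (norm x)\<^sup>2 + (norm y)\<^sup>2"
    have q: "q > 0" using z xy(3) unfolding q_def
      by (metis add.right_neutral norm_eq_zero sum_power2_gt_zero_iff)
    have "H (y - x) z = H y y - H x x" by (simp add: xy(3) H_simps orth xy)
    then have 1: "H (y - x) z \<ge> m * q"
      using pos[OF xy(2)] neg[OF xy(1)] by (simp add: q_def distrib_left)
    have "norm z * norm (y - x) \<le> (norm x + norm y) * (norm x + norm y)"
      unfolding xy(3) using norm_triangle_ineq[of x y] norm_triangle_ineq4[of y x]
      by (intro mult_mono) auto
    also have "\<dots> \<le> 2 * q"
      using zero_le_power2[of "norm x - norm y"] by (simp add: q_def power2_eq_square algebra_simps)
    finally have "m / 4 * (norm z * norm (y - x)) \<le> m / 4 * (2 * q)"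
      using m by (intro mult_left_mono) auto
    then have "\<bar>g' z (y - x) - H (y - x) z\<bar> \<le> (m * q) / 2"
      using r[OF z(2), of "y - x"] by (simp add: mult_ac)
    moreover have "m * q > 0" using m q by simp
    ultimately have "g' z (y - x) > 0" using 1 by linarith
    then show "g' z \<noteq> (\<lambda>v. 0)" by auto
  qed
qed

text \<open>For nonzero \<open>x\<close> in \<open>N\<close>, the function \<open>g\<close> on the
  ray from \<open>x\<close> in direction \<eta> is negative up to the height
  \<open>\<kappa> * norm x\<close>, strictly increasing from there on, and positive at the height
  \<open>S\<close>. These facts are \<open>low\<close>, \<open>inc\<close> and \<open>high\<close>;
  they leave exactly one zero, which then depends continuously on \<open>x\<close>.\<close>

lemma zero_section:
  assumes eta: "\<eta> \<in> P" "norm \<eta> = 1" and rho: "\<rho> > 0"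
  obtains r s where "r > 0" "continuous_on (N \<inter> cball 0 r) s" "s 0 = 0"
    "\<And>x. x \<in> N \<inter> cball 0 r \<Longrightarrow> 0 \<le> s x \<and> s x \<le> \<rho> \<and> g (x + s x *\<^sub>R \<eta>) = 0"
proof -
  obtain K where K: "K > 0" "\<And>u v. \<bar>H u v\<bar> \<le> K * norm u * norm v"
    using bilinear_bounded_pos[OF bil] by auto
  \<comment> \<open>Chosen for \<open>K * \<kappa>\<^sup>2 \<le> m / 2\<close>: over
    \<open>N\<close>, at slope at most \<kappa>, the positive part of the form is at most half as
    large as the negative one. The same bound serves \<open>high\<close> with the two parts
    exchanged.\<close>
  define \<kappa> where "\<kappa> = min 1 (m / (2 * K))"
  have kap: "\<kappa> > 0" "\<kappa> \<le> 1" using K m by (auto simp: \<kappa>_def)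
  have kap2: "K * \<kappa>\<^sup>2 \<le> m / 2"
  proof -
    have "K * \<kappa>\<^sup>2 \<le> K * (\<kappa> * 1)" unfolding power2_eq_square using kap K by (intro mult_left_mono) auto
    also have "\<dots> \<le> K * (m / (2 * K))" using K by (intro mult_left_mono) (auto simp: \<kappa>_def)
    also have "\<dots> = m / 2" using K by simp
    finally show ?thesis .
  qed
  \<comment> \<open>The first bound is for values, at points of norm at most
    \<open>2 * norm x\<close> or \<open>2 * S\<close>; the second is for the derivative, where
    \<open>norm x \<le> u / \<kappa>\<close> bounds the norm of the point by
    \<open>(1 / \<kappa> + 1) * u\<close>.\<close>
  define \<epsilon> where "\<epsilon> = min (m / 32) (m / (2 * (1 / \<kappa> + 1)))"
  have "1 / \<kappa> + 1 > 0" using kap by (simp add: add_pos_pos)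
  have eps: "\<epsilon> > 0" "\<epsilon> \<le> m / 32" "\<epsilon> * (1 / \<kappa> + 1) \<le> m / 2"
  proof -
    show "\<epsilon> > 0" using m \<open>1 / \<kappa> + 1 > 0\<close> by (simp add: \<epsilon>_def)
    show "\<epsilon> \<le> m / 32" unfolding \<epsilon>_def by (rule min.cobounded1)
    have "\<epsilon> \<le> m / (2 * (1 / \<kappa> + 1))" unfolding \<epsilon>_def by (rule min.cobounded2)
    then have "\<epsilon> * (1 / \<kappa> + 1) \<le> m / (2 * (1 / \<kappa> + 1)) * (1 / \<kappa> + 1)"
      using \<open>1 / \<kappa> + 1 > 0\<close> by (intro mult_right_mono) auto
    also have "\<dots> = m / 2" using \<open>1 / \<kappa> + 1 > 0\<close> by (metis divide_divide_eq_left' mult.commute nonzero_divide_eq_eq order_less_irrefl)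
    finally show "\<epsilon> * (1 / \<kappa> + 1) \<le> m / 2" .
  qed
  obtain r where "r > 0" and der: "\<And>z. norm z < r \<Longrightarrow> (g has_derivative g' z) (at z)"
    and r1: "\<And>z v. norm z < r \<Longrightarrow> \<bar>g' z v - H v z\<bar> \<le> \<epsilon> * norm z * norm v"
    and r2: "\<And>z. norm z < r \<Longrightarrow> \<bar>g z - H z z / 2\<bar> \<le> \<epsilon> * (norm z)\<^sup>2"
    using approx[OF eps(1)] by blast
  define S where "S = min \<rho> (r / 3)"
  have S: "0 < S" "S \<le> \<rho>" "S \<le> r / 3" using \<open>r > 0\<close> rho by (auto simp: S_def)
  \<comment> \<open>With \<open>norm x \<le> \<kappa> * S\<close>, the end point
    \<open>x + S *\<^sub>R \<eta>\<close> lies in the cone where the positive part of the form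
    prevails.\<close>
  define \<delta> where "\<delta> = \<kappa> * S"
  have dl: "0 < \<delta>" "\<delta> \<le> S" using kap S by (auto simp: \<delta>_def mult_left_le_one_le)
  define X where "X = N \<inter> cball 0 \<delta>"
  have nz: "norm (x + s *\<^sub>R \<eta>) \<le> norm x + s" if "0 \<le> s" for x s
    using norm_triangle_ineq[of x "s *\<^sub>R \<eta>"] that eta by simp
  have nr: "norm (x + s *\<^sub>R \<eta>) < r" if "x \<in> X" "0 \<le> s" "s \<le> S" for x s
    using nz[OF that(2), of x] that S dl \<open>r > 0\<close> by (auto simp: X_def)
  have Hz: "H (x + s *\<^sub>R \<eta>) (x + s *\<^sub>R \<eta>) = H x x + s\<^sup>2 * H \<eta> \<eta>" if "x \<in> X" for x s
    using that eta by (simp add: X_def H_simps orth power2_eq_square)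
  have Hee: "m \<le> H \<eta> \<eta>" "H \<eta> \<eta> \<le> K" using pos[OF eta(1)] K(2)[of \<eta> \<eta>] eta by auto
  have low: "g (x + s *\<^sub>R \<eta>) < 0" if x: "x \<in> X" "x \<noteq> 0" and s: "0 \<le> s" "s \<le> \<kappa> * norm x" for x s
  proof -
    have "\<kappa> * norm x \<le> norm x" using kap by (simp add: mult_left_le_one_le)
    moreover have "\<kappa> * norm x \<le> S"
      using x kap dl by (smt (verit) Int_iff X_def calculation mem_cball_0)
    ultimately have sx: "s \<le> norm x" "s \<le> S" using s by auto
    have "norm (x + s *\<^sub>R \<eta>) \<le> 2 * norm x" using nz[OF s(1), of x] sx by simp
    then have "(norm (x + s *\<^sub>R \<eta>))\<^sup>2 \<le> (2 * norm x)\<^sup>2" by (intro power_mono) auto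
    then have "\<epsilon> * (norm (x + s *\<^sub>R \<eta>))\<^sup>2 \<le> m / 32 * (2 * norm x)\<^sup>2"
      using eps by (intro mult_mono) auto
    then have a: "\<bar>g (x + s *\<^sub>R \<eta>) - H (x + s *\<^sub>R \<eta>) (x + s *\<^sub>R \<eta>) / 2\<bar> \<le> m / 8 * (norm x)\<^sup>2"
      using r2[OF nr[OF x(1) s(1) sx(2)]] by (simp add: power_mult_distrib)
    have "s\<^sup>2 * H \<eta> \<eta> \<le> (\<kappa> * norm x)\<^sup>2 * K"
      using s Hee m by (intro mult_mono power_mono) auto
    also have "\<dots> = K * \<kappa>\<^sup>2 * (norm x)\<^sup>2" by (simp add: power_mult_distrib)
    also have "\<dots> \<le> m / 2 * (norm x)\<^sup>2" using kap2 by (intro mult_right_mono) auto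
    finally have "H (x + s *\<^sub>R \<eta>) (x + s *\<^sub>R \<eta>) \<le> - m / 2 * (norm x)\<^sup>2"
      using Hz[OF x(1), of s] neg[of x] x by (simp add: X_def)
    moreover have "m * (norm x)\<^sup>2 > 0" using x m by simp
    ultimately show ?thesis using a by linarith
  qed
  have inc: "g (x + s *\<^sub>R \<eta>) < g (x + t *\<^sub>R \<eta>)"
    if x: "x \<in> X" and s: "\<kappa> * norm x \<le> s" "s < t" "t \<le> S" for x s t
  proof -
    have s0: "0 \<le> s" using s(1) kap by (meson mult_nonneg_nonneg norm_ge_zero order.trans less_imp_le)
    have d: "((\<lambda>u. g (x + u *\<^sub>R \<eta>)) has_real_derivative g' (x + u *\<^sub>R \<eta>) \<eta>) (at u)" if "s \<le> u" "u \<le> t" for u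
    proof -
      have D: "(g has_derivative g' (x + u *\<^sub>R \<eta>)) (at (x + u *\<^sub>R \<eta>))"
        using that s s0 by (intro der nr x) auto
      show ?thesis by (rule has_derivative_along_line[OF D])
    qed
    show ?thesis
    proof (rule DERIV_pos_imp_increasing_open[OF s(2)])
      fix u assume u: "s < u" "u < t"
      have u0: "u > 0" using s0 u by simp
      have nx: "norm x \<le> u / \<kappa>" using s(1) u kap by (simp add: field_simps)
      have "norm (x + u *\<^sub>R \<eta>) \<le> (1 / \<kappa> + 1) * u"
        using nz[of u x] u0 nx by (simp add: distrib_right)
      then have "\<epsilon> * norm (x + u *\<^sub>R \<eta>) \<le> \<epsilon> * ((1 / \<kappa> + 1) * u)"
        using eps by (intro mult_left_mono) auto
      also have "\<dots> = (\<epsilon> * (1 / \<kappa> + 1)) * u" by simp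
      also have "\<dots> \<le> m / 2 * u" using eps u0 by (intro mult_right_mono) auto
      finally have a: "\<epsilon> * norm (x + u *\<^sub>R \<eta>) \<le> m / 2 * u" .
      have h1: "H \<eta> (x + u *\<^sub>R \<eta>) = u * H \<eta> \<eta>" using x eta by (simp add: H_simps orth X_def)
      have h2: "u * m \<le> u * H \<eta> \<eta>" using u0 Hee by (intro mult_left_mono) auto
      have h3: "u * m > 0" using u0 m by simp
      have "\<bar>g' (x + u *\<^sub>R \<eta>) \<eta> - H \<eta> (x + u *\<^sub>R \<eta>)\<bar> \<le> (u * m) / 2"
        using r1[OF nr[OF x, of u], of \<eta>] u u0 s(3) a eta by (simp add: mult.commute)
      then have "g' (x + u *\<^sub>R \<eta>) \<eta> > 0" using h1 h2 h3 by linarith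
      then show "\<exists>y. ((\<lambda>u. g (x + u *\<^sub>R \<eta>)) has_real_derivative y) (at u) \<and> y > 0"
        using d[of u] u by auto
    next
      show "continuous_on {s..t} (\<lambda>u. g (x + u *\<^sub>R \<eta>))"
        by (rule DERIV_atLeastAtMost_imp_continuous_on) (use d in blast)
    qed
  qed
  have high: "g (x + S *\<^sub>R \<eta>) > 0" if x: "x \<in> X" for x
  proof -
    have nx: "norm x \<le> \<kappa> * S" "norm x \<le> S" using x dl by (auto simp: X_def \<delta>_def)
    have "norm (x + S *\<^sub>R \<eta>) \<le> 2 * S" using nz[of S x] nx S by simp
    then have "(norm (x + S *\<^sub>R \<eta>))\<^sup>2 \<le> (2 * S)\<^sup>2" by (intro power_mono) auto
    then have "\<epsilon> * (norm (x + S *\<^sub>R \<eta>))\<^sup>2 \<le> m / 32 * (2 * S)\<^sup>2"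
      using eps by (intro mult_mono) auto
    then have a: "\<bar>g (x + S *\<^sub>R \<eta>) - H (x + S *\<^sub>R \<eta>) (x + S *\<^sub>R \<eta>) / 2\<bar> \<le> m / 8 * S\<^sup>2"
      using r2[OF nr[OF x, of S]] S by (simp add: power_mult_distrib)
    have "\<bar>H x x\<bar> \<le> K * (norm x)\<^sup>2" using K(2)[of x x] by (simp add: power2_eq_square)
    also have "\<dots> \<le> K * (\<kappa> * S)\<^sup>2" using nx K by (intro mult_left_mono power_mono) auto
    also have "\<dots> = K * \<kappa>\<^sup>2 * S\<^sup>2" by (simp add: power_mult_distrib)
    also have "\<dots> \<le> m / 2 * S\<^sup>2" using kap2 by (intro mult_right_mono) auto
    finally have "H (x + S *\<^sub>R \<eta>) (x + S *\<^sub>R \<eta>) \<ge> S\<^sup>2 * H \<eta> \<eta> - m / 2 * S\<^sup>2"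
      using Hz[OF x, of S] by simp
    moreover have "S\<^sup>2 * H \<eta> \<eta> \<ge> S\<^sup>2 * m" using Hee by (intro mult_left_mono) auto
    moreover have "m * S\<^sup>2 > 0" using S m by simp
    moreover have "S\<^sup>2 * m = m * S\<^sup>2" by simp
    ultimately show ?thesis using a by linarith
  qed
  have contg: "continuous_on (ball 0 r) g"
    by (rule has_derivative_continuous_on) (use der in \<open>auto intro: has_derivative_at_withinI\<close>)
  have cont: "continuous_on (X \<times> {0..S}) (\<lambda>p. g (fst p + snd p *\<^sub>R \<eta>))"
    by (rule continuous_on_compose2[OF contg]) (auto intro!: continuous_intros nr)
  have ex: "\<exists>!s. s \<in> {0..S} \<and> g (x + s *\<^sub>R \<eta>) = 0" if x: "x \<in> X" for x
  proof -
    define a where "a = \<kappa> * norm x"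
    have a: "0 \<le> a" "a \<le> S"
      using x kap dl S by (auto simp: a_def X_def mult_le_one intro: order_trans[OF mult_left_le_one_le])
    have ga: "g (x + a *\<^sub>R \<eta>) \<le> 0"
      using low[OF x _ a(1)] value_at_0 by (cases "x = 0") (auto simp: a_def)
    have "continuous_on {a..S} (\<lambda>s. g (x + s *\<^sub>R \<eta>))"
      by (rule continuous_on_compose2[OF contg]) (use a x in \<open>auto intro!: continuous_intros nr\<close>)
    then obtain s where s: "a \<le> s" "s \<le> S" "g (x + s *\<^sub>R \<eta>) = 0"
      using IVT'[of "\<lambda>s. g (x + s *\<^sub>R \<eta>)" a 0 S] ga high[OF x] a by auto
    have ge: "a \<le> t" if "0 \<le> t" "g (x + t *\<^sub>R \<eta>) = 0" for t
      using low[OF x _ that(1)] that by (cases "x = 0") (force simp: a_def)+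
    show ?thesis
    proof (rule ex1I[of _ s])
      show "s \<in> {0..S} \<and> g (x + s *\<^sub>R \<eta>) = 0" using s a by auto
      fix t assume t: "t \<in> {0..S} \<and> g (x + t *\<^sub>R \<eta>) = 0"
      then show "t = s"
        using inc[OF x, of s t] inc[OF x, of t s] s ge[of t] by (fastforce simp: a_def)
    qed
  qed
  obtain s where s: "continuous_on X s" "\<And>x. x \<in> X \<Longrightarrow> s x \<in> {0..S}"
     "\<And>x. x \<in> X \<Longrightarrow> g (x + s x *\<^sub>R \<eta>) = 0"
     "\<And>x t. x \<in> X \<Longrightarrow> t \<in> {0..S} \<Longrightarrow> g (x + t *\<^sub>R \<eta>) = 0 \<Longrightarrow> t = s x"
    by (rule unique_zero_continuous[OF cont ex], assumption) (rule that)
  have "0 \<in> X" using sN dl by (auto simp: X_def subspace_0)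
  then have "s 0 = 0" using s(4)[of 0 0] value_at_0 S by simp
  have "0 \<le> s x \<and> s x \<le> \<rho> \<and> g (x + s x *\<^sub>R \<eta>) = 0" if "x \<in> N \<inter> cball 0 \<delta>" for x
    using s(2)[of x] s(3)[of x] S(2) that by (simp add: X_def)
  with \<open>s 0 = 0\<close> s(1) dl(1) show ?thesis
    by (intro that[of \<delta> s]) (simp_all only: X_def)
qed

end

section \<open>Non-flatness of the zero set at a saddle\<close>

lemma subspace_dim_1E:
  fixes T :: "'b::euclidean_space set"
  assumes "subspace T" "dim T = 1"
  obtains t where "norm t = 1" "t \<in> T" "\<And>y. y \<in> T \<Longrightarrow> y = (y \<bullet> t) *\<^sub>R t"
proof -
  have "T \<noteq> {0}" using assms by auto
  then obtain v where v: "v \<in> T" "v \<noteq> 0" using assms subspace_0 by blast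
  define t where "t = v /\<^sub>R norm v"
  have t: "norm t = 1" "t \<in> T" using v assms by (auto simp: t_def subspace_scale)
  have "t \<noteq> 0" using t by auto
  have "span {t} = T"
    using assms t \<open>t \<noteq> 0\<close> by (intro subspace_dim_equal) (auto simp: span_minimal)
  then have "y = (y \<bullet> t) *\<^sub>R t" if y: "y \<in> T" for y
  proof -
    obtain c where "y = c *\<^sub>R t" using y \<open>span {t} = T\<close> by (auto simp: span_singleton)
    then show ?thesis using t by (simp add: norm_eq_1)
  qed
  with t that show ?thesis by blast
qed

lemma connected_same_sign:
  fixes \<phi> :: "'b::topological_space \<Rightarrow> real"
  assumes "connected C" "continuous_on C \<phi>" "\<And>z. z \<in> C \<Longrightarrow> \<phi> z \<noteq> 0" "u \<in> C" "v \<in> C" "\<phi> u > 0"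
  shows "\<phi> v > 0"
proof (rule ccontr)
  assume "\<not> \<phi> v > 0"
  moreover have "connected (\<phi> ` C)" using assms connected_continuous_image by blast
  ultimately have "0 \<in> \<phi> ` C"
    using connectedD_interval[of "\<phi> ` C" "\<phi> v" "\<phi> u" 0] assms by simp
  with assms(3) show False by force
qed

context quadratic_saddle
begin

definition prN :: "'b \<Rightarrow> 'b" where "prN z = (SOME x. x \<in> N \<and> z - x \<in> P)"

lemma prN_in: "prN z \<in> N" and prN_compl: "z - prN z \<in> P"
proof -
  obtain x y where "x \<in> N" "y \<in> P" "z = x + y" using sum by blast
  then have "x \<in> N \<and> z - x \<in> P" by simp
  then have "prN z \<in> N \<and> z - prN z \<in> P" unfolding prN_def by (rule someI)
  then show "prN z \<in> N" "z - prN z \<in> P" by auto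
qed

lemma prN_unique:
  assumes "x \<in> N" "z - x \<in> P" shows "prN z = x"
proof -
  have "prN z - x \<in> N" using assms prN_in sN by (simp add: subspace_diff)
  moreover have "prN z - x = (z - x) - (z - prN z)" by simp
  then have "prN z - x \<in> P" using assms prN_compl sP by (metis subspace_diff)
  ultimately have "prN z - x \<in> N \<inter> P" by blast
  then show ?thesis using NP by simp
qed

lemma linear_prN: "linear prN"
proof (rule linearI)
  fix u v c
  have "u + v - (prN u + prN v) \<in> P"
    using subspace_add[OF sP prN_compl[of u] prN_compl[of v]] by (simp add: algebra_simps)
  then show "prN (u + v) = prN u + prN v"
    using prN_in sN by (intro prN_unique) (auto simp: subspace_add)
  have "c *\<^sub>R u - c *\<^sub>R prN u \<in> P"
    using subspace_scale[OF sP prN_compl[of u]] by (simp add: algebra_simps)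
  then show "prN (c *\<^sub>R u) = c *\<^sub>R prN u"
    using prN_in sN by (intro prN_unique) (auto simp: subspace_scale)
qed

lemma continuous_prN: "continuous_on S prN"
  using linear_prN linear_continuous_on linear_conv_bounded_linear by blast

lemma unit_vector_in:
  assumes "subspace W" "W \<noteq> {0}" obtains \<eta> :: 'b where "\<eta> \<in> W" "norm \<eta> = 1"
proof -
  obtain v where "v \<in> W" "v \<noteq> 0" using assms subspace_0 by blast
  then show ?thesis using assms that[of "v /\<^sub>R norm v"] by (auto simp: subspace_scale)
qed

text \<open>\<open>Q\<close> stands for a neighbourhood of the critical point in its level
  component, not in its level set; what is known is that it absorbs the connected pieces of the zero
  set that contain 0 and lie in the ball of radius \<open>r2\<close>. The graph of the section is
  such a piece: it is connected, contains 0 as \<open>s 0 = 0\<close>, and its points have norm at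
  most \<open>2 * r2 / 3\<close>.\<close>

lemma connected_section:
  assumes Q: "Q \<subseteq> {z. g z = 0}"
    and r2: "r2 > 0" "\<And>C. connected C \<Longrightarrow> 0 \<in> C \<Longrightarrow> C \<subseteq> {z. g z = 0} \<inter> ball 0 r2 \<Longrightarrow> C \<subseteq> Q"
    and eta: "\<eta> \<in> P" "norm \<eta> = 1"
  obtains r s where "r > 0" "continuous_on (N \<inter> cball 0 r) s"
    "\<And>x. x \<in> N \<inter> cball 0 r \<Longrightarrow> 0 \<le> s x \<and> x + s x *\<^sub>R \<eta> \<in> Q"
proof -
  obtain r s where r: "r > 0" and s: "continuous_on (N \<inter> cball 0 r) s" "s 0 = 0"
    "\<And>x. x \<in> N \<inter> cball 0 r \<Longrightarrow> 0 \<le> s x \<and> s x \<le> r2 / 3 \<and> g (x + s x *\<^sub>R \<eta>) = 0"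
    using zero_section[OF eta, of "r2 / 3"] r2(1) by auto
  define r' where "r' = min r (r2 / 3)"
  have r': "r' > 0" "r' \<le> r" "r' \<le> r2 / 3" using r r2 by (auto simp: r'_def)
  let ?X = "N \<inter> cball 0 r'"
  have sub: "?X \<subseteq> N \<inter> cball 0 r" using r' by auto
  have cs: "continuous_on ?X s" using s(1) sub continuous_on_subset by blast
  define C where "C = (\<lambda>x. x + s x *\<^sub>R \<eta>) ` ?X"
  have "convex ?X" using sN by (simp add: subspace_imp_convex convex_Int)
  then have "connected C"
    unfolding C_def by (intro connected_continuous_image continuous_intros cs convex_connected)
  moreover have "0 \<in> ?X" using sN r' by (simp add: subspace_0)
  then have "0 \<in> C" unfolding C_def using s(2) by force
  moreover have "C \<subseteq> {z. g z = 0} \<inter> ball 0 r2"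
  proof
    fix z assume "z \<in> C"
    then obtain x where x: "x \<in> ?X" and z: "z = x + s x *\<^sub>R \<eta>" by (auto simp: C_def)
    then have x': "0 \<le> s x \<and> s x \<le> r2 / 3 \<and> g z = 0" using s(3)[of x] sub by blast
    have "norm z \<le> norm x + s x"
      using norm_triangle_ineq[of x "s x *\<^sub>R \<eta>"] x' eta by (simp add: z)
    then show "z \<in> {z. g z = 0} \<inter> ball 0 r2" using x x' r' r2(1) by auto
  qed
  ultimately have "C \<subseteq> Q" by (rule r2(2))
  show ?thesis
  proof (rule that[OF r'(1) cs])
    fix x assume x: "x \<in> ?X"
    then show "0 \<le> s x \<and> x + s x *\<^sub>R \<eta> \<in> Q" using s(3)[of x] sub \<open>C \<subseteq> Q\<close> by (auto simp: C_def)
  qed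
qed

text \<open>The section over a small sphere of \<open>N\<close> would be nullhomotopic in the punctured neighbourhood
  for dimensional reasons, although the projection along \<open>P\<close> retracts it onto that sphere.\<close>

lemma not_flat_lowdim:
  fixes T :: "'b set"
  assumes Q: "Q \<subseteq> {z. g z = 0}" "0 \<in> Q"
    and nz: "\<And>z. z \<in> Q \<Longrightarrow> z \<noteq> 0 \<Longrightarrow> prN z \<noteq> 0"
    and r2: "r2 > 0" "\<And>C. connected C \<Longrightarrow> 0 \<in> C \<Longrightarrow> C \<subseteq> {z. g z = 0} \<inter> ball 0 r2 \<Longrightarrow> C \<subseteq> Q"
    and T: "subspace T" "dim N < dim T" and d: "d > 0"
    and hom: "homeomorphism Q (T \<inter> ball 0 d) h k" and h0: "h 0 = 0"
    and ne: "N \<noteq> {0}" "P \<noteq> {0}"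
  shows False
proof -
  obtain \<eta> where eta: "\<eta> \<in> P" "norm \<eta> = 1" using unit_vector_in[OF sP ne(2)] .
  obtain r s where r: "r > 0" and s: "continuous_on (N \<inter> cball 0 r) s"
    "\<And>x. x \<in> N \<inter> cball 0 r \<Longrightarrow> 0 \<le> s x \<and> x + s x *\<^sub>R \<eta> \<in> Q"
    using connected_section[OF Q(1) r2 eta] by blast
  define S where "S = N \<inter> sphere 0 r"
  define Y where "Y = T \<inter> ball 0 d - {0}"
  define \<gamma> where "\<gamma> x = x + s x *\<^sub>R \<eta>" for x
  define \<pi> where "\<pi> z = (r / norm (prN z)) *\<^sub>R prN z" for z
  have Ssub: "S \<subseteq> N \<inter> cball 0 r" by (auto simp: S_def)
  have c\<gamma>: "continuous_on S \<gamma>"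
    unfolding \<gamma>_def using s(1) Ssub by (intro continuous_intros) (rule continuous_on_subset)
  have pr\<gamma>: "prN (\<gamma> x) = x" if "x \<in> S" for x
    using that eta sP by (intro prN_unique) (auto simp: \<gamma>_def S_def subspace_scale)
  have S0: "x \<noteq> 0" if "x \<in> S" for x using that r by (auto simp: S_def)
  have \<gamma>Q: "\<gamma> x \<in> Q - {0}" if "x \<in> S" for x
  proof -
    have "x \<in> N \<inter> cball 0 r" using that Ssub by blast
    then show ?thesis
      using s(2)[of x] pr\<gamma>[OF that] S0[OF that] linear_0[OF linear_prN] by (auto simp: \<gamma>_def)
  qed
  have \<pi>\<gamma>: "\<pi> (\<gamma> x) = x" if "x \<in> S" for x
    using that r by (simp add: \<pi>_def pr\<gamma>) (simp add: S_def)
  have hk: "\<And>x. x \<in> Q \<Longrightarrow> k (h x) = x" "\<And>y. y \<in> T \<inter> ball 0 d \<Longrightarrow> h (k y) = y"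
    "h ` Q = T \<inter> ball 0 d" "k ` (T \<inter> ball 0 d) = Q" "continuous_on Q h" "continuous_on (T \<inter> ball 0 d) k"
    using hom by (auto simp: homeomorphism_def)
  have k0: "k 0 = 0" using hk(1)[OF Q(2)] h0 by simp
  have hY: "h z \<in> Y" if "z \<in> Q - {0}" for z
    using that hk(1,3) k0 h0 unfolding Y_def by (metis DiffD1 DiffD2 DiffI image_eqI singletonD singletonI)
  have kQ: "k y \<in> Q - {0}" if "y \<in> Y" for y
    using that hk(2,4) k0 h0 unfolding Y_def by (metis DiffD1 DiffD2 DiffI image_eqI singletonD singletonI)
  have cF: "continuous_on S (h \<circ> \<gamma>)"
    using \<gamma>Q by (intro continuous_on_compose c\<gamma> continuous_on_subset[OF hk(5)]) auto
  \<comment> \<open>Radial projection of \<open>h (\<gamma> x)\<close> to the sphere of radius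
    \<open>d / 2\<close>. The straight homotopy to it stays in the punctured ball, since both ends
    are positive multiples of one vector.\<close>
  define u where "u x = (d / 2 / norm (h (\<gamma> x))) *\<^sub>R h (\<gamma> x)" for x
  have FY: "h (\<gamma> x) \<in> Y" if "x \<in> S" for x using hY \<gamma>Q that by blast
  have cu: "continuous_on S u"
    unfolding u_def using cF FY by (auto intro!: continuous_intros simp: o_def Y_def)
  have uT: "u x \<in> T \<inter> sphere 0 (d / 2)" if "x \<in> S" for x
    using FY[OF that] d T by (auto simp: u_def Y_def subspace_scale)
  have sphY: "T \<inter> sphere 0 (d / 2) \<subseteq> Y" using d by (auto simp: Y_def)
  have seg: "closed_segment (h (\<gamma> x)) (u x) \<subseteq> Y" if x: "x \<in> S" for x
  proof -
    define a where "a = h (\<gamma> x)"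
    have a: "a \<in> T" "a \<noteq> 0" "norm a < d" using FY[OF x] by (auto simp: a_def Y_def)
    have cv: "convex (T \<inter> ball 0 d)" using T by (simp add: subspace_imp_convex convex_Int)
    have "closed_segment a (u x) \<subseteq> T \<inter> ball 0 d"
      using uT[OF x] a d by (intro closed_segment_subset cv) auto
    moreover have "0 \<notin> closed_segment a (u x)"
    proof
      assume "0 \<in> closed_segment a (u x)"
      then obtain t where t: "0 \<le> t" "t \<le> 1" "0 = (1 - t) *\<^sub>R a + t *\<^sub>R u x"
        by (auto simp: closed_segment_def)
      then have "((1 - t) + t * (d / 2 / norm a)) *\<^sub>R a = 0"
        by (simp add: u_def a_def scaleR_add_left)
      moreover have "(1 - t) + t * (d / 2 / norm a) > 0"
        using t(1,2) d a(2) by (cases "t = 1") (auto intro!: add_pos_nonneg)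
      ultimately show False using a(2) by simp
    qed
    ultimately show ?thesis by (auto simp: Y_def a_def)
  qed
  have h1: "homotopic_with_canon (\<lambda>x. True) S Y (h \<circ> \<gamma>) u"
    using seg by (intro homotopic_with_linear cF cu) auto
  \<comment> \<open>Here \<open>dim N < dim T\<close> enters: it makes every map from the sphere of
    \<open>N\<close> to the sphere of \<open>T\<close> nullhomotopic.\<close>
  have dims: "aff_dim (N \<inter> cball 0 r) < aff_dim (T \<inter> cball 0 (d / 2))"
    using T d r sN by (simp add: rel_frontier_subspace_Int_cball)
  have fr: "rel_frontier (N \<inter> cball 0 r) = S" "rel_frontier (T \<inter> cball 0 (d / 2)) = T \<inter> sphere 0 (d / 2)"
    using T d r sN by (simp_all add: rel_frontier_subspace_Int_cball S_def)
  obtain c where "homotopic_with_canon (\<lambda>z. True) S (T \<inter> sphere 0 (d / 2)) u (\<lambda>x. c)"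
  proof (rule inessential_spheremap_lowdim_gen[OF _ _ _ _ dims, of u, unfolded fr])
    show "convex (N \<inter> cball 0 r)" "convex (T \<inter> cball 0 (d / 2))"
      using sN T by (simp_all add: subspace_imp_convex convex_Int)
    show "bounded (N \<inter> cball 0 r)" "bounded (T \<inter> cball 0 (d / 2))" by (simp_all add: bounded_Int)
    show "continuous_on S u" by (rule cu)
    show "u \<in> S \<rightarrow> T \<inter> sphere 0 (d / 2)" using uT by blast
  qed (rule that)
  then have "homotopic_with_canon (\<lambda>z. True) S Y u (\<lambda>x. c)"
    using sphY homotopic_with_subset_right by blast
  with h1 have h2: "homotopic_with_canon (\<lambda>x. True) S Y (h \<circ> \<gamma>) (\<lambda>x. c)"
    by (rule homotopic_with_trans)
  have "continuous_on Y (\<pi> \<circ> k)"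
  proof (rule continuous_on_compose)
    show "continuous_on Y k" using hk(6) by (rule continuous_on_subset) (auto simp: Y_def)
    have "continuous_on (Q - {0}) \<pi>"
      unfolding \<pi>_def
      by (intro continuous_on_scaleR continuous_on_divide continuous_on_const continuous_on_norm continuous_prN)
        (use nz in auto)
    moreover have "k ` Y \<subseteq> Q - {0}" using kQ by (rule image_subsetI)
    ultimately show "continuous_on (k ` Y) \<pi>" by (rule continuous_on_subset)
  qed
  moreover have "(\<pi> \<circ> k) \<in> Y \<rightarrow> S"
    using kQ nz r prN_in sN by (auto simp: \<pi>_def S_def subspace_scale)
  \<comment> \<open>Carried back by \<open>\<pi> \<circ> k\<close>, the nullhomotopy contracts the
    identity of \<open>S\<close>.\<close>
  ultimately have "homotopic_with_canon (\<lambda>x. True) S S ((\<pi> \<circ> k) \<circ> (h \<circ> \<gamma>)) ((\<pi> \<circ> k) \<circ> (\<lambda>x. c))"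
    by (intro homotopic_with_compose_continuous_map_left[OF h2]) auto
  moreover have "((\<pi> \<circ> k) \<circ> (h \<circ> \<gamma>)) x = id x" if "x \<in> S" for x
    using \<gamma>Q[OF that] by (simp add: hk \<pi>\<gamma> that)
  ultimately have "homotopic_with_canon (\<lambda>x. True) S S id ((\<pi> \<circ> k) \<circ> (\<lambda>x. c))"
    by (elim homotopic_with_eq) auto
  then have "contractible S" unfolding contractible_def by (auto simp: o_def)
  then show False using not_contractible_subspace_sphere[OF sN ne(1) r] by (simp add: S_def)
qed

text \<open>The zero set reaches at least three of the four open quadrants cut out by
  \<open>N\<close> and \<open>P\<close>. Removing 0 from the interval
  \<open>T \<inter> ball 0 d\<close> leaves two halves, whose images under \<open>k\<close> are
  connected and avoid both axes, so that each lies in one quadrant.\<close>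

lemma not_flat_plane:
  fixes T :: "'b set"
  assumes Q: "Q \<subseteq> {z. g z = 0}" "0 \<in> Q"
    and nz: "\<And>z. z \<in> Q \<Longrightarrow> z \<noteq> 0 \<Longrightarrow> prN z \<noteq> 0 \<and> z - prN z \<noteq> 0"
    and r2: "r2 > 0" "\<And>C. connected C \<Longrightarrow> 0 \<in> C \<Longrightarrow> C \<subseteq> {z. g z = 0} \<inter> ball 0 r2 \<Longrightarrow> C \<subseteq> Q"
    and T: "subspace T" "dim T = 1" and d: "d > 0"
    and hom: "homeomorphism Q (T \<inter> ball 0 d) h k" and h0: "h 0 = 0"
    and dims: "dim N = 1" "dim P = 1"
  shows False
proof -
  obtain \<eta> where eta: "norm \<eta> = 1" "\<eta> \<in> P" "\<And>y. y \<in> P \<Longrightarrow> y = (y \<bullet> \<eta>) *\<^sub>R \<eta>"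
    using subspace_dim_1E[OF sP dims(2)] by blast
  obtain \<theta> where theta: "norm \<theta> = 1" "\<theta> \<in> N" "\<And>y. y \<in> N \<Longrightarrow> y = (y \<bullet> \<theta>) *\<^sub>R \<theta>"
    using subspace_dim_1E[OF sN dims(1)] by blast
  obtain t where t: "norm t = 1" "t \<in> T" "\<And>y. y \<in> T \<Longrightarrow> y = (y \<bullet> t) *\<^sub>R t"
    using subspace_dim_1E[OF T] by blast
  have hk: "\<And>x. x \<in> Q \<Longrightarrow> k (h x) = x" "\<And>y. y \<in> T \<inter> ball 0 d \<Longrightarrow> h (k y) = y"
    "h ` Q = T \<inter> ball 0 d" "k ` (T \<inter> ball 0 d) = Q" "continuous_on Q h" "continuous_on (T \<inter> ball 0 d) k"
    using hom by (auto simp: homeomorphism_def)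
  have k0: "k 0 = 0" using hk(1)[OF Q(2)] h0 by simp
  have e0: "prN z \<bullet> \<theta> \<noteq> 0" "(z - prN z) \<bullet> \<eta> \<noteq> 0" if "z \<in> Q" "z \<noteq> 0" for z
    using nz[OF that] theta(3)[OF prN_in[of z]] eta(3)[OF prN_compl[of z]]
    by (metis scale_zero_left)+
  have ht: "h z \<bullet> t \<noteq> 0" if "z \<in> Q" "z \<noteq> 0" for z
  proof
    assume "h z \<bullet> t = 0"
    moreover have "h z \<in> T" using hk(3) that by blast
    ultimately have "h z = 0" using t(3)[of "h z"] by simp
    then show False using hk(1)[OF that(1)] k0 that(2) by simp
  qed
  \<comment> \<open>The factor \<sigma> is used with the values 1 and -1 and selects one half of the
    interval.\<close>
  have same: "(prN u \<bullet> \<theta> > 0 \<longleftrightarrow> prN v \<bullet> \<theta> > 0) \<and> ((u - prN u) \<bullet> \<eta> > 0 \<longleftrightarrow> (v - prN v) \<bullet> \<eta> > 0)"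
    if uv: "u \<in> Q - {0}" "v \<in> Q - {0}" and s: "h u \<bullet> (\<sigma> *\<^sub>R t) > 0" "h v \<bullet> (\<sigma> *\<^sub>R t) > 0" for u v \<sigma>
  proof -
    define Y where "Y = T \<inter> ball 0 d \<inter> {y. (\<sigma> *\<^sub>R t) \<bullet> y > 0}"
    have "convex Y" unfolding Y_def
      by (intro convex_Int convex_ball subspace_imp_convex T convex_halfspace_gt)
    then have con: "connected (k ` Y)"
      by (intro connected_continuous_image convex_connected continuous_on_subset[OF hk(6)]) (auto simp: Y_def)
    have kY: "k ` Y \<subseteq> Q - {0}"
    proof -
      have "k y \<in> Q" "k y \<noteq> 0" if "y \<in> Y" for y
      proof -
        have "y \<in> T \<inter> ball 0 d" "y \<noteq> 0" using that by (auto simp: Y_def)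
        then show "k y \<in> Q" "k y \<noteq> 0" using hk(2)[of y] imageI[of y "T \<inter> ball 0 d" k, unfolded hk(4)] h0 by auto
      qed
      then show ?thesis by (intro image_subsetI) simp
    qed
    have "h u \<in> Y" "h v \<in> Y" using uv s hk(3) by (auto simp: Y_def inner_commute)
    then have in_kY: "u \<in> k ` Y" "v \<in> k ` Y" using hk(1) uv by (metis DiffD1 image_eqI)+
    have c: "continuous_on (k ` Y) (\<lambda>z. prN z \<bullet> \<theta>)" "continuous_on (k ` Y) (\<lambda>z. (z - prN z) \<bullet> \<eta>)"
      by (rule continuous_on_inner[OF continuous_prN continuous_on_const],
        rule continuous_on_inner[OF continuous_on_diff[OF continuous_on_id continuous_prN] continuous_on_const])
    show ?thesis
      using connected_same_sign[OF con c(1), of u v] connected_same_sign[OF con c(1), of v u]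
        connected_same_sign[OF con c(2), of u v] connected_same_sign[OF con c(2), of v u] in_kY kY e0
      by blast
  qed
  have m\<eta>: "- \<eta> \<in> P" "norm (- \<eta>) = 1" using eta sP by (auto simp: subspace_neg)
  obtain r s where r: "r > 0" and s: "\<And>x. x \<in> N \<inter> cball 0 r \<Longrightarrow> 0 \<le> s x \<and> x + s x *\<^sub>R \<eta> \<in> Q"
    using connected_section[OF Q(1) r2 eta(2,1)] by blast
  obtain r' s' where r': "r' > 0" and s': "\<And>x. x \<in> N \<inter> cball 0 r' \<Longrightarrow> 0 \<le> s' x \<and> x + s' x *\<^sub>R (- \<eta>) \<in> Q"
    using connected_section[OF Q(1) r2 m\<eta>] by blast
  have pt: "x + c *\<^sub>R \<eta> \<in> Q - {0} \<and> prN (x + c *\<^sub>R \<eta>) = x \<and> c \<noteq> 0"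
    if "x + c *\<^sub>R \<eta> \<in> Q" "x \<in> N" "x \<noteq> 0" for x c
  proof -
    have p: "prN (x + c *\<^sub>R \<eta>) = x" using that eta sP by (intro prN_unique) (auto simp: subspace_scale)
    then have "x + c *\<^sub>R \<eta> \<noteq> 0" using that(3) linear_0[OF linear_prN] by metis
    then show ?thesis using that p nz[OF that(1)] by auto
  qed
  define R where "R = min r r'"
  have R: "R > 0" "R \<le> r" "R \<le> r'" using r r' by (auto simp: R_def)
  have x: "R *\<^sub>R \<theta> \<in> N \<inter> cball 0 r" "R *\<^sub>R \<theta> \<in> N \<inter> cball 0 r'" "- (R *\<^sub>R \<theta>) \<in> N \<inter> cball 0 r" "R *\<^sub>R \<theta> \<noteq> 0"
    using R theta sN by (auto simp: subspace_scale subspace_neg)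
  \<comment> \<open>The points \<open>a\<close>, \<open>b\<close>, \<open>c\<close> lie in three
    different quadrants; the first two come from the section in direction \<eta>, the third from the
    one in direction \<open>- \<eta>\<close>.\<close>
  define a where "a = R *\<^sub>R \<theta> + s (R *\<^sub>R \<theta>) *\<^sub>R \<eta>"
  define b where "b = - (R *\<^sub>R \<theta>) + s (- (R *\<^sub>R \<theta>)) *\<^sub>R \<eta>"
  define c where "c = R *\<^sub>R \<theta> + (- s' (R *\<^sub>R \<theta>)) *\<^sub>R \<eta>"
  have \<theta>\<theta>: "\<theta> \<bullet> \<theta> = 1" "\<eta> \<bullet> \<eta> = 1" using theta eta by (auto simp: norm_eq_1)
  have A: "a \<in> Q - {0}" "prN a \<bullet> \<theta> > 0" "(a - prN a) \<bullet> \<eta> > 0"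
    using pt[of "R *\<^sub>R \<theta>" "s (R *\<^sub>R \<theta>)"] s[OF x(1)] x R by (auto simp: a_def \<theta>\<theta>)
  have B: "b \<in> Q - {0}" "\<not> prN b \<bullet> \<theta> > 0" "(b - prN b) \<bullet> \<eta> > 0"
    using pt[of "- (R *\<^sub>R \<theta>)" "s (- (R *\<^sub>R \<theta>))"] s[OF x(3)] x R by (auto simp: b_def \<theta>\<theta>)
  have C: "c \<in> Q - {0}" "prN c \<bullet> \<theta> > 0" "\<not> (c - prN c) \<bullet> \<eta> > 0"
    using pt[of "R *\<^sub>R \<theta>" "- s' (R *\<^sub>R \<theta>)"] s'[OF x(2)] x R by (auto simp: c_def \<theta>\<theta>)
  have opp: "h u \<bullet> t > 0 \<longleftrightarrow> \<not> h v \<bullet> t > 0"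
    if "u \<in> Q - {0}" "v \<in> Q - {0}" "\<not> ((prN u \<bullet> \<theta> > 0 \<longleftrightarrow> prN v \<bullet> \<theta> > 0) \<and> ((u - prN u) \<bullet> \<eta> > 0 \<longleftrightarrow> (v - prN v) \<bullet> \<eta> > 0))"
    for u v
  proof -
    have "\<not> (h u \<bullet> t > 0 \<and> h v \<bullet> t > 0)"
      using same[OF that(1,2), of 1] that(3) by (metis scaleR_one)
    moreover have "\<not> (h u \<bullet> t < 0 \<and> h v \<bullet> t < 0)"
      using same[OF that(1,2), of "-1"] that(3) by (metis inner_minus_right neg_0_less_iff_less scaleR_minus1_left)
    moreover have "h u \<bullet> t \<noteq> 0" "h v \<bullet> t \<noteq> 0" using ht that(1,2) by auto
    ultimately show ?thesis by linarith
  qed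
  \<comment> \<open>Any two of the three points would lie in different halves, but there are only
    two halves.\<close>
  show False using opp[of a b] opp[of b c] opp[of a c] A B C by blast
qed

text \<open>The three cases are exhaustive because \<open>dim N + dim P\<close> exceeds
  \<open>dim T\<close> by one and neither summand is zero. The latter excludes an extremum:
  \<open>T\<close> is nontrivial by \<open>DIM\<close>, so \<open>Q\<close> has a point besides 0,
  and by \<open>zero_set\<close> that point has nonzero parts in both \<open>N\<close> and
  \<open>P\<close>.\<close>

lemma not_locally_flat:
  assumes DIM: "DIM('b) \<ge> 2"
  obtains r0 where "r0 > 0"
    "\<And>Q r2 T d h k. Q \<subseteq> {z. g z = 0} \<inter> ball 0 r0 \<Longrightarrow> 0 \<in> Q \<Longrightarrow> r2 > 0 \<Longrightarrow>
      (\<And>C. connected C \<Longrightarrow> 0 \<in> C \<Longrightarrow> C \<subseteq> {z. g z = 0} \<inter> ball 0 r2 \<Longrightarrow> C \<subseteq> Q) \<Longrightarrow>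
      subspace T \<Longrightarrow> dim T = DIM('b) - 1 \<Longrightarrow> d > 0 \<Longrightarrow>
      homeomorphism Q ((T::'b set) \<inter> ball 0 d) h k \<Longrightarrow> h 0 = 0 \<Longrightarrow> False"
proof -
  obtain r0 where r0: "r0 > 0" "\<And>x y. x \<in> N \<Longrightarrow> y \<in> P \<Longrightarrow> norm (x + y) < r0 \<Longrightarrow> x + y \<noteq> 0 \<Longrightarrow>
    g (x + y) = 0 \<Longrightarrow> x \<noteq> 0 \<and> y \<noteq> 0" using zero_set by metis
  show ?thesis
  proof (rule that[OF r0(1)])
    fix Q r2 d and T :: "'b set" and h k
    assume Q: "Q \<subseteq> {z. g z = 0} \<inter> ball 0 r0" "0 \<in> Q" and r2: "r2 > 0"
      "\<And>C. connected C \<Longrightarrow> 0 \<in> C \<Longrightarrow> C \<subseteq> {z. g z = 0} \<inter> ball 0 r2 \<Longrightarrow> C \<subseteq> Q"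
      and T: "subspace T" "dim T = DIM('b) - 1" and d: "d > 0"
      and hom: "homeomorphism Q (T \<inter> ball 0 d) h k" and h0: "h 0 = 0"
    have nz: "prN z \<noteq> 0 \<and> z - prN z \<noteq> 0" if "z \<in> Q" "z \<noteq> 0" for z
    proof -
      have "norm z < r0" "g z = 0" using Q that by auto
      then show ?thesis using r0(2)[OF prN_in[of z] prN_compl[of z]] that by simp
    qed
    have "T \<noteq> {0}" using T DIM by auto
    then obtain v where v: "v \<in> T" "norm v = 1" using unit_vector_in T by blast
    define y where "y = (d / 2) *\<^sub>R v"
    have y: "y \<in> T \<inter> ball 0 d" "y \<noteq> 0" using v d T by (auto simp: y_def subspace_scale)
    have "k y \<in> Q" "k y \<noteq> 0"
      using y hom h0 by (metis homeomorphism_def image_eqI)+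
    then have ne: "N \<noteq> {0}" "P \<noteq> {0}" using nz[of "k y"] prN_in[of "k y"] prN_compl[of "k y"] by auto
    interpret D: quadratic_saddle "\<lambda>z. - g z" "\<lambda>z v. - g' z v" "\<lambda>u v. - H u v" P N m by (rule dual)
    have "dim N \<noteq> 0" "dim P \<noteq> 0" using ne sN sP subspace_0 by (auto simp: dim_eq_0)
    then consider "dim N < dim T" | "dim P < dim T" | "dim N = 1" "dim P = 1" "dim T = 1"
      using dim_sum T(2) by linarith
    then show False
    proof cases
      case 1
      then show False using not_flat_lowdim[OF _ Q(2) _ r2 T(1) _ d hom h0 ne] Q nz by blast
    next
      case 2
      have "D.prN z = z - prN z" for z
        using prN_in prN_compl by (intro D.prN_unique) auto
      then have "D.prN z \<noteq> 0" if "z \<in> Q" "z \<noteq> 0" for z using nz that by simp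
      moreover have "{z. - g z = 0} = {z. g z = 0}" by simp
      ultimately show False using D.not_flat_lowdim[of Q r2 T d h k] Q r2 2 T d hom h0 ne by auto
    next
      case 3
      then show False using not_flat_plane[OF _ Q(2) _ r2 T(1) _ d hom h0] Q nz by blast
    qed
  qed
qed

end

section \<open>Level components, tubes and edges\<close>

definition level_component :: "'a topology \<Rightarrow> ('a \<Rightarrow> real) \<Rightarrow> 'a \<Rightarrow> 'a set" where
  "level_component M f x = connected_component_of_set (subtopology M {y \<in> topspace M. f y = f x}) x"

lemma level_components_eq: "level_components M f = level_component M f ` topspace M"
proof -
  have "topspace M \<inter> {x \<in> topspace M. f x = c} = {x \<in> topspace M. f x = c}" for c by auto
  then show ?thesis
    by (auto simp: level_components_def level_component_def connected_components_of_def)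
qed

lemma level_component_refl: "x \<in> topspace M \<Longrightarrow> x \<in> level_component M f x"
  by (simp add: level_component_def connected_component_of_refl)

lemma level_component_subset: "level_component M f x \<subseteq> {y \<in> topspace M. f y = f x}"
  using connected_component_of_subset_topspace by (fastforce simp: level_component_def)

lemma level_component_cong:
  assumes "y \<in> level_component M f x"
  shows "level_component M f y = level_component M f x"
proof -
  have "f y = f x" using assms level_component_subset by fastforce
  then show ?thesis
    using connected_component_of_equiv[of "subtopology M {z \<in> topspace M. f z = f x}" x y] assms
    by (simp add: level_component_def)
qed

lemma connectedin_level_component: "connectedin M (level_component M f x)"
  using connectedin_connected_component_of[of "subtopology M {y \<in> topspace M. f y = f x}" x]
  unfolding level_component_def connectedin_subtopology by (rule conjunct1)

lemma level_component_maximal: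
  assumes "connectedin M C" "x \<in> C" "\<And>y. y \<in> C \<Longrightarrow> f y = f x"
  shows "C \<subseteq> level_component M f x"
proof -
  have "C \<subseteq> {y \<in> topspace M. f y = f x}"
    using connectedin_subset_topspace[OF assms(1)] assms(3) by blast
  then show ?thesis
    unfolding level_component_def using assms(1,2)
    by (intro connected_component_of_maximal) (simp_all add: connectedin_subtopology)
qed

lemma element_of_level_component:
  assumes "x \<in> topspace M"
  shows "element_of (level_components M f) x = level_component M f x"
  unfolding element_of_def
proof (rule the_equality)
  show "level_component M f x \<in> level_components M f \<and> x \<in> level_component M f x"
    using assms by (simp add: level_components_eq level_component_refl)
  show "L = level_component M f x" if L: "L \<in> level_components M f \<and> x \<in> L" for L
  proof -
    obtain y where "L = level_component M f y" using L by (auto simp: level_components_eq)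
    then show ?thesis using level_component_cong[of x M f y] L by simp
  qed
qed

locale level_space =
  fixes M :: "'a topology" and f :: "'a \<Rightarrow> real"
  assumes compact: "compact_space M" and Hausdorff: "Hausdorff_space M"
    and cont: "continuous_map M euclideanreal f"
begin

abbreviation "\<L> \<equiv> level_component M f"

lemma closedin_level: "closedin M {x \<in> topspace M. f x \<in> C}" if "closed C" for C
  using closedin_continuous_map_preimage[OF cont, of C] that by simp

lemma openin_level: "openin M {x \<in> topspace M. f x \<in> C}" if "open C" for C
  using openin_continuous_map_preimage[OF cont, of C] that by simp

lemma closedin_level_component: "closedin M (\<L> x)"
proof -
  have "closedin M {y \<in> topspace M. f y = f x}"
    using closedin_level[of "{f x}"] by simp
  then show ?thesis
    unfolding level_component_def by (meson closedin_connected_component_of closedin_closed_subtopology)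
qed

lemma compact_image_closedin: "closedin M K \<Longrightarrow> compact (f ` K)"
  using closedin_compact_space[OF compact] image_compactin[OF _ cont] by auto

lemma closure_level_bounds:
  assumes "x \<in> M closure_of S" "\<And>y. y \<in> S \<Longrightarrow> f y \<in> C" "closed C"
  shows "f x \<in> C"
proof -
  have "M closure_of S \<subseteq> {x \<in> topspace M. f x \<in> C}"
    using closure_of_restrict[of M S] closure_of_minimal[OF _ closedin_level[OF assms(3)], of "topspace M \<inter> S"] assms(2)
    by auto
  with assms(1) show ?thesis by auto
qed

lemma closure_of_local:
  assumes "x \<in> M closure_of S" "open C" "f x \<in> C"
  shows "x \<in> M closure_of {y \<in> S. f y \<in> C}"
  unfolding in_closure_of
proof (intro conjI allI impI)
  show "x \<in> topspace M" using assms in_closure_of by fast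
  fix T assume T: "x \<in> T \<and> openin M T"
  then have "openin M (T \<inter> {x \<in> topspace M. f x \<in> C})" using openin_level[OF assms(2)] by blast
  moreover have "x \<in> T \<inter> {x \<in> topspace M. f x \<in> C}" using T assms \<open>x \<in> topspace M\<close> by blast
  ultimately obtain y where "y \<in> S" "y \<in> T \<inter> {x \<in> topspace M. f x \<in> C}"
    using assms(1)[unfolded in_closure_of] by meson
  then show "\<exists>y. y \<in> {y \<in> S. f y \<in> C} \<and> y \<in> T" by blast
qed

text \<open>A connected superlevel part of \<open>e\<close> close to the level \<open>b\<close> lies in disjoint neighbourhoods
  of the members of \<open>\<V>\<close>, so only one of them is met.\<close>

lemma unique_end:
  fixes h :: "'a \<Rightarrow> real"
  assumes h: "continuous_map M euclideanreal h"
    and V: "finite \<V>" "\<And>L. L \<in> \<V> \<Longrightarrow> closedin M L" "pairwise disjnt \<V>"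
    and e: "e \<subseteq> topspace M" "\<And>x. x \<in> e \<Longrightarrow> h x < b" "\<And>t. t < b \<Longrightarrow> \<exists>x\<in>e. h x > t"
      "\<And>t. t < b \<Longrightarrow> connectedin M {x \<in> e. h x > t}"
    and lim: "M closure_of e \<inter> {x. h x = b} \<subseteq> \<Union>\<V>"
  obtains L where "L \<in> \<V>" "M closure_of e \<inter> {x. h x = b} \<subseteq> L" "M closure_of e \<inter> {x. h x = b} \<noteq> {}"
proof -
  interpret h: level_space M h using compact Hausdorff h by unfold_locales
  let ?C = "M closure_of e"
  have cl: "closedin M ?C" by simp
  have le: "h x \<le> b" if "x \<in> ?C" for x
    using h.closure_level_bounds[OF that, of "{..b}"] e(2) by (auto simp: less_imp_le)
  \<comment> \<open>A closed part of the closure of \<open>e\<close> that misses the level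
    \<open>b\<close> stays below it by a positive amount, since its image under \<open>h\<close> is
    compact.\<close>
  have near: "\<exists>t<b. \<forall>x\<in>K. h x \<le> t" if K: "closedin M K" "K \<subseteq> ?C" "\<And>x. x \<in> K \<Longrightarrow> h x \<noteq> b" for K
  proof (cases "K = {}")
    case True then show ?thesis by (auto intro: lt_ex)
  next
    case False
    then obtain y where "y \<in> K" "\<And>x. x \<in> K \<Longrightarrow> h x \<le> h y"
      using compact_attains_sup[OF h.compact_image_closedin[OF K(1)]] by auto
    then show ?thesis using K le by (metis order_le_less subsetD)
  qed
  have ne: "?C \<inter> {x. h x = b} \<noteq> {}"
  proof
    assume "?C \<inter> {x. h x = b} = {}"
    then obtain t where t: "t < b" "\<And>x. x \<in> ?C \<Longrightarrow> h x \<le> t" using near[OF cl] by blast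
    obtain x where "x \<in> e" "h x > t" using e(3) t(1) by blast
    then show False using t(2)[of x] closure_of_subset[OF e(1)] by auto
  qed
  then obtain x where x: "x \<in> ?C" "h x = b" by blast
  then obtain L where L: "L \<in> \<V>" "x \<in> L" using lim by blast
  have "?C \<inter> {x. h x = b} \<subseteq> L"
  proof (rule ccontr)
    assume "\<not> ?thesis"
    then obtain y where y: "y \<in> ?C" "h y = b" "y \<notin> L" by blast
    define L' where "L' = \<Union>(\<V> - {L})"
    have "closedin M L" "closedin M L'" unfolding L'_def using V L by (auto intro!: closedin_Union)
    moreover have "disjnt L L'" using V(3) L(1) unfolding L'_def pairwise_def disjnt_def by blast
    moreover have "normal_space M"
      using compact Hausdorff compact_Hausdorff_or_regular_imp_normal_space by blast
    ultimately obtain U U' where U: "openin M U" "openin M U'" "L \<subseteq> U" "L' \<subseteq> U'" "disjnt U U'"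
      unfolding normal_space_def by metis
    have yU: "y \<in> U'" using y L lim U(4) unfolding L'_def by blast
    have "closedin M (?C - (U \<union> U'))" using U by (intro closedin_diff) auto
    moreover have "h z \<noteq> b" if "z \<in> ?C - (U \<union> U')" for z
      using that lim U(3,4) unfolding L'_def by blast
    ultimately obtain t where t: "t < b" "\<And>z. z \<in> ?C - (U \<union> U') \<Longrightarrow> h z \<le> t"
      using near[of "?C - (U \<union> U')"] by auto
    let ?S = "{z \<in> e. h z > t}"
    have con: "connectedin M ?S" by (rule e(4)[OF t(1)])
    have "?S \<subseteq> U \<union> U'" using t(2) closure_of_subset[OF e(1)] by force
    moreover have "U \<inter> U' \<inter> ?S = {}" using U(5) by (auto simp: disjnt_def)
    moreover have meets: "W \<inter> ?S \<noteq> {}" if "openin M W" "w \<in> W" "w \<in> ?C" "h w = b" for W w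
      using h.closure_of_local[OF that(3), of "{t<..}"] that t(1) by (auto simp: in_closure_of)
    then have "U \<inter> ?S \<noteq> {}" "U' \<inter> ?S \<noteq> {}"
      using U x y L yU by blast+
    ultimately show False using con U(1,2) unfolding connectedin by blast
  qed
  with L ne that show ?thesis by blast
qed

end

text \<open>A saturated open set over an open interval, with exactly one level component over each
  value. The clause on the closure makes the tube relatively closed over its interval; this is what
  forces two tubes that meet to have the same components over all common values.\<close>

definition level_tube :: "'a topology \<Rightarrow> ('a \<Rightarrow> real) \<Rightarrow> 'a set \<Rightarrow> real \<Rightarrow> real \<Rightarrow> bool" where
  "level_tube M f G a b \<longleftrightarrow> openin M G \<and> a < b \<and> f ` G = {a<..<b} \<and>
     (\<forall>x\<in>G. \<forall>y\<in>G. f x = f y \<longrightarrow> level_component M f x = level_component M f y) \<and>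
     (\<forall>x\<in>G. level_component M f x \<subseteq> G) \<and>
     (\<forall>x\<in>M closure_of G. a < f x \<and> f x < b \<longrightarrow> x \<in> G) \<and>
     (\<forall>x\<in>G. \<forall>y\<in>G. subtopology M (level_component M f x) homeomorphic_space
        subtopology M (level_component M f y))"

text \<open>The interface between analysis and topology. \<open>open_map\<close> and
  \<open>tubes\<close> are what the absence of critical points leaves to the topological argument,
  and \<open>distinct\<close> is the comparison of homeomorphism types. The assumptions are verified
  separately for dimension 0 and for dimension at least 2.\<close>

locale reeb_space = level_space +
  fixes V :: "'a set set"
  assumes fin: "finite V" and V: "V \<subseteq> level_components M f"
    and open_map: "\<And>U. openin M U \<Longrightarrow> U \<subseteq> topspace M - \<Union>V \<Longrightarrow> open (f ` U)"
    and tubes: "\<And>x. x \<in> topspace M - \<Union>V \<Longrightarrow> \<exists>G a b. x \<in> G \<and> G \<subseteq> topspace M - \<Union>V \<and> level_tube M f G a b"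
    and distinct: "\<And>L x. L \<in> V \<Longrightarrow> x \<in> topspace M - \<Union>V \<Longrightarrow>
       \<not> subtopology M L homeomorphic_space subtopology M (level_component M f x)"
begin

definition "Reg = topspace M - \<Union>V"

abbreviation "edges \<equiv> connected_components_of (subtopology M Reg)"

lemma V_eq: "L \<in> V \<Longrightarrow> x \<in> L \<Longrightarrow> x \<in> topspace M \<and> \<L> x = L"
  using V level_component_cong level_component_subset by (fastforce simp: level_components_eq)

lemma V_nonempty: "L \<in> V \<Longrightarrow> L \<noteq> {}"
  using V level_component_refl by (fastforce simp: level_components_eq)

lemma V_closed: "L \<in> V \<Longrightarrow> closedin M L"
  using V closedin_level_component by (auto simp: level_components_eq)

lemma V_disjoint: "pairwise disjnt V"
  unfolding pairwise_def disjnt_def using V_eq by blast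

definition "tube G a b \<longleftrightarrow> G \<subseteq> Reg \<and> level_tube M f G a b"

lemma tubeD:
  assumes "tube G a b"
  shows "openin M G" "G \<subseteq> Reg" "G \<subseteq> topspace M" "a < b" "f ` G = {a<..<b}"
    "\<And>x y. x \<in> G \<Longrightarrow> y \<in> G \<Longrightarrow> f x = f y \<Longrightarrow> \<L> x = \<L> y"
    "\<And>x. x \<in> G \<Longrightarrow> \<L> x \<subseteq> G"
    "\<And>x. x \<in> M closure_of G \<Longrightarrow> a < f x \<Longrightarrow> f x < b \<Longrightarrow> x \<in> G"
    "\<And>x y. x \<in> G \<Longrightarrow> y \<in> G \<Longrightarrow> subtopology M (\<L> x) homeomorphic_space subtopology M (\<L> y)"
    "\<And>x. x \<in> G \<Longrightarrow> a < f x \<and> f x < b"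
proof -
  have G: "G \<subseteq> Reg" and t: "level_tube M f G a b" using assms by (simp_all add: tube_def)
  show "G \<subseteq> Reg" "G \<subseteq> topspace M" using G by (auto simp: Reg_def)
  show "openin M G" "a < b" and im: "f ` G = {a<..<b}"
    using t unfolding level_tube_def by blast+
  show "\<And>x y. x \<in> G \<Longrightarrow> y \<in> G \<Longrightarrow> f x = f y \<Longrightarrow> \<L> x = \<L> y"
    using t unfolding level_tube_def by (elim conjE) blast
  show "\<And>x. x \<in> G \<Longrightarrow> \<L> x \<subseteq> G"
    using t unfolding level_tube_def by (elim conjE) blast
  show "\<And>x. x \<in> M closure_of G \<Longrightarrow> a < f x \<Longrightarrow> f x < b \<Longrightarrow> x \<in> G"
    using t unfolding level_tube_def by (elim conjE) blast
  show "\<And>x y. x \<in> G \<Longrightarrow> y \<in> G \<Longrightarrow> subtopology M (\<L> x) homeomorphic_space subtopology M (\<L> y)"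
    using t unfolding level_tube_def by (elim conjE) blast
  show "\<And>x. x \<in> G \<Longrightarrow> a < f x \<and> f x < b"
    using im by (metis greaterThanLessThan_iff imageI)
qed

text \<open>A separation of the part over \<open>J\<close> would split \<open>J\<close> into two
  nonempty open sets of values, as \<open>f\<close> is open on the regular set. They are disjoint
  because the fibre over a value is one connected component, lying wholly in the part.\<close>

lemma tube_part_connected:
  assumes G: "tube G a b" and J: "open J" "connected J" "J \<subseteq> {a<..<b}"
  shows "connectedin M {x \<in> G. f x \<in> J}"
proof -
  let ?S = "{x \<in> G. f x \<in> J}"
  note T = tubeD[OF G]
  have op: "openin M ?S"
  proof -
    have "?S = G \<inter> {x \<in> topspace M. f x \<in> J}" using T(3) by auto
    then show ?thesis using openin_Int[OF T(1) openin_level[OF J(1)]] by simp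
  qed
  have "False" if E: "openin M E1" "openin M E2" "?S \<subseteq> E1 \<union> E2" "E1 \<inter> E2 \<inter> ?S = {}" "E1 \<inter> ?S \<noteq> {}" "E2 \<inter> ?S \<noteq> {}"
    for E1 E2
  proof -
    have o: "open (f ` (E1 \<inter> ?S))" "open (f ` (E2 \<inter> ?S))"
      using E op T(2) unfolding Reg_def by (intro open_map; blast)+
    have fS: "f ` ?S = J"
    proof
      show "J \<subseteq> f ` ?S"
      proof
        fix t assume t: "t \<in> J"
        then obtain x where "x \<in> G" "f x = t" using T(5) J(3) by (metis imageE subsetD)
        with t show "t \<in> f ` ?S" by blast
      qed
    qed auto
    have "f ` ?S \<subseteq> f ` (E1 \<inter> ?S) \<union> f ` (E2 \<inter> ?S)" using E(3) by blast
    then have "J \<subseteq> f ` (E1 \<inter> ?S) \<union> f ` (E2 \<inter> ?S)" by (simp only: fS)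
    moreover have "f ` (E1 \<inter> ?S) \<inter> f ` (E2 \<inter> ?S) = {}"
    proof (rule ccontr)
      assume "f ` (E1 \<inter> ?S) \<inter> f ` (E2 \<inter> ?S) \<noteq> {}"
      then obtain x y where xy: "x \<in> E1 \<inter> ?S" "y \<in> E2 \<inter> ?S" "f x = f y" by (auto simp: disjoint_iff)
      then have eq: "\<L> x = \<L> y" using T(6)[of x y] by simp
      have "\<L> x \<subseteq> ?S" using T(7)[of x] level_component_subset[of M f x] xy by auto
      moreover have "x \<in> \<L> x" "y \<in> \<L> x"
        using xy T(3) level_component_refl[of x M f] level_component_refl[of y M f] unfolding eq by auto
      ultimately show False
        using connectedin_level_component[of M f x] E xy unfolding connectedin by blast
    qed
    ultimately have "f ` (E1 \<inter> ?S) \<inter> J = {} \<or> f ` (E2 \<inter> ?S) \<inter> J = {}"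
      using connectedD[OF J(2) o] by blast
    then show False using E(5,6) by blast
  qed
  then show ?thesis unfolding connectedin using T(3) by blast
qed

lemma tube_connected: "tube G a b \<Longrightarrow> connectedin M G"
proof -
  assume G: "tube G a b"
  have "{x \<in> G. f x \<in> {a<..<b}} = G" using tubeD(10)[OF G] by auto
  then show ?thesis using tube_part_connected[OF G, of "{a<..<b}"] by simp
qed

text \<open>The values attained on \<open>G \<inter> H\<close> form a set that is open by
  \<open>open_map\<close> and closed in the common interval by compactness and the closure clauses
  of both tubes; so it is the whole interval. Over a common value the tubes then share a point,
  hence its component.\<close>

lemma tubes_agree:
  assumes G: "tube G a b" and H: "tube H c d" and GH: "G \<inter> H \<noteq> {}"
    and x: "x \<in> G" "c < f x" "f x < d"
  shows "x \<in> H"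
proof -
  note G' = tubeD[OF G] and H' = tubeD[OF H]
  define J where "J = {max a c<..<min b d}"
  define D where "D = f ` (G \<inter> H)"
  have "open D" unfolding D_def using G'(1,2) H'(1) by (intro open_map) (auto simp: Reg_def)
  have DJ: "D \<subseteq> J" unfolding D_def J_def using G'(10) H'(10) by auto
  have cl: "t \<in> D" if t: "t \<in> J" "t \<in> closure D" for t
  proof -
    obtain s u where su: "max a c < s" "s < t" "t < u" "u < min b d"
      using t(1) unfolding J_def by (meson dense greaterThanLessThan_iff)
    define K where "K = M closure_of (G \<inter> H) \<inter> {x \<in> topspace M. f x \<in> {s..u}}"
    have "closedin M K" unfolding K_def by (intro closedin_Int closedin_level) auto
    then have "closed (f ` K)" using compact_image_closedin compact_imp_closed by blast
    have sub: "D \<inter> {s<..<u} \<subseteq> f ` K"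
    proof
      fix r assume "r \<in> D \<inter> {s<..<u}"
      then obtain y where "y \<in> G \<inter> H" "f y = r" "s < r" "r < u" unfolding D_def by auto
      moreover from this have "y \<in> M closure_of (G \<inter> H)"
        using G'(3) closure_of_subset[of "G \<inter> H" M] by blast
      ultimately show "r \<in> f ` K" using G'(3) by (intro image_eqI[of _ f y]) (auto simp: K_def)
    qed
    have "t \<in> closure (D \<inter> {s<..<u})"
      using open_Int_closure_subset[of "{s<..<u}" D] t(2) su by (auto simp: Int_commute)
    then have "t \<in> f ` K" using closure_minimal[OF sub \<open>closed (f ` K)\<close>] by blast
    then obtain y where y: "y \<in> M closure_of (G \<inter> H)" "f y = t" unfolding K_def by blast
    have "y \<in> G" using G'(8)[of y] y su closure_of_mono[of "G \<inter> H" G M] by auto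
    moreover have "y \<in> H" using H'(8)[of y] y su closure_of_mono[of "G \<inter> H" H M] by auto
    ultimately show ?thesis using y D_def by blast
  qed
  have "connected J" unfolding J_def by simp
  moreover have "openin (top_of_set J) D" using \<open>open D\<close> DJ by (simp add: open_subset)
  moreover have "closedin (top_of_set J) D"
  proof -
    have "D = J \<inter> closure D" using DJ cl closure_subset[of D] by blast
    then show ?thesis by (metis closed_closure closedin_closed_Int)
  qed
  moreover have "D \<noteq> {}" using GH by (auto simp: D_def)
  ultimately have "D = J" using connected_clopen by blast
  moreover have "f x \<in> J" using G'(10)[OF x(1)] x by (auto simp: J_def)
  ultimately obtain w where w: "w \<in> G" "w \<in> H" "f w = f x" unfolding D_def by auto
  then have "\<L> w = \<L> x" using G'(6)[of w x] x by simp
  then have "x \<in> \<L> w" using x G'(3) level_component_refl[of x M f] by auto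
  then show ?thesis using H'(7)[OF w(2)] by blast
qed

text \<open>By \<open>tubes_agree\<close> the two tubes coincide over their common values, so the
  union still has one component per value. For the closure clause, a limit point of one tube with a
  value in the interval of the other is a limit of points that \<open>tubes_agree\<close> places in
  the other.\<close>

lemma tube_Un:
  assumes G: "tube G a b" and H: "tube H c d" and GH: "G \<inter> H \<noteq> {}"
  shows "tube (G \<union> H) (min a c) (max b d)"
proof -
  note G' = tubeD[OF G] and H' = tubeD[OF H]
  obtain w where w: "w \<in> G" "w \<in> H" using GH by blast
  have ov: "a < f w" "f w < b" "c < f w" "f w < d" using G'(10) H'(10) w by auto
  have agG: "x \<in> H" if "x \<in> G" "c < f x" "f x < d" for x using tubes_agree[OF G H GH that] .
  have clos: "x \<in> H'" if G': "tube G a b" and H': "tube H' c d" and w: "w \<in> G" "w \<in> H'"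
    and x: "x \<in> M closure_of G" "c < f x" "f x < d" for G H' a b c d w x
  proof -
    have "x \<in> M closure_of {y \<in> G. f y \<in> {c<..<d}}"
      using x by (intro closure_of_local) auto
    moreover have "{y \<in> G. f y \<in> {c<..<d}} \<subseteq> H'" using tubes_agree[OF G' H'] w by auto
    ultimately have "x \<in> M closure_of H'" using closure_of_mono by blast
    then show ?thesis using tubeD(8)[OF H'] x by blast
  qed
  show ?thesis
    unfolding tube_def level_tube_def
  proof (intro conjI ballI impI)
    show "G \<union> H \<subseteq> Reg" "openin M (G \<union> H)" "min a c < max b d"
      using G'(1,2,4) H'(1,2,4) by (auto simp: min_def max_def)
    have "{a<..<b} \<union> {c<..<d} = {min a c<..<max b d}" using ov by auto
    then show "f ` (G \<union> H) = {min a c<..<max b d}" by (simp add: image_Un G' H')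
    fix x assume x: "x \<in> G \<union> H"
    show "\<L> x \<subseteq> G \<union> H" using x G'(7) H'(7) by blast
    fix y assume y: "y \<in> G \<union> H"
    show "\<L> x = \<L> y" if "f x = f y"
    proof (cases "x \<in> G")
      case True
      then have "x \<in> H" if "y \<in> H" using agG[OF True] H'(10)[OF that] \<open>f x = f y\<close> by simp
      then show ?thesis using True y G'(6)[OF True _ that] H'(6)[OF _ _ that] by blast
    next
      case False
      then have "x \<in> H" using x by blast
      then have "y \<in> H" using y agG[of y] H'(10)[of x] \<open>f x = f y\<close> by force
      then show ?thesis using \<open>x \<in> H\<close> H'(6)[OF _ _ that] by blast
    qed
    show "subtopology M (\<L> x) homeomorphic_space subtopology M (\<L> y)"
      using x y G'(9) H'(9) w homeomorphic_space_trans by (metis UnE)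
  next
    fix x assume x: "x \<in> M closure_of (G \<union> H)" and r: "min a c < f x \<and> f x < max b d"
    have "x \<in> M closure_of G \<or> x \<in> M closure_of H" using x by simp
    moreover have "a < f x \<and> f x < b \<or> c < f x \<and> f x < d" using r ov by auto
    ultimately show "x \<in> G \<union> H"
      using clos[OF G G w(1,1)] clos[OF G H w] clos[OF H G w(2,1)] clos[OF H H w(2,2)] by blast
  qed
qed

lemma tube_in_edge:
  assumes e: "e \<in> edges" and G: "tube G a b" "G \<inter> e \<noteq> {}" shows "G \<subseteq> e"
proof (rule connected_components_of_maximal[OF e])
  show "connectedin (subtopology M Reg) G"
    using tube_connected[OF G(1)] tubeD(2)[OF G(1)] by (simp add: connectedin_subtopology)
  show "\<not> disjnt e G" using G(2) by (auto simp: disjnt_def)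
qed

lemma edge_subset: "e \<in> edges \<Longrightarrow> e \<subseteq> Reg" "e \<in> edges \<Longrightarrow> e \<subseteq> topspace M"
  using connected_components_of_subset[of e "subtopology M Reg"] by auto

lemma edge_connected: "e \<in> edges \<Longrightarrow> connectedin M e"
  using connectedin_connected_components_of[of e "subtopology M Reg"] by (simp add: connectedin_subtopology)

lemma tube_at: "x \<in> Reg \<Longrightarrow> \<exists>G a b. x \<in> G \<and> tube G a b"
  using tubes[of x] by (auto simp: tube_def Reg_def)

text \<open>By \<open>tube_Un\<close>, a tube that meets some tube through \<open>x\<close> lies in
  a larger tube through \<open>x\<close>. So the union \<open>C\<close> of the tubes through
  \<open>x\<close> and the union \<open>D\<close> of the tubes that miss \<open>C\<close> are
  disjoint open sets covering the connected set \<open>e\<close>.\<close>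

lemma edge_common_tube:
  assumes e: "e \<in> edges" and x: "x \<in> e" and y: "y \<in> e"
  obtains G a b where "tube G a b" "x \<in> G" "y \<in> G" "G \<subseteq> e"
proof -
  define C where "C = \<Union>{G. \<exists>a b. tube G a b \<and> x \<in> G}"
  define D where "D = \<Union>{G. \<exists>a b. tube G a b \<and> G \<inter> C = {}}"
  have o: "openin M C" "openin M D" unfolding C_def D_def by (auto intro!: openin_Union dest: tubeD(1))
  have cov: "e \<subseteq> C \<union> D"
  proof
    fix z assume "z \<in> e"
    then obtain G a b where G: "z \<in> G" "tube G a b" using tube_at edge_subset(1)[OF e] by blast
    show "z \<in> C \<union> D"
    proof (cases "G \<inter> C = {}")
      case True then show ?thesis using G unfolding D_def by blast
    next
      case False
      then obtain G' a' b' where G': "tube G' a' b'" "x \<in> G'" "G \<inter> G' \<noteq> {}" unfolding C_def by blast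
      then show ?thesis using tube_Un[OF G(2) G'(1,3)] G unfolding C_def by blast
    qed
  qed
  have "C \<inter> D = {}" unfolding D_def by blast
  moreover have "x \<in> C" using tube_at edge_subset(1)[OF e] x unfolding C_def by blast
  ultimately have "y \<in> C"
    using edge_connected[OF e] o cov x y unfolding connectedin by blast
  then show ?thesis
    using that tube_in_edge[OF e] x unfolding C_def by blast
qed

text \<open>Most clauses of a tube concern at most two points at a time, and any two points of an
  edge lie in a common tube inside it. For a limit point, that tube is taken through two points with
  values on either side of its value.\<close>

lemma edge_tube:
  assumes e: "e \<in> edges" obtains a b where "tube e a b"
proof -
  have ne: "e \<noteq> {}" using nonempty_connected_components_of[OF e] .
  have op: "openin M e"
  proof (subst openin_subopen, intro ballI)
    fix x assume "x \<in> e"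
    then show "\<exists>T. openin M T \<and> x \<in> T \<and> T \<subseteq> e" using edge_common_tube[OF e, of x x] tubeD(1) by metis
  qed
  define a where "a = Inf (f ` e)"
  define b where "b = Sup (f ` e)"
  have opf: "open (f ` e)" using op edge_subset(1)[OF e] by (intro open_map) (auto simp: Reg_def)
  have "connectedin euclideanreal (f ` e)" using connectedin_continuous_map_image[OF cont edge_connected[OF e]] .
  then have cf: "connected (f ` e)" by simp
  have "compact (f ` topspace M)" by (rule compact_image_closedin) simp
  then have bd: "bdd_above (f ` e)" "bdd_below (f ` e)"
    using edge_subset(2)[OF e] bounded_imp_bdd_above bounded_imp_bdd_below bounded_subset[OF compact_imp_bounded]
    by (meson image_mono)+
  have fe: "f ` e = {a<..<b}"
  proof
    show "f ` e \<subseteq> {a<..<b}"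
    proof
      fix t assume t: "t \<in> f ` e"
      obtain d where d: "d > 0" "ball t d \<subseteq> f ` e" using opf t openE by blast
      have "t - d/2 \<in> f ` e" "t + d/2 \<in> f ` e" using d by (auto simp: dist_real_def subset_iff)
      then have "a \<le> t - d/2" "t + d/2 \<le> b" unfolding a_def b_def using bd by (auto intro: cInf_lower cSup_upper)
      then show "t \<in> {a<..<b}" using d by auto
    qed
    show "{a<..<b} \<subseteq> f ` e"
    proof
      fix t assume t: "t \<in> {a<..<b}"
      obtain u v where "u \<in> f ` e" "u < t" "v \<in> f ` e" "t < v"
        using t ne bd unfolding a_def b_def by (auto simp: cInf_less_iff less_cSup_iff)
      then show "t \<in> f ` e" using connectedD_interval[OF cf, of u v t] by simp
    qed
  qed
  have "tube e a b"
    unfolding tube_def level_tube_def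
  proof (intro conjI ballI impI)
    show "e \<subseteq> Reg" "openin M e" "f ` e = {a<..<b}" using edge_subset[OF e] op fe by auto
    show "a < b" using fe ne by (metis greaterThanLessThan_empty_iff image_is_empty not_less)
    fix x assume x: "x \<in> e"
    show "\<L> x \<subseteq> e"
    proof -
      obtain G a b where G: "tube G a b" "x \<in> G" "G \<subseteq> e" using edge_common_tube[OF e x x] .
      then show ?thesis using tubeD(7)[OF G(1,2)] by blast
    qed
    fix y assume y: "y \<in> e"
    obtain G a b where G: "tube G a b" "x \<in> G" "y \<in> G" using edge_common_tube[OF e x y] .
    show "\<L> x = \<L> y" if "f x = f y" using tubeD(6)[OF G that] .
    show "subtopology M (\<L> x) homeomorphic_space subtopology M (\<L> y)" using tubeD(9)[OF G] .
  next
    fix x assume x: "x \<in> M closure_of e" and fx: "a < f x \<and> f x < b"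
    obtain u v where "u \<in> f ` e" "u < f x" "v \<in> f ` e" "f x < v"
      using fx ne bd unfolding a_def b_def by (auto simp: cInf_less_iff less_cSup_iff)
    then obtain y z where yz: "y \<in> e" "z \<in> e" "f y < f x" "f x < f z" by blast
    obtain G c d where G: "tube G c d" "y \<in> G" "z \<in> G" "G \<subseteq> e" using edge_common_tube[OF e yz(1,2)] .
    have cd: "c < f x" "f x < d"
      using tubeD(10)[OF G(1) G(2)] tubeD(10)[OF G(1) G(3)] yz by auto
    have "x \<in> M closure_of {w \<in> e. f w \<in> {c<..<d}}" using x cd by (intro closure_of_local) auto
    \<comment> \<open>Over the values of \<open>G\<close> the edge has nothing outside
      \<open>G\<close>: a point \<open>w\<close> shares a tube with a point of \<open>G\<close> of
      the same value, and hence has the same component.\<close>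
    moreover have "{w \<in> e. f w \<in> {c<..<d}} \<subseteq> G"
    proof
      fix w assume "w \<in> {w \<in> e. f w \<in> {c<..<d}}"
      then have w: "w \<in> e" "f w \<in> f ` G" using tubeD(5)[OF G(1)] by auto
      then obtain v where v: "v \<in> G" "f v = f w" by (metis imageE)
      have "v \<in> e" using v(1) G(4) by blast
      obtain G' a' b' where G': "tube G' a' b'" "w \<in> G'" "v \<in> G'" "G' \<subseteq> e"
        using edge_common_tube[OF e w(1) \<open>v \<in> e\<close>] .
      have "\<L> v = \<L> w" by (rule tubeD(6)[OF G'(1,3,2) v(2)])
      then have "w \<in> \<L> v" using level_component_refl[of w M f] w(1) edge_subset(2)[OF e] by auto
      then show "w \<in> G" using tubeD(7)[OF G(1) v(1)] by blast
    qed
    ultimately have "x \<in> M closure_of G" using closure_of_mono by blast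
    then show "x \<in> e" using tubeD(8)[OF G(1)] cd G(4) by blast
  qed
  then show ?thesis by (rule that)
qed

end

text \<open>Stated for an arbitrary \<open>q\<close> because it is applied both to the Reeb graph
  and to the weak element space. The closed saturated set \<open>K\<close> bounds the closure of the
  image from above, and continuity bounds it from below.\<close>

lemma closure_of_quotient_image:
  assumes eX: "e \<subseteq> topspace X" and K: "closedin X K" "e \<subseteq> K"
    and sat: "\<And>x y. x \<in> topspace X \<Longrightarrow> y \<in> K \<Longrightarrow> q x = q y \<Longrightarrow> x \<in> K"
  shows "quotient_topology X q closure_of (q ` e) \<subseteq> q ` K"
    and "q ` (X closure_of e) \<subseteq> quotient_topology X q closure_of (q ` e)"
proof -
  note qm = quotient_map_quotient_topology[of X q]
  have "{x \<in> topspace X. q x \<in> q ` K} = K"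
    using sat closedin_subset[OF K(1)] by blast
  moreover have "q ` K \<subseteq> topspace (quotient_topology X q)"
    using closedin_subset[OF K(1)] by auto
  ultimately have "closedin (quotient_topology X q) (q ` K)"
    using qm[unfolded quotient_map_closedin, THEN conjunct2, rule_format, of "q ` K"] K(1) by simp
  then show "quotient_topology X q closure_of (q ` e) \<subseteq> q ` K"
    using K(2) by (intro closure_of_minimal image_mono)
  show "q ` (X closure_of e) \<subseteq> quotient_topology X q closure_of (q ` e)"
    using quotient_imp_continuous_map[OF qm] by (rule continuous_map_image_closure_subset)
qed

section \<open>Ends of edges, abstract weak elements and incidence\<close>

context reeb_space
begin

abbreviation "\<F> \<equiv> level_components M f"

abbreviation "weak \<equiv> abstract_weak_element M \<F>"

lemma edge_disjoint_V: "e \<in> edges \<Longrightarrow> L \<in> V \<Longrightarrow> e \<inter> L = {}"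
  using edge_subset(1) unfolding Reg_def by blast

text \<open>A regular limit point has a tube around it, which is open, so it meets the edge and
  therefore lies in it.\<close>

lemma edge_closure_V:
  assumes e: "e \<in> edges" and x: "x \<in> M closure_of e" "x \<notin> e" shows "x \<in> \<Union>V"
proof (rule ccontr)
  assume "x \<notin> \<Union>V"
  then have "x \<in> Reg" using x(1) closure_of_subset_topspace[of M e] unfolding Reg_def by blast
  then obtain G a b where G: "x \<in> G" "tube G a b" using tube_at by blast
  have "G \<inter> e \<noteq> {}" using x(1) G(1) tubeD(1)[OF G(2)] unfolding in_closure_of by blast
  then show False using tube_in_edge[OF e G(2)] G(1) x(2) by blast
qed

text \<open>\<open>unique_end\<close> is applied to \<open>f\<close> at the upper end of the
  interval and to the negative of \<open>f\<close> at the lower one. The closure clause of the tube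
  excludes further limit points at values in between.\<close>

lemma edge_ends:
  assumes e: "e \<in> edges"
  obtains L1 L2 where "L1 \<in> V" "L2 \<in> V" "M closure_of e \<subseteq> e \<union> L1 \<union> L2"
    "M closure_of e \<inter> L1 \<noteq> {}" "M closure_of e \<inter> L2 \<noteq> {}"
proof -
  obtain a b where T: "tube e a b" using edge_tube[OF e] .
  note t = tubeD[OF T]
  have top: "M closure_of e \<inter> {x. f x = b} \<subseteq> \<Union>V" "M closure_of e \<inter> {x. f x = a} \<subseteq> \<Union>V"
    using edge_closure_V[OF e] t(10) by fastforce+
  have ex: "\<exists>x\<in>e. f x = s" if "a < s" "s < b" for s
    using that t(5) by (metis greaterThanLessThan_iff imageE)
  obtain L2 where L2: "L2 \<in> V" "M closure_of e \<inter> {x. f x = b} \<subseteq> L2" "M closure_of e \<inter> {x. f x = b} \<noteq> {}"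
  proof (rule unique_end[OF cont fin V_closed V_disjoint t(3), where b = b])
    fix s assume s: "s < b"
    obtain r where "max a s < r" "r < b" using dense[of "max a s" b] t(4) s by auto
    then show "\<exists>x\<in>e. s < f x" using ex[of r] by auto
    have "{x \<in> e. f x > s} = {x \<in> e. f x \<in> {max a s<..<b}}" using t(10) by auto
    moreover have "connectedin M \<dots>" by (rule tube_part_connected[OF T]) auto
    ultimately show "connectedin M {x \<in> e. f x > s}" by (rule ssubst)
  qed (use t(10) top in auto)
  have contm: "continuous_map M euclideanreal (\<lambda>x. - f x)" using cont by (intro continuous_map_minus)
  obtain L1 where L1: "L1 \<in> V" "M closure_of e \<inter> {x. - f x = - a} \<subseteq> L1" "M closure_of e \<inter> {x. - f x = - a} \<noteq> {}"
  proof (rule unique_end[OF contm fin V_closed V_disjoint t(3), where b = "- a"])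
    fix s assume s: "s < - a"
    obtain r where "a < r" "r < min b (- s)" using dense[of a "min b (- s)"] t(4) s by auto
    then show "\<exists>x\<in>e. s < - f x" using ex[of r] by force
    have "{x \<in> e. - f x > s} = {x \<in> e. f x \<in> {a<..<min b (- s)}}" using t(10) by auto
    moreover have "connectedin M \<dots>" by (rule tube_part_connected[OF T]) auto
    ultimately show "connectedin M {x \<in> e. - f x > s}" by (rule ssubst)
  qed (use t(10) top in auto)
  have "M closure_of e \<subseteq> e \<union> L1 \<union> L2"
  proof
    fix x assume x: "x \<in> M closure_of e"
    have "f x \<in> {a..b}" using closure_level_bounds[OF x, of "{a..b}"] t(10) by (auto simp: less_imp_le)
    then consider "f x = a" | "f x = b" | "a < f x" "f x < b" by fastforce
    then show "x \<in> e \<union> L1 \<union> L2" using x L1(2) L2(2) t(8) by cases auto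
  qed
  moreover have "M closure_of e \<inter> L1 \<noteq> {}" "M closure_of e \<inter> L2 \<noteq> {}" using L1(2,3) L2(2,3) by blast+
  ultimately show ?thesis using that L1 L2 by blast
qed

abbreviation "\<Q> \<equiv> decomposition_space M \<F>"

lemma own_component: "x \<in> topspace M \<Longrightarrow> x \<in> \<L> x"
  by (rule level_component_refl)

lemma element_of_F: "x \<in> topspace M \<Longrightarrow> element_of \<F> x = \<L> x"
  by (rule element_of_level_component)

lemma in_F: "L \<in> \<F> \<Longrightarrow> \<exists>x\<in>topspace M. L = \<L> x"
  by (auto simp: level_components_eq)

lemma similar_elements_eq:
  assumes "L \<in> \<F>"
  shows "similar_elements M \<F> L = {L' \<in> \<F>. subtopology M L' homeomorphic_space subtopology M L}"
proof -
  have "M closure_of L' = L'" if L': "L' \<in> \<F>" for L'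
  proof -
    have "closedin M L'" using in_F[OF L'] closedin_level_component by auto
    then show ?thesis by (simp add: closure_of_closedin)
  qed
  then show ?thesis using assms by (simp add: similar_elements_def proper_element_def cong: conj_cong)
qed

lemma topspace_Q: "topspace \<Q> = \<F>"
  by (auto simp: decomposition_space_def level_components_eq element_of_level_component[unfolded level_components_eq])

lemma continuous_element_of: "continuous_map M \<Q> (element_of \<F>)"
  unfolding decomposition_space_def
  using quotient_map_quotient_topology by (rule quotient_imp_continuous_map)

lemma closedin_Q:
  assumes "S \<subseteq> \<F>" "finite S" shows "closedin \<Q> S"
proof -
  have "closedin M L" if "L \<in> S" for L
    using that assms in_F closedin_level_component by blast
  then have cl: "closedin M (\<Union>S)" using assms(2) by (intro closedin_Union) auto
  have "{x \<in> topspace M. element_of \<F> x \<in> S} = \<Union>S"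
  proof safe
    fix x assume x: "x \<in> topspace M" "element_of \<F> x \<in> S"
    then show "x \<in> \<Union>S" using element_of_F[OF x(1)] own_component[OF x(1)] by auto
  next
    fix x L assume x: "x \<in> L" "L \<in> S"
    obtain y where y: "L = \<L> y" using x assms in_F by blast
    then show "x \<in> topspace M" using x level_component_subset[of M f y] by blast
    then show "element_of \<F> x \<in> S"
      using element_of_F[of x] level_component_cong[of x M f y] x y by simp
  qed
  moreover have "quotient_map M \<Q> (element_of \<F>)"
    unfolding decomposition_space_def by (rule quotient_map_quotient_topology)
  ultimately show ?thesis
    using cl assms(1) topspace_Q
    by (simp add: quotient_map_closedin[of M \<Q>, THEN iffD1, THEN conjunct2, rule_format, of "element_of \<F>" S, symmetric])
qed

lemma openin_Q:
  assumes "openin M U" "\<And>x. x \<in> U \<Longrightarrow> \<L> x \<subseteq> U"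
  shows "openin \<Q> (\<L> ` U)"
proof -
  have sub: "U \<subseteq> topspace M" using assms(1) openin_subset by blast
  have "{x \<in> topspace M. element_of \<F> x \<in> \<L> ` U} = U"
  proof safe
    fix x y assume x: "x \<in> topspace M" and y: "element_of \<F> x = \<L> y" "y \<in> U"
    then have "x \<in> \<L> y" using element_of_F[OF x] own_component[OF x] by simp
    then show "x \<in> U" using assms(2)[OF y(2)] by blast
  next
    fix x assume "x \<in> U"
    then show "x \<in> topspace M" "element_of \<F> x \<in> \<L> ` U"
      using sub element_of_level_component[of x M f] by auto
  qed
  then show ?thesis
    using assms(1) sub unfolding decomposition_space_def openin_quotient_topology
    by (auto simp: element_of_level_component image_iff)
qed

lemma weak_eq:
  assumes L: "L \<in> \<F>"
  shows "weak L = {x \<in> topspace M. \<exists>C. connectedin \<Q> C \<and> L \<in> C \<and> \<L> x \<in> C \<and>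
     C \<subseteq> {L' \<in> \<F>. subtopology M L' homeomorphic_space subtopology M L}}"
  unfolding abstract_weak_element_def similar_elements_eq[OF L]
  by (intro Collect_cong conj_cong refl)
    (auto simp: connected_component_of_def connectedin_subtopology element_of_F)

text \<open>A set of components homeomorphic to \<open>L\<close> contains only vertices, by
  \<open>distinct\<close>. The finitely many vertices form a discrete subspace of the quotient, so a
  connected such set around \<open>L\<close> is \<open>{L}\<close>.\<close>

lemma weak_vertex:
  assumes L: "L \<in> V" shows "weak L = L"
proof -
  have LF: "L \<in> \<F>" using L V by blast
  have only: "\<L> x = L" if x: "x \<in> topspace M" and C: "connectedin \<Q> C" "L \<in> C" "\<L> x \<in> C"
    "C \<subseteq> {L' \<in> \<F>. subtopology M L' homeomorphic_space subtopology M L}" for x C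
  proof (rule ccontr)
    assume ne: "\<L> x \<noteq> L"
    have CV: "C \<subseteq> V"
    proof
      fix L' assume "L' \<in> C"
      then have L': "L' \<in> \<F>" "subtopology M L homeomorphic_space subtopology M L'"
        using C(4) homeomorphic_space_sym by blast+
      obtain y where y: "y \<in> topspace M" "L' = \<L> y" using in_F[OF L'(1)] by blast
      then have "y \<in> \<Union>V" using distinct[OF L, of y] L'(2) by blast
      then show "L' \<in> V" using V_eq y by auto
    qed
    then have "closedin \<Q> {L}" "closedin \<Q> (C - {L})"
      using V fin L by (auto intro!: closedin_Q dest: finite_subset)
    then show False
      using C(1,2,3) ne unfolding connectedin_closedin by blast
  qed
  have self: "\<exists>C. connectedin \<Q> C \<and> L \<in> C \<and> \<L> x \<in> C \<and>
     C \<subseteq> {L' \<in> \<F>. subtopology M L' homeomorphic_space subtopology M L}" if "\<L> x = L" for x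
    using that LF topspace_Q by (intro exI[of _ "{L}"]) auto
  have "weak L = {x \<in> topspace M. \<L> x = L}"
    unfolding weak_eq[OF LF]
  proof (intro Collect_cong conj_cong refl iffI)
    fix x assume x: "x \<in> topspace M"
    assume "\<exists>C. connectedin \<Q> C \<and> L \<in> C \<and> \<L> x \<in> C \<and>
     C \<subseteq> {L' \<in> \<F>. subtopology M L' homeomorphic_space subtopology M L}"
    then show "\<L> x = L" by (elim exE conjE) (rule only[OF x])
  qed (rule self)
  also have "\<dots> = L" using V_eq[OF L] own_component by auto
  finally show ?thesis .
qed

lemma edge_saturated: "e \<in> edges \<Longrightarrow> x \<in> e \<Longrightarrow> \<L> x \<subseteq> e"
  by (metis edge_tube tubeD(7))

lemma openin_edge: "e \<in> edges \<Longrightarrow> openin M e"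
  by (metis edge_tube tubeD(1))

lemma edges_Union: "\<Union>edges = Reg"
  using Union_connected_components_of[of "subtopology M Reg"] unfolding Reg_def
  by (simp add: inf.absorb2)

text \<open>By \<open>distinct\<close>, a set of components homeomorphic to \<open>\<L> x\<close>
  avoids \<open>V\<close> and is covered by the images of \<open>e\<close> and of the other edges,
  which are disjoint and open in the quotient; a connected one stays in the image of
  \<open>e\<close>. Conversely that image is connected, and its components are homeomorphic because
  \<open>e\<close> is a tube.\<close>

lemma weak_edge:
  assumes e: "e \<in> edges" and x: "x \<in> e" shows "weak (\<L> x) = e"
proof -
  have xM: "x \<in> topspace M" using edge_subset(2)[OF e] x by blast
  then have LF: "\<L> x \<in> \<F>" by (simp add: level_components_eq)
  obtain a b where T: "tube e a b" using edge_tube[OF e] .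
  have sat: "y \<in> e" if "y \<in> topspace M" "\<L> y \<in> \<L> ` e" for y
    using that edge_saturated[OF e] level_component_refl[of y M f] by auto
  have only: "\<L> y \<in> \<L> ` e" if C: "connectedin \<Q> C" "\<L> x \<in> C" "\<L> y \<in> C"
    "C \<subseteq> {L' \<in> \<F>. subtopology M L' homeomorphic_space subtopology M (\<L> x)}" for y C
  proof (rule ccontr)
    assume ne: "\<L> y \<notin> \<L> ` e"
    define D where "D = \<Union>(edges - {e})"
    have o: "openin M e" "openin M D" unfolding D_def using openin_edge e by auto
    have cov: "C \<subseteq> \<L> ` e \<union> \<L> ` D"
    proof
      fix L' assume L': "L' \<in> C"
      then obtain z where z: "z \<in> topspace M" "L' = \<L> z" using C(4) in_F by blast
      have "z \<notin> \<Union>V"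
      proof
        assume "z \<in> \<Union>V"
        then have "L' \<in> V" using V_eq z(2) by auto
        moreover have "x \<in> topspace M - \<Union>V" using edge_subset(1)[OF e] x by (auto simp: Reg_def)
        ultimately show False using distinct C(4) L' by blast
      qed
      then have "z \<in> e \<union> D" using z edges_Union unfolding D_def Reg_def by blast
      then show "L' \<in> \<L> ` e \<union> \<L> ` D" using z by blast
    qed
    have "\<L> ` e \<inter> \<L> ` D = {}"
    proof (rule ccontr)
      assume "\<L> ` e \<inter> \<L> ` D \<noteq> {}"
      then obtain u v where uv: "u \<in> e" "v \<in> D" "\<L> u = \<L> v" by (auto simp: disjoint_iff)
      then obtain e' where e': "e' \<in> edges" "e' \<noteq> e" "v \<in> e'" unfolding D_def by blast
      then have "v \<in> topspace M" using edge_subset(2) by blast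
      then have "v \<in> e" using sat[of v] uv by (metis imageI)
      then show False using pairwise_disjoint_connected_components_of e' e
        by (metis disjnt_iff pairwiseD)
    qed
    moreover have "openin \<Q> (\<L> ` e)" using o edge_saturated[OF e] by (intro openin_Q)
    moreover have "openin \<Q> (\<L> ` D)"
      using o(2) edge_saturated unfolding D_def by (intro openin_Q) blast+
    moreover have "\<L> ` e \<inter> C \<noteq> {}" using x C(2) by blast
    moreover have "\<L> ` D \<inter> C \<noteq> {}"
    proof -
      have "\<L> y \<in> \<L> ` D" using cov C(3) ne by (meson UnE subsetD)
      with C(3) have "\<L> y \<in> \<L> ` D \<inter> C" by (rule IntI[rotated])
      then show ?thesis by (metis empty_iff)
    qed
    ultimately show False using connectedinD[OF C(1), of "\<L> ` e" "\<L> ` D"] cov by blast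
  qed
  have self: "\<exists>C. connectedin \<Q> C \<and> \<L> x \<in> C \<and> \<L> y \<in> C \<and>
     C \<subseteq> {L' \<in> \<F>. subtopology M L' homeomorphic_space subtopology M (\<L> x)}" if y: "y \<in> e" for y
  proof (intro exI[of _ "\<L> ` e"] conjI)
    have "connectedin \<Q> (element_of \<F> ` e)"
      using continuous_element_of edge_connected[OF e] by (rule connectedin_continuous_map_image)
    moreover have "element_of \<F> ` e = \<L> ` e"
      using edge_subset(2)[OF e] element_of_F by (intro image_cong) auto
    ultimately show "connectedin \<Q> (\<L> ` e)" by simp
    show "\<L> ` e \<subseteq> {L' \<in> \<F>. subtopology M L' homeomorphic_space subtopology M (\<L> x)}"
      using edge_subset(2)[OF e] tubeD(9)[OF T _ x] by (auto simp: level_components_eq)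
  qed (use x y in auto)
  show ?thesis
    unfolding weak_eq[OF LF]
  proof (intro subset_antisym subsetI)
    fix y assume "y \<in> {y \<in> topspace M. \<exists>C. connectedin \<Q> C \<and> \<L> x \<in> C \<and> \<L> y \<in> C \<and>
     C \<subseteq> {L' \<in> \<F>. subtopology M L' homeomorphic_space subtopology M (\<L> x)}}"
    then have y: "y \<in> topspace M" and "\<exists>C. connectedin \<Q> C \<and> \<L> x \<in> C \<and> \<L> y \<in> C \<and>
     C \<subseteq> {L' \<in> \<F>. subtopology M L' homeomorphic_space subtopology M (\<L> x)}" by simp_all
    from this(2) have "\<L> y \<in> \<L> ` e" by (elim exE conjE) (rule only)
    then show "y \<in> e" by (rule sat[OF y])
  next
    fix y assume y: "y \<in> e"
    then show "y \<in> {y \<in> topspace M. \<exists>C. connectedin \<Q> C \<and> \<L> x \<in> C \<and> \<L> y \<in> C \<and>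
     C \<subseteq> {L' \<in> \<F>. subtopology M L' homeomorphic_space subtopology M (\<L> x)}}"
      using self[OF y] edge_subset(2)[OF e] by blast
  qed
qed

theorem weak_elements: "weak ` \<F> = V \<union> edges"
proof
  show "weak ` \<F> \<subseteq> V \<union> edges"
  proof
    fix W assume "W \<in> weak ` \<F>"
    then obtain x where x: "x \<in> topspace M" "W = weak (\<L> x)" using in_F by blast
    show "W \<in> V \<union> edges"
    proof (cases "x \<in> \<Union>V")
      case True
      then show ?thesis using x weak_vertex V_eq by auto
    next
      case False
      then obtain e where "e \<in> edges" "x \<in> e" using x(1) edges_Union unfolding Reg_def by blast
      then show ?thesis using weak_edge x(2) by simp
    qed
  qed
  show "V \<union> edges \<subseteq> weak ` \<F>"
  proof
    fix W assume "W \<in> V \<union> edges"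
    then show "W \<in> weak ` \<F>"
    proof
      assume "W \<in> V" then show ?thesis using weak_vertex V by (metis imageI subsetD)
    next
      assume W: "W \<in> edges"
      then obtain x where x: "x \<in> W" using nonempty_connected_components_of by fastforce
      then have "\<L> x \<in> \<F>" using edge_subset(2)[OF W] by (auto simp: level_components_eq)
      then show ?thesis using weak_edge[OF W x] by (metis imageI)
    qed
  qed
qed

lemma topspace_weak_space: "topspace (abstract_weak_element_space M \<F>) = V \<union> edges"
proof -
  have "element_of \<F> ` topspace M = \<F>"
    using topspace_Q by (simp add: decomposition_space_def)
  then show ?thesis
    unfolding abstract_weak_element_space_def using weak_elements by (simp add: image_image[symmetric])
qed

lemma V_edges_disjoint: "V \<inter> edges = {}"
  using edge_disjoint_V V_nonempty by blast

text \<open>The two closures are taken in different quotients of \<open>M\<close>, by components and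
  by weak elements. Both quotient maps send the points of a vertex to that vertex and separate
  \<open>e\<close> from all other points. \<open>main\<close> relies on such common properties only,
  so both quotients yield the same \<open>L1\<close> and \<open>L2\<close>.\<close>

lemma incidence:
  assumes e: "e \<in> edges"
  obtains L1 L2 where "L1 \<in> V" "L2 \<in> V" "V \<inter> \<Q> closure_of (element_of \<F> ` e) = {L1, L2}"
    "V \<inter> abstract_weak_element_space M \<F> closure_of {e} = {L1, L2}"
proof -
  obtain L1 L2 where L: "L1 \<in> V" "L2 \<in> V" "M closure_of e \<subseteq> e \<union> L1 \<union> L2"
    "M closure_of e \<inter> L1 \<noteq> {}" "M closure_of e \<inter> L2 \<noteq> {}" using edge_ends[OF e] .
  \<comment> \<open>Closed, as it is the closure of \<open>e\<close> enlarged by two closed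
    vertices, and saturated for either quotient.\<close>
  define K where "K = e \<union> L1 \<union> L2"
  have eM: "e \<subseteq> topspace M" by (rule edge_subset(2)[OF e])
  have K: "closedin M K" "e \<subseteq> K"
  proof -
    have "K = M closure_of e \<union> L1 \<union> L2" using L(3) closure_of_subset[OF eM] by (auto simp: K_def)
    then show "closedin M K" using V_closed[OF L(1)] V_closed[OF L(2)] by (simp add: closedin_Un)
  qed (auto simp: K_def)
  have main: "V \<inter> quotient_topology M q closure_of (q ` e) = {L1, L2}"
    if qV: "\<And>L x. L \<in> V \<Longrightarrow> x \<in> L \<Longrightarrow> q x = L"
      and qM: "\<And>x. x \<in> topspace M \<Longrightarrow> q x \<in> V \<Longrightarrow> x \<in> q x"
      and qs: "\<And>x y. x \<in> e \<Longrightarrow> y \<in> topspace M \<Longrightarrow> q y = q x \<Longrightarrow> y \<in> e" for q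
  proof -
    have sat: "x \<in> K" if x: "x \<in> topspace M" and y: "y \<in> K" and eq: "q x = q y" for x y
    proof (cases "y \<in> e")
      case True then show ?thesis using qs[OF True x eq] by (simp add: K_def)
    next
      case False
      then have "q x \<in> {L1, L2}" using y qV L unfolding K_def eq by blast
      then show ?thesis using qM[OF x] L(1,2) by (auto simp: K_def)
    qed
    have qe: "q x \<notin> V" if "x \<in> e" for x
      using qM[of x] edge_disjoint_V[OF e] eM that by blast
    have clo: "quotient_topology M q closure_of (q ` e) \<subseteq> q ` K"
      "q ` (M closure_of e) \<subseteq> quotient_topology M q closure_of (q ` e)"
      by (intro closure_of_quotient_image[OF eM K]; rule sat; assumption)+
    show ?thesis
    proof
      have "q x \<in> {L1, L2}" if "x \<in> K" "q x \<in> V" for x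
        using that qe[of x] qV[OF L(1), of x] qV[OF L(2), of x] unfolding K_def by auto
      then have "q ` K \<inter> V \<subseteq> {L1, L2}" by blast
      then show "V \<inter> quotient_topology M q closure_of (q ` e) \<subseteq> {L1, L2}" using clo(1) by blast
      obtain x1 x2 where "x1 \<in> M closure_of e" "x1 \<in> L1" "x2 \<in> M closure_of e" "x2 \<in> L2" using L(4,5) by blast
      then have "L1 \<in> q ` (M closure_of e)" "L2 \<in> q ` (M closure_of e)"
        using qV[OF L(1)] qV[OF L(2)] by (metis imageI)+
      then show "{L1, L2} \<subseteq> V \<inter> quotient_topology M q closure_of (q ` e)" using clo(2) L(1,2) by blast
    qed
  qed
  have el: "element_of \<F> x = \<L> x" if "x \<in> topspace M" for x
    using that by (rule element_of_level_component)
  have "V \<inter> \<Q> closure_of (element_of \<F> ` e) = {L1, L2}"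
    unfolding decomposition_space_def
  proof (rule main)
    show "element_of \<F> x = L" if "L \<in> V" "x \<in> L" for L x
      using V_eq[OF that] el by simp
    show "x \<in> element_of \<F> x" if "x \<in> topspace M" for x
      using el[OF that] level_component_refl[OF that, of f] by simp
    show "y \<in> e" if "x \<in> e" "y \<in> topspace M" "element_of \<F> y = element_of \<F> x" for x y
    proof -
      have "x \<in> topspace M" using that eM by blast
      then have "\<L> y = \<L> x" using that el by simp
      then show ?thesis using edge_saturated[OF e that(1)] level_component_refl[OF that(2), of f] by auto
    qed
  qed
  moreover have "V \<inter> abstract_weak_element_space M \<F> closure_of ((\<lambda>x. weak (element_of \<F> x)) ` e) = {L1, L2}"
    unfolding abstract_weak_element_space_def
  proof (rule main)
    show "weak (element_of \<F> x) = L" if "L \<in> V" "x \<in> L" for L x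
      using V_eq[OF that] el[of x] weak_vertex[OF that(1)] by simp
    have w: "weak (element_of \<F> x) = e'" if "e' \<in> edges" "x \<in> e'" for x e'
      using weak_edge[OF that] el[of x] edge_subset(2)[OF that(1)] that(2) by auto
    have cases: "x \<in> \<Union>V \<or> (\<exists>e'\<in>edges. x \<in> e')" if "x \<in> topspace M" for x
      using that edges_Union unfolding Reg_def by blast
    show own: "x \<in> weak (element_of \<F> x)" if "x \<in> topspace M" for x
      using cases[OF that]
    proof
      assume "x \<in> \<Union>V"
      then show ?thesis using V_eq el[OF that] weak_vertex by auto
    next
      assume "\<exists>e'\<in>edges. x \<in> e'"
      then show ?thesis using w by auto
    qed
    show "y \<in> e" if "x \<in> e" "y \<in> topspace M" "weak (element_of \<F> y) = weak (element_of \<F> x)" for x y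
    proof -
      have "weak (element_of \<F> y) = e" using w[OF e that(1)] that(3) by simp
      moreover have "y \<in> weak (element_of \<F> y)" by (rule own[OF that(2)])
      ultimately show ?thesis by simp
    qed
  qed
  \<comment> \<open>In the weak element space the whole edge is a single point.\<close>
  moreover have "(\<lambda>x. weak (element_of \<F> x)) ` e = {e}"
  proof -
    have "weak (element_of \<F> x) = e" if "x \<in> e" for x
      using weak_edge[OF e that] el[of x] eM that by auto
    moreover have "e \<noteq> {}" using nonempty_connected_components_of[OF e] .
    ultimately show ?thesis by auto
  qed
  ultimately show ?thesis using that[OF L(1,2)] by simp
qed

end

section \<open>Morse functions in charts\<close>

text \<open>Local flatness of dimension \<open>dim T\<close>. The model is a ball in a linear
  subspace of the chart space, since a hyperplane of \<open>'b\<close> has no Euclidean space type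
  of its own.\<close>

definition flat_at :: "'a topology \<Rightarrow> 'a \<Rightarrow> 'b::euclidean_space set \<Rightarrow> bool" where
  "flat_at X x T \<longleftrightarrow> (\<exists>Q d h k. openin X Q \<and> x \<in> Q \<and> d > 0 \<and>
     homeomorphic_maps (subtopology X Q) (top_of_set (T \<inter> ball 0 d)) h k \<and> h x = 0)"

lemma flat_at_homeomorphic:
  assumes hom: "homeomorphic_maps X Y a b" and x: "flat_at X x T"
  shows "flat_at Y (a x) T"
proof -
  obtain Q d h k where Q: "openin X Q" "x \<in> Q" "d > 0"
    "homeomorphic_maps (subtopology X Q) (top_of_set (T \<inter> ball 0 d)) h k" "h x = 0"
    using x unfolding flat_at_def by blast
  have Qs: "Q \<subseteq> topspace X" using Q(1) openin_subset by blast
  have ba: "b (a y) = y" if "y \<in> topspace X" for y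
    using hom that by (simp add: homeomorphic_maps_def)
  have ma: "homeomorphic_map X Y a" using hom homeomorphic_maps_map by blast
  have o: "openin Y (a ` Q)" using homeomorphic_map_openness_eq[OF ma] Q(1) by blast
  have "homeomorphic_maps (subtopology X Q) (subtopology Y (a ` Q)) a b"
  proof (rule homeomorphic_maps_subtopologies[OF hom])
    have "a ` (topspace X \<inter> Q) = a ` Q" using Qs by (simp add: inf.absorb2)
    moreover have "topspace Y \<inter> a ` Q = a ` Q" using openin_subset[OF o] by blast
    ultimately show "a ` (topspace X \<inter> Q) = topspace Y \<inter> a ` Q" by simp
  qed
  then have "homeomorphic_maps (subtopology Y (a ` Q)) (subtopology X Q) b a"
    by (rule homeomorphic_maps_sym[THEN iffD1])
  then have "homeomorphic_maps (subtopology Y (a ` Q)) (top_of_set (T \<inter> ball 0 d)) (h \<circ> b) (a \<circ> k)"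
    using Q(4) by (intro homeomorphic_maps_compose) (rule conjI)
  moreover have "(h \<circ> b) (a x) = 0" using ba Qs Q(2,5) by auto
  ultimately show ?thesis unfolding flat_at_def using o Q(2,3) by blast
qed

text \<open>The estimates at a saddle hold only in a small ball. Restricting the model to a smaller
  concentric ball brings the flat neighbourhood into any given one while keeping its form.\<close>

lemma flat_at_shrink:
  assumes x: "flat_at X x T" and T: "0 \<in> T" and W: "openin X W" "x \<in> W"
  obtains Q d h k where "openin X Q" "x \<in> Q" "Q \<subseteq> W" "d > 0"
    "homeomorphic_maps (subtopology X Q) (top_of_set (T \<inter> ball 0 d)) h k" "h x = 0"
proof -
  obtain Q d h k where Q: "openin X Q" "x \<in> Q" "d > 0"
    "homeomorphic_maps (subtopology X Q) (top_of_set (T \<inter> ball 0 d)) h k" "h x = 0"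
    using x unfolding flat_at_def by blast
  have Qs: "Q \<subseteq> topspace X" using Q(1) openin_subset by blast
  let ?B = "T \<inter> ball 0 d"
  have hm: "continuous_map (subtopology X Q) (top_of_set ?B) h" "continuous_map (top_of_set ?B) (subtopology X Q) k"
    and hk: "\<And>y. y \<in> Q \<Longrightarrow> k (h y) = y" "\<And>y. y \<in> ?B \<Longrightarrow> h (k y) = y"
    using Q(4) Qs unfolding homeomorphic_maps_def by auto
  have kx: "k 0 = x" using hk(1)[OF Q(2)] Q(5) by simp
  have "openin (subtopology X Q) (Q \<inter> W)" using W(1) by (auto simp: openin_subtopology)
  from openin_continuous_map_preimage[OF hm(2) this]
  have o: "openin (top_of_set ?B) {y \<in> ?B. k y \<in> Q \<inter> W}" by simp
  have "0 \<in> {y \<in> ?B. k y \<in> Q \<inter> W}" using kx Q(2,3) W(2) T by simp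
  then obtain e where e: "e > 0" "ball 0 e \<inter> ?B \<subseteq> {y \<in> ?B. k y \<in> Q \<inter> W}"
    using o unfolding openin_contains_ball by blast
  define d' where "d' = min e d"
  have d': "d' > 0" "d' \<le> d" "d' \<le> e" using e(1) Q(3) by (auto simp: d'_def)
  let ?B' = "T \<inter> ball 0 d'"
  have B'B: "?B' \<subseteq> ?B" "?B' = ?B \<inter> ball 0 d'" using d' by auto
  define Q' where "Q' = {y \<in> Q. h y \<in> ?B'}"
  have "openin (top_of_set ?B) ?B'" unfolding B'B(2) by (intro openin_open_Int) simp
  from openin_continuous_map_preimage[OF hm(1) this]
  have "openin (subtopology X Q) Q'" using Qs by (simp add: Q'_def inf.absorb2)
  then have oQ': "openin X Q'" using Q(1) openin_trans_full by blast
  have Q'W: "Q' \<subseteq> W"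
  proof
    fix y assume "y \<in> Q'"
    then have y: "y \<in> Q" "h y \<in> ?B'" by (auto simp: Q'_def)
    then have "h y \<in> ball 0 e \<inter> ?B" using d' by auto
    then have "k (h y) \<in> W" using e(2) by blast
    then show "y \<in> W" using hk(1)[OF y(1)] by simp
  qed
  have "homeomorphic_maps (subtopology (subtopology X Q) Q') (subtopology (top_of_set ?B) ?B') h k"
  proof (rule homeomorphic_maps_subtopologies[OF Q(4)])
    have km: "k y \<in> Q" if "y \<in> ?B" for y
      using continuous_map_image_subset_topspace[OF hm(2)] that by auto
    have "h ` Q' = ?B'"
    proof
      show "?B' \<subseteq> h ` Q'"
      proof
        fix y assume y: "y \<in> ?B'"
        then have "h (k y) = y" "k y \<in> Q" using hk(2) km B'B(1) by blast+
        then show "y \<in> h ` Q'" unfolding Q'_def using y by (intro image_eqI[of _ h "k y"]) auto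
      qed
    qed (auto simp: Q'_def)
    moreover have "topspace (subtopology X Q) \<inter> Q' = Q'" using Qs by (auto simp: Q'_def)
    moreover have "topspace (top_of_set ?B) \<inter> ?B' = ?B'" using B'B(1) by auto
    ultimately show "h ` (topspace (subtopology X Q) \<inter> Q') = topspace (top_of_set ?B) \<inter> ?B'" by simp
  qed
  moreover have "subtopology (subtopology X Q) Q' = subtopology X Q'"
    unfolding subtopology_subtopology by (intro arg_cong[where f = "subtopology X"]) (auto simp: Q'_def)
  moreover have "subtopology (top_of_set ?B) ?B' = top_of_set ?B'"
    unfolding subtopology_subtopology using B'B(1) by (simp add: inf.absorb2)
  ultimately have "homeomorphic_maps (subtopology X Q') (top_of_set ?B') h k" by simp
  moreover have "x \<in> Q'" unfolding Q'_def using Q(2,5) T d'(1) by simp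
  ultimately show ?thesis using that[OF oQ' _ Q'W d'(1)] Q(5) by blast
qed

text \<open>Continuity of the derivative is assumed one direction at a time, which is the form that
  \<open>Ck_on\<close> provides. Bounds for the basis directions near \<open>y\<close> add up to a
  bound \<open>K\<close> on the operator norm, and the ball is convex.\<close>

lemma C1_directional_bound:
  fixes g :: "'b::euclidean_space \<Rightarrow> 'c::real_normed_vector"
  assumes S: "open S" "y \<in> S" and D: "\<And>x. x \<in> S \<Longrightarrow> (g has_derivative D x) (at x)"
    and c: "\<And>v. continuous_on S (\<lambda>x. D x v)"
  obtains r K where "r > 0" "cball y r \<subseteq> S" "K-lipschitz_on (cball y r) g"
proof -
  have "\<exists>r>0. \<forall>x\<in>cball y r. x \<in> S \<and> norm (D x b) \<le> norm (D y b) + 1" for b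
  proof -
    obtain r1 where r1: "r1 > 0" "cball y r1 \<subseteq> S" using S open_contains_cball by blast
    have "continuous (at y) (\<lambda>x. D x b)" using c S continuous_on_eq_continuous_at by blast
    then obtain d where d: "d > 0" "\<And>x. dist x y < d \<Longrightarrow> dist (D x b) (D y b) < 1"
      unfolding continuous_at_eps_delta using zero_less_one by blast
    have "x \<in> S \<and> norm (D x b) \<le> norm (D y b) + 1" if "x \<in> cball y (min r1 (d / 2))" for x
    proof
      show "x \<in> S" using that r1 by auto
      have "dist (D x b) (D y b) < 1" using that d by (auto simp: dist_commute)
      then show "norm (D x b) \<le> norm (D y b) + 1"
        using norm_triangle_ineq2[of "D x b" "D y b"] by (simp add: dist_norm)
    qed
    moreover have "min r1 (d / 2) > 0" using r1 d by simp
    ultimately show ?thesis by blast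
  qed
  then obtain r where r: "\<And>b. r b > 0" "\<And>b x. x \<in> cball y (r b) \<Longrightarrow> x \<in> S \<and> norm (D x b) \<le> norm (D y b) + 1"
    by metis
  define R where "R = Min (r ` Basis)"
  have R: "R > 0" "\<And>b. b \<in> Basis \<Longrightarrow> R \<le> r b" using r by (auto simp: R_def)
  define K where "K = (\<Sum>b\<in>Basis. norm (D y b) + 1)"
  have K: "K \<ge> 0" unfolding K_def by (intro sum_nonneg) (simp add: add_nonneg_nonneg)
  have sub: "cball y R \<subseteq> S" using R(2) r(2) nonempty_Basis by (metis all_not_in_conv mem_cball order_trans subsetI)
  have "norm (g u - g w) \<le> K * norm (u - w)" if "u \<in> cball y R" "w \<in> cball y R" for u w
  proof (rule differentiable_bound[OF convex_cball])
    fix x assume x: "x \<in> cball y R"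
    then have xS: "x \<in> S" using sub by blast
    show "(g has_derivative D x) (at x within cball y R)" using D[OF xS] has_derivative_at_withinI by blast
    have lin: "linear (D x)" using D[OF xS] has_derivative_linear by blast
    show "onorm (D x) \<le> K"
    proof (rule onorm_le)
      fix v
      have "D x v = D x (\<Sum>b\<in>Basis. (v \<bullet> b) *\<^sub>R b)" by (simp add: euclidean_representation)
      also have "\<dots> = (\<Sum>b\<in>Basis. (v \<bullet> b) *\<^sub>R D x b)" by (simp add: linear_sum[OF lin] linear_cmul[OF lin])
      finally have "norm (D x v) \<le> (\<Sum>b\<in>Basis. norm ((v \<bullet> b) *\<^sub>R D x b))" by (metis norm_sum)
      also have "\<dots> \<le> (\<Sum>b\<in>Basis. norm v * (norm (D y b) + 1))"
      proof (rule sum_mono)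
        fix b :: 'b assume b: "b \<in> Basis"
        have "norm (D x b) \<le> norm (D y b) + 1" using r(2)[of x b] x R(2)[OF b] by auto
        then show "norm ((v \<bullet> b) *\<^sub>R D x b) \<le> norm v * (norm (D y b) + 1)"
          using Basis_le_norm[OF b, of v] by (simp add: mult_mono)
      qed
      also have "\<dots> = K * norm v" by (simp add: K_def sum_distrib_left mult.commute)
      finally show "norm (D x v) \<le> K * norm v" .
    qed
  qed (use that in auto)
  then have "K-lipschitz_on (cball y R) g" using K by (auto simp: lipschitz_on_def dist_norm)
  then show ?thesis using that R(1) sub by blast
qed

section \<open>Charts of a closed manifold of positive dimension\<close>

locale smooth_manifold =
  fixes M :: "'a topology" and A :: "('a set \<times> ('a \<Rightarrow> 'b::euclidean_space)) set" and f :: "'a \<Rightarrow> real"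
  assumes man: "closed_manifold DIM('b) M A" and smooth: "smooth_function A f"
begin

lemma Hausdorff_M: "Hausdorff_space M" and compact_M: "compact_space M"
  using man by (auto simp: closed_manifold_def)

lemma chart_exists: "p \<in> topspace M \<Longrightarrow> \<exists>U \<phi>. (U, \<phi>) \<in> A \<and> p \<in> U"
  using man by (auto simp: closed_manifold_def)

context
  fixes U \<phi> \<psi> assumes chart: "(U, \<phi>) \<in> A" and psi: "\<psi> = inv_into U \<phi>"
begin

lemma chart_openin: "openin M U" and chart_open: "open (\<phi> ` U)"
  and chart_homeo: "homeomorphic_map (subtopology M U) (top_of_set (\<phi> ` U)) \<phi>"
  using man chart by (auto simp: closed_manifold_def model_space_def)

lemma chart_subset: "U \<subseteq> topspace M"
  using chart_openin openin_subset by blast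

lemma chart_inj: "inj_on \<phi> U"
  using homeomorphic_imp_injective_map[OF chart_homeo] chart_subset by (simp add: inf.absorb2)

lemma chart_left: "x \<in> U \<Longrightarrow> \<psi> (\<phi> x) = x"
  by (simp add: psi chart_inj)

lemma chart_right: "y \<in> \<phi> ` U \<Longrightarrow> \<phi> (\<psi> y) = y" and chart_in: "y \<in> \<phi> ` U \<Longrightarrow> \<psi> y \<in> U"
  by (simp_all add: psi f_inv_into_f inv_into_into)

lemma chart_continuous: "continuous_map (subtopology M U) euclidean \<phi>"
  using homeomorphic_imp_continuous_map[OF chart_homeo] continuous_map_in_subtopology by blast

lemma chart_inv_continuous: "continuous_map (top_of_set (\<phi> ` U)) M \<psi>"
proof -
  obtain g where g: "homeomorphic_maps (subtopology M U) (top_of_set (\<phi> ` U)) \<phi> g"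
    using chart_homeo homeomorphic_map_maps by blast
  then have c: "continuous_map (top_of_set (\<phi> ` U)) M g"
    unfolding homeomorphic_maps_def continuous_map_in_subtopology by blast
  have "g y = \<psi> y" if "y \<in> \<phi> ` U" for y
  proof -
    obtain x where x: "x \<in> U" "y = \<phi> x" using \<open>y \<in> \<phi> ` U\<close> by blast
    then have "g y = x" using g chart_subset by (auto simp: homeomorphic_maps_def)
    then show ?thesis using x chart_left by simp
  qed
  then show ?thesis by (intro continuous_map_eq[OF c]) auto
qed

lemma chart_open_image:
  assumes "openin M W" "W \<subseteq> U" shows "open (\<phi> ` W)"
proof -
  have "openin (subtopology M U) W" using assms by (auto simp: openin_subtopology)
  then have "openin (top_of_set (\<phi> ` U)) (\<phi> ` W)"
    using homeomorphic_map_openness_eq[OF chart_homeo] by blast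
  then show ?thesis using chart_open openin_open_eq by blast
qed

lemma chart_open_preimage:
  assumes "open B" shows "openin M {x \<in> U. \<phi> x \<in> B}"
proof -
  have "openin (subtopology M U) {x \<in> topspace (subtopology M U). \<phi> x \<in> B}"
    by (rule openin_continuous_map_preimage[OF chart_continuous]) (simp add: assms)
  moreover have "{x \<in> topspace (subtopology M U). \<phi> x \<in> B} = {x \<in> U. \<phi> x \<in> B}"
    using chart_subset by auto
  ultimately show ?thesis using chart_openin openin_trans_full by metis
qed

lemma chart_compact: "compact K \<Longrightarrow> K \<subseteq> \<phi> ` U \<Longrightarrow> compactin M (\<psi> ` K)"
  by (rule image_compactin[OF _ chart_inv_continuous]) (simp add: compactin_subtopology)

lemma chart_closed: "compact K \<Longrightarrow> K \<subseteq> \<phi> ` U \<Longrightarrow> closedin M (\<psi> ` K)"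
  using chart_compact compactin_imp_closedin Hausdorff_M by blast

lemma chart_connected: "connected C \<Longrightarrow> C \<subseteq> \<phi> ` U \<Longrightarrow> connectedin M (\<psi> ` C)"
  by (rule connectedin_continuous_map_image[OF chart_inv_continuous]) (simp add: connectedin_subtopology)

lemma chart_function_derivative:
  obtains g' where "\<And>x. x \<in> \<phi> ` U \<Longrightarrow> ((f \<circ> \<psi>) has_derivative g' x) (at x)"
    "\<And>v. continuous_on (\<phi> ` U) (\<lambda>x. g' x v)"
proof -
  have "Ck_on (Suc 0) (\<phi> ` U) (f \<circ> \<psi>)"
    using smooth chart by (auto simp: smooth_function_def smooth_on_def psi simp del: Ck_on.simps)
  then show ?thesis using that by (auto simp: at_within_open[OF _ chart_open])
qed

lemma chart_function_continuous: "continuous_on (\<phi> ` U) (f \<circ> \<psi>)"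
proof -
  have "Ck_on 0 (\<phi> ` U) (f \<circ> \<psi>)"
    using smooth chart by (auto simp: smooth_function_def smooth_on_def psi simp del: Ck_on.simps)
  then show ?thesis by simp
qed

lemma transition_derivative:
  assumes other: "(V, \<xi>) \<in> A"
  obtains D where "open (\<phi> ` (U \<inter> V))"
    "\<And>x. x \<in> \<phi> ` (U \<inter> V) \<Longrightarrow> ((\<xi> \<circ> \<psi>) has_derivative D x) (at x)"
    "\<And>v. continuous_on (\<phi> ` (U \<inter> V)) (\<lambda>x. D x v)"
proof -
  have "openin M V" using man other by (auto simp: closed_manifold_def)
  then have o: "open (\<phi> ` (U \<inter> V))" by (intro chart_open_image openin_Int chart_openin) auto
  have "\<forall>(U, \<phi>)\<in>A. \<forall>(V, \<psi>)\<in>A. smooth_on (\<psi> ` (U \<inter> V)) (\<phi> \<circ> inv_into V \<psi>)"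
    using man by (simp add: closed_manifold_def)
  then have "smooth_on (\<phi> ` (V \<inter> U)) (\<xi> \<circ> \<psi>)" using chart other psi by fastforce
  then have "Ck_on (Suc 0) (\<phi> ` (U \<inter> V)) (\<xi> \<circ> \<psi>)"
    by (simp add: smooth_on_def Int_commute del: Ck_on.simps)
  then show ?thesis using that o by (auto simp: at_within_open[OF _ o])
qed

end

lemma continuous_map_from_charts:
  fixes h :: "'a \<Rightarrow> real"
  assumes h: "\<And>U \<phi>. (U, \<phi>) \<in> A \<Longrightarrow> continuous_on (\<phi> ` U) (h \<circ> inv_into U \<phi>)"
  shows "continuous_map M euclideanreal h"
  unfolding continuous_map_def
proof (intro conjI allI impI)
  fix C :: "real set" assume "openin euclideanreal C"
  then have C: "open C" by simp
  show "openin M {x \<in> topspace M. h x \<in> C}"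
  proof (subst openin_subopen, intro ballI)
    fix p assume p: "p \<in> {x \<in> topspace M. h x \<in> C}"
    then obtain U \<phi> where ch: "(U, \<phi>) \<in> A" "p \<in> U" using chart_exists by blast
    define \<psi> where "\<psi> = inv_into U \<phi>"
    note c = ch(1) \<psi>_def
    have o: "open (\<phi> ` U \<inter> (h \<circ> \<psi>) -` C)"
      using continuous_open_preimage[OF h[OF ch(1), folded \<psi>_def] chart_open[OF c] C] .
    let ?W = "{x \<in> U. \<phi> x \<in> \<phi> ` U \<inter> (h \<circ> \<psi>) -` C}"
    have "openin M ?W" using chart_open_preimage[OF c o] .
    moreover have "p \<in> ?W" using p ch(2) chart_left[OF c] by auto
    moreover have "?W \<subseteq> {x \<in> topspace M. h x \<in> C}"
    proof
      fix x assume "x \<in> ?W"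
      then have "x \<in> U" "h (\<psi> (\<phi> x)) \<in> C" by auto
      then show "x \<in> {x \<in> topspace M. h x \<in> C}" using chart_left[OF c] chart_subset[OF c] by auto
    qed
    ultimately show "\<exists>T. openin M T \<and> p \<in> T \<and> T \<subseteq> {x \<in> topspace M. h x \<in> C}" by blast
  qed
qed simp

lemma continuous_f: "continuous_map M euclideanreal f"
  using chart_function_continuous[OF _ refl] by (rule continuous_map_from_charts)

sublocale level_space M f
  using compact_M Hausdorff_M continuous_f by unfold_locales

text \<open>\<open>critical_point\<close> speaks of some chart; the chain rule with the transition
  map transfers the vanishing derivative to every chart around \<open>p\<close>.\<close>

lemma critical_in_chart:
  assumes c: "(U, \<phi>) \<in> A" "\<psi> = inv_into U \<phi>" and p: "p \<in> U" "critical_point A f p"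
  shows "((f \<circ> \<psi>) has_derivative (\<lambda>v. 0)) (at (\<phi> p))"
proof -
  obtain V \<xi> where V: "(V, \<xi>) \<in> A" "p \<in> V"
    and d0: "((f \<circ> inv_into V \<xi>) has_derivative (\<lambda>v. 0)) (at (\<xi> p) within \<xi> ` V)"
    using p(2) unfolding critical_point_def by blast
  define \<theta> where "\<theta> = inv_into V \<xi>"
  note c' = V(1) \<theta>_def
  have d1: "((f \<circ> \<theta>) has_derivative (\<lambda>v. 0)) (at (\<xi> p))"
    using d0 at_within_open[OF _ chart_open[OF c'], of "\<xi> p"] V(2) by (simp add: \<theta>_def)
  obtain D where o: "open (\<phi> ` (U \<inter> V))"
    and D: "\<And>x. x \<in> \<phi> ` (U \<inter> V) \<Longrightarrow> ((\<xi> \<circ> \<psi>) has_derivative D x) (at x)"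
    using transition_derivative[OF c V(1)] by metis
  have pin: "\<phi> p \<in> \<phi> ` (U \<inter> V)" using p V by blast
  have "((\<lambda>x. (f \<circ> \<theta>) ((\<xi> \<circ> \<psi>) x)) has_derivative (\<lambda>v. 0)) (at (\<phi> p))"
    using has_derivative_compose[OF D[OF pin], of "f \<circ> \<theta>" "\<lambda>v. 0"] d1 chart_left[OF c p(1)] by simp
  then show ?thesis
  proof (rule has_derivative_transform_within_open[OF _ o pin])
    fix x assume "x \<in> \<phi> ` (U \<inter> V)"
    then obtain q where "q \<in> U" "q \<in> V" "x = \<phi> q" by blast
    then show "(f \<circ> \<theta>) ((\<xi> \<circ> \<psi>) x) = (f \<circ> \<psi>) x"
      using chart_left[OF c] chart_left[OF c'] by simp
  qed
qed

text \<open>The lines parallel to \<open>v\<close> in a chart ball stand in for the flow lines of a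
  gradient field. Growth at rate \<open>m\<close> is stated for pairs of points rather than for
  derivatives, so that it survives the subtraction of a function with a small Lipschitz
  constant.\<close>

definition flow_box ::
    "'a set \<Rightarrow> 'a set \<Rightarrow> ('a \<Rightarrow> 'b) \<Rightarrow> 'b \<Rightarrow> 'b \<Rightarrow> real \<Rightarrow> real \<Rightarrow> bool" where
  "flow_box W U \<phi> z v R m \<longleftrightarrow> (U, \<phi>) \<in> A \<and> norm v = 1 \<and> R > 0 \<and> m > 0 \<and> cball z R \<subseteq> \<phi> ` U \<and>
     inv_into U \<phi> ` cball z R \<subseteq> W \<and> (\<forall>x\<in>cball z R. \<not> critical_point A f (inv_into U \<phi> x)) \<and>
     (\<forall>x s. 0 \<le> s \<longrightarrow> x \<in> cball z R \<longrightarrow> x + s *\<^sub>R v \<in> cball z R \<longrightarrow>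
        m * s \<le> f (inv_into U \<phi> (x + s *\<^sub>R v)) - f (inv_into U \<phi> x))"

text \<open>At a regular point some direction has a positive derivative. By continuity half of it
  persists on a small ball, and the mean value theorem integrates this bound along segments.\<close>

lemma flow_box_exists:
  assumes p: "p \<in> topspace M" "\<not> critical_point A f p" and W: "openin M W" "p \<in> W"
  obtains U \<phi> v R m where "flow_box W U \<phi> (\<phi> p) v R m" "p \<in> U"
proof -
  obtain U \<phi> where ch: "(U, \<phi>) \<in> A" "p \<in> U" using chart_exists p by blast
  define \<psi> where "\<psi> = inv_into U \<phi>"
  note c = ch(1) \<psi>_def
  obtain g' where g': "\<And>x. x \<in> \<phi> ` U \<Longrightarrow> ((f \<circ> \<psi>) has_derivative g' x) (at x)"
    "\<And>v. continuous_on (\<phi> ` U) (\<lambda>x. g' x v)" using chart_function_derivative[OF c] by blast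
  have pin: "\<phi> p \<in> \<phi> ` U" using ch by blast
  have lin: "linear (g' x)" if "x \<in> \<phi> ` U" for x using g'(1)[OF that] has_derivative_linear by blast
  have "g' (\<phi> p) \<noteq> (\<lambda>v. 0)"
  proof
    assume "g' (\<phi> p) = (\<lambda>v. 0)"
    then have "((f \<circ> inv_into U \<phi>) has_derivative (\<lambda>v. 0)) (at (\<phi> p) within \<phi> ` U)"
      using g'(1)[OF pin] has_derivative_at_withinI unfolding \<psi>_def by metis
    then show False using p(2) ch unfolding critical_point_def by blast
  qed
  then obtain w where w: "g' (\<phi> p) w \<noteq> 0" by auto
  \<comment> \<open>Normalised, with the sign that makes \<open>f\<close> increase.\<close>
  define v where "v = (sgn (g' (\<phi> p) w) / norm w) *\<^sub>R w"
  have w0: "w \<noteq> 0" using w linear_0[OF lin[OF pin]] by auto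
  have v: "norm v = 1" using w w0 by (simp add: v_def abs_sgn_eq)
  have "g' (\<phi> p) v = \<bar>g' (\<phi> p) w\<bar> / norm w"
    by (simp add: v_def linear_cmul[OF lin[OF pin]] sgn_if)
  then have gv: "g' (\<phi> p) v > 0" using w w0 by simp
  define m where "m = g' (\<phi> p) v / 2"
  have m: "m > 0" "m < g' (\<phi> p) v" using gv by (auto simp: m_def)
  have "open (\<phi> ` (U \<inter> W))" by (intro chart_open_image[OF c] openin_Int W chart_openin[OF c]) auto
  moreover have "open (\<phi> ` U \<inter> (\<lambda>x. g' x v) -` {m<..})"
    by (rule continuous_open_preimage[OF g'(2) chart_open[OF c]]) simp
  ultimately have "open (\<phi> ` (U \<inter> W) \<inter> (\<phi> ` U \<inter> (\<lambda>x. g' x v) -` {m<..}))" by (rule open_Int)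
  moreover have "\<phi> p \<in> \<phi> ` (U \<inter> W) \<inter> (\<phi> ` U \<inter> (\<lambda>x. g' x v) -` {m<..})" using ch W m by auto
  ultimately obtain R where R: "R > 0" "cball (\<phi> p) R \<subseteq> \<phi> ` (U \<inter> W) \<inter> (\<phi> ` U \<inter> (\<lambda>x. g' x v) -` {m<..})"
    unfolding open_contains_cball by blast
  have B: "cball (\<phi> p) R \<subseteq> \<phi> ` U" "\<And>x. x \<in> cball (\<phi> p) R \<Longrightarrow> m < g' x v" using R(2) by auto
  have "flow_box W U \<phi> (\<phi> p) v R m"
    unfolding flow_box_def \<psi>_def[symmetric]
  proof (intro conjI ballI allI impI)
    show "\<psi> ` cball (\<phi> p) R \<subseteq> W"
    proof
      fix x assume "x \<in> \<psi> ` cball (\<phi> p) R"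
      then obtain q where "q \<in> U \<inter> W" "x = \<psi> (\<phi> q)" using R(2) by blast
      then show "x \<in> W" using chart_left[OF c] by simp
    qed
    fix x assume x: "x \<in> cball (\<phi> p) R"
    then have xU: "x \<in> \<phi> ` U" using B by blast
    show "\<not> critical_point A f (\<psi> x)"
    proof
      assume "critical_point A f (\<psi> x)"
      then have "((f \<circ> \<psi>) has_derivative (\<lambda>v. 0)) (at x)"
        using critical_in_chart[OF c chart_in[OF c xU]] chart_right[OF c xU] by simp
      then have "g' x = (\<lambda>v. 0)" using has_derivative_unique g'(1)[OF xU] by blast
      then show False using B(2)[OF x] m by simp
    qed
    fix s :: real assume s: "0 \<le> s" and y: "x + s *\<^sub>R v \<in> cball (\<phi> p) R"
    show "m * s \<le> f (\<psi> (x + s *\<^sub>R v)) - f (\<psi> x)"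
    proof (cases "s = 0")
      case True then show ?thesis by simp
    next
      case False
      then have s0: "0 < s" using s by simp
      have seg: "x + t *\<^sub>R v \<in> cball (\<phi> p) R" if "0 \<le> t" "t \<le> s" for t
      proof -
        have "x + t *\<^sub>R v = (1 - t / s) *\<^sub>R x + (t / s) *\<^sub>R (x + s *\<^sub>R v)"
          using s0 by (simp add: algebra_simps)
        moreover have "0 \<le> t / s" "0 \<le> 1 - t / s" using that s0 by (auto simp: field_simps)
        ultimately show ?thesis
          using convexD[OF convex_cball x y, of "1 - t / s" "t / s"] by simp
      qed
      have der: "((\<lambda>t. (f \<circ> \<psi>) (x + t *\<^sub>R v)) has_real_derivative g' (x + t *\<^sub>R v) v) (at t)"
        if "0 \<le> t" "t \<le> s" for t
      proof -
        have tU: "x + t *\<^sub>R v \<in> \<phi> ` U" using seg[OF that] B by blast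
        show ?thesis by (rule has_derivative_along_line[OF g'(1)[OF tU]])
      qed
      obtain t where t: "0 < t" "t < s"
        "(f \<circ> \<psi>) (x + s *\<^sub>R v) - (f \<circ> \<psi>) (x + 0 *\<^sub>R v) = (s - 0) * g' (x + t *\<^sub>R v) v"
        using MVT2[OF s0, of "\<lambda>t. (f \<circ> \<psi>) (x + t *\<^sub>R v)" "\<lambda>t. g' (x + t *\<^sub>R v) v"] der by blast
      have "s * m \<le> s * g' (x + t *\<^sub>R v) v"
        using B(2)[OF seg[of t]] t s0 by (intro mult_left_mono) auto
      then show ?thesis using t(3) by (simp add: mult.commute)
    qed
  qed (use ch v R m B in auto)
  then show ?thesis using that ch(2) by blast
qed

lemma flow_boxD:
  assumes "flow_box W U \<phi> z v R m" "\<psi> = inv_into U \<phi>"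
  shows "(U, \<phi>) \<in> A" "norm v = 1" "R > 0" "m > 0" "cball z R \<subseteq> \<phi> ` U" "\<psi> ` cball z R \<subseteq> W"
    "\<And>x. x \<in> cball z R \<Longrightarrow> \<not> critical_point A f (\<psi> x)"
    "\<And>x s. 0 \<le> s \<Longrightarrow> x \<in> cball z R \<Longrightarrow> x + s *\<^sub>R v \<in> cball z R \<Longrightarrow> m * s \<le> f (\<psi> (x + s *\<^sub>R v)) - f (\<psi> x)"
  using assms by (simp_all add: flow_box_def)

text \<open>On the segment of length \<open>2 * R\<close> through \<open>p\<close> in direction
  \<open>v\<close>, the values of \<open>f\<close> cover the interval of radius \<open>m * R\<close>
  about \<open>f p\<close>.\<close>

lemma open_map_regular:
  assumes W: "openin M W" and reg: "\<And>p. p \<in> W \<Longrightarrow> \<not> critical_point A f p"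
  shows "open (f ` W)"
  unfolding open_contains_ball
proof (intro ballI)
  fix t assume "t \<in> f ` W"
  then obtain p where p: "p \<in> W" "f p = t" by blast
  then have "p \<in> topspace M" using W openin_subset by blast
  then obtain U \<phi> v R m where fb: "flow_box W U \<phi> (\<phi> p) v R m" "p \<in> U"
    using flow_box_exists[OF _ reg W] p by metis
  define \<psi> where "\<psi> = inv_into U \<phi>"
  note F = flow_boxD[OF fb(1) \<psi>_def]
  note c = F(1) \<psi>_def
  have \<psi>p: "\<psi> (\<phi> p) = p" using chart_left[OF c fb(2)] .
  have seg: "\<phi> p + s *\<^sub>R v \<in> cball (\<phi> p) R" if "\<bar>s\<bar> \<le> R" for s using that F(2) by (simp add: dist_norm)
  define h where "h s = (f \<circ> \<psi>) (\<phi> p + s *\<^sub>R v)" for s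
  have cont: "continuous_on {-R..R} h"
    unfolding h_def
    by (rule continuous_on_compose2[OF continuous_on_subset[OF chart_function_continuous[OF c] F(5)]])
      (auto intro!: continuous_intros seg)
  have up: "t + m * R \<le> h R" using F(8)[of R "\<phi> p"] F(3) seg[of R] seg[of 0] \<psi>p p(2) by (simp add: h_def)
  have down: "h (- R) \<le> t - m * R"
    using F(8)[of R "\<phi> p + (- R) *\<^sub>R v"] F(3) seg[of "- R"] seg[of 0] \<psi>p p(2) by (simp add: h_def)
  have "ball t (m * R) \<subseteq> f ` W"
  proof
    fix u assume "u \<in> ball t (m * R)"
    then have "h (- R) \<le> u" "u \<le> h R" using up down by (auto simp: dist_real_def)
    then obtain s where s: "- R \<le> s" "s \<le> R" "h s = u" using IVT'[of h "- R" u R] cont F(3) by auto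
    then have "\<psi> (\<phi> p + s *\<^sub>R v) \<in> W" using F(6) seg[of s] by (auto simp: abs_le_iff)
    then show "u \<in> f ` W" using s(3) by (auto simp: h_def)
  qed
  then show "\<exists>e>0. ball t e \<subseteq> f ` W" using F(3,4) by (metis mult_pos_pos)
qed

end

section \<open>Level components near regular and critical points\<close>

context smooth_manifold
begin

text \<open>An implicit function argument in a flow box: over each small vector \<open>t\<close>
  orthogonal to \<open>v\<close> there is exactly one height \<open>s t\<close> at which
  \<open>f\<close> takes the value \<open>f p\<close>. The graph is connected and contains
  \<open>p\<close>, so it lies in the level component, which is therefore open in its level near
  \<open>p\<close>.\<close>

lemma regular_level_flat:
  assumes p: "p \<in> topspace M" "\<not> critical_point A f p"
  obtains N and T :: "'b set" where "openin M N" "p \<in> N" "{x \<in> N. f x = f p} \<subseteq> level_component M f p"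
    "flat_at (subtopology M (level_component M f p)) p T" "subspace T" "dim T = DIM('b) - 1"
proof -
  obtain U \<phi> v R m where fb: "flow_box (topspace M) U \<phi> (\<phi> p) v R m" "p \<in> U"
    using flow_box_exists[OF p openin_topspace p(1)] by blast
  define \<psi> where "\<psi> = inv_into U \<phi>"
  note F = flow_boxD[OF fb(1) \<psi>_def]
  note c = F(1) \<psi>_def
  define z where "z = \<phi> p"
  note F' = F[folded z_def]
  have \<psi>z: "\<psi> z = p" unfolding z_def using chart_left[OF c fb(2)] .
  define T where "T = {t. v \<bullet> t = 0}"
  have v0: "v \<noteq> 0" "v \<bullet> v = 1" using F(2) by (auto simp: norm_eq_1)
  have T: "subspace T" "dim T = DIM('b) - 1"
    unfolding T_def using v0 by (simp_all add: subspace_hyperplane dim_hyperplane)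
  \<comment> \<open>Half of the radius for the base and half for the height keep
    \<open>z + t + s *\<^sub>R v\<close> in the ball.\<close>
  define \<sigma> where "\<sigma> = R / 2"
  have \<sigma>: "\<sigma> > 0" using F(3) by (simp add: \<sigma>_def)
  have inB: "z + t + s *\<^sub>R v \<in> cball z R" if "norm t \<le> \<sigma>" "\<bar>s\<bar> \<le> \<sigma>" for t s
  proof -
    have "z - (z + t + s *\<^sub>R v) = - (t + s *\<^sub>R v)" by simp
    then have "dist z (z + t + s *\<^sub>R v) = norm (t + s *\<^sub>R v)"
      unfolding dist_norm by (metis norm_minus_cancel)
    also have "\<dots> \<le> norm t + \<bar>s\<bar>" using norm_triangle_ineq[of t "s *\<^sub>R v"] F(2) by simp
    finally show ?thesis using that by (simp add: \<sigma>_def)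
  qed
  define G where "G t s = f (\<psi> (z + t + s *\<^sub>R v)) - f p" for t s
  have cfB: "continuous_on (cball z R) (f \<circ> \<psi>)"
    using chart_function_continuous[OF c] F'(5) by (rule continuous_on_subset)
  have contG: "continuous_on (cball 0 \<sigma> \<times> {-\<sigma>..\<sigma>}) (\<lambda>q. G (fst q) (snd q))"
  proof -
    have "continuous_on (cball 0 \<sigma> \<times> {-\<sigma>..\<sigma>}) (\<lambda>q. (f \<circ> \<psi>) (z + fst q + snd q *\<^sub>R v))"
      by (rule continuous_on_compose2[OF cfB]) (auto intro!: continuous_intros inB)
    then show ?thesis unfolding G_def o_def by (intro continuous_intros)
  qed
  have incG: "G t s < G t s'" if "norm t \<le> \<sigma>" "- \<sigma> \<le> s" "s < s'" "s' \<le> \<sigma>" for t s s'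
  proof -
    have e: "z + t + s *\<^sub>R v + (s' - s) *\<^sub>R v = z + t + s' *\<^sub>R v" by (simp add: algebra_simps)
    have "z + t + s *\<^sub>R v \<in> cball z R" "z + t + s' *\<^sub>R v \<in> cball z R"
      using that by (auto intro!: inB simp del: mem_cball)
    then have "m * (s' - s) \<le> G t s' - G t s"
      using F'(8)[of "s' - s" "z + t + s *\<^sub>R v", unfolded e] that unfolding G_def by linarith
    moreover have "m * (s' - s) > 0" using F(4) that by simp
    ultimately show ?thesis by simp
  qed
  have G0: "G 0 0 = 0" by (simp add: G_def \<psi>z)
  have ctop: "continuous_on (cball 0 \<sigma>) (\<lambda>t. G t s)" if "\<bar>s\<bar> \<le> \<sigma>" for s
    by (rule continuous_on_compose2[OF contG, of "cball 0 \<sigma>" "\<lambda>t. (t, s)", simplified])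
      (use that in \<open>auto intro!: continuous_intros\<close>)
  have "open (ball 0 \<sigma> \<inter> (\<lambda>t. G t \<sigma>) -` {0<..})" "open (ball 0 \<sigma> \<inter> (\<lambda>t. G t (- \<sigma>)) -` {..<0})"
    using \<sigma> by (auto intro!: continuous_open_preimage continuous_on_subset[OF ctop])
  then have "open ((ball 0 \<sigma> \<inter> (\<lambda>t. G t \<sigma>) -` {0<..}) \<inter> (ball 0 \<sigma> \<inter> (\<lambda>t. G t (- \<sigma>)) -` {..<0}))"
    by (rule open_Int)
  moreover have "0 \<in> (ball 0 \<sigma> \<inter> (\<lambda>t. G t \<sigma>) -` {0<..}) \<inter> (ball 0 \<sigma> \<inter> (\<lambda>t. G t (- \<sigma>)) -` {..<0})"
    using incG[of 0 0 \<sigma>] incG[of 0 "- \<sigma>" 0] G0 \<sigma> by simp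
  ultimately obtain \<delta> where \<delta>: "\<delta> > 0"
    "cball 0 \<delta> \<subseteq> (ball 0 \<sigma> \<inter> (\<lambda>t. G t \<sigma>) -` {0<..}) \<inter> (ball 0 \<sigma> \<inter> (\<lambda>t. G t (- \<sigma>)) -` {..<0})"
    unfolding open_contains_cball by blast
  have d: "norm t \<le> \<sigma>" "G t \<sigma> > 0" "G t (- \<sigma>) < 0" if "norm t \<le> \<delta>" for t
  proof -
    have "t \<in> cball 0 \<delta>" using that by simp
    then have "t \<in> (ball 0 \<sigma> \<inter> (\<lambda>t. G t \<sigma>) -` {0<..}) \<inter> (ball 0 \<sigma> \<inter> (\<lambda>t. G t (- \<sigma>)) -` {..<0})"
      using \<delta>(2) by blast
    then show "norm t \<le> \<sigma>" "G t \<sigma> > 0" "G t (- \<sigma>) < 0" by auto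
  qed
  define D where "D = T \<inter> ball 0 \<delta>"
  have D: "norm t \<le> \<delta>" "v \<bullet> t = 0" if "t \<in> D" for t using that by (auto simp: D_def T_def)
  have contGD: "continuous_on (D \<times> {-\<sigma>..\<sigma>}) (\<lambda>q. G (fst q) (snd q))"
    by (rule continuous_on_subset[OF contG]) (use D(1) d(1) in auto)
  have uniq: "\<exists>!s. s \<in> {-\<sigma>..\<sigma>} \<and> G t s = 0" if "t \<in> D" for t
  proof -
    have t: "norm t \<le> \<sigma>" "G t \<sigma> > 0" "G t (- \<sigma>) < 0" using d D(1)[OF \<open>t \<in> D\<close>] by auto
    have "continuous_on {-\<sigma>..\<sigma>} (G t)"
      by (rule continuous_on_compose2[OF contG, of "{-\<sigma>..\<sigma>}" "\<lambda>s. (t, s)", simplified])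
        (use t in \<open>auto intro!: continuous_intros\<close>)
    then obtain s where s: "-\<sigma> \<le> s" "s \<le> \<sigma>" "G t s = 0"
      using IVT'[of "G t" "-\<sigma>" 0 \<sigma>] t \<sigma> by auto
    show ?thesis
    proof (rule ex1I[of _ s])
      show "s \<in> {-\<sigma>..\<sigma>} \<and> G t s = 0" using s by simp
      show "r = s" if "r \<in> {-\<sigma>..\<sigma>} \<and> G t r = 0" for r
        using incG[OF t(1), of r s] incG[OF t(1), of s r] s that by force
    qed
  qed
  obtain s where s: "continuous_on D s" "\<And>t. t \<in> D \<Longrightarrow> s t \<in> {-\<sigma>..\<sigma>}" "\<And>t. t \<in> D \<Longrightarrow> G t (s t) = 0"
     "\<And>t r. t \<in> D \<Longrightarrow> r \<in> {-\<sigma>..\<sigma>} \<Longrightarrow> G t r = 0 \<Longrightarrow> r = s t"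
    by (rule unique_zero_continuous[OF contGD uniq], assumption) (rule that)
  have D0: "0 \<in> D" using \<delta> T by (simp add: D_def subspace_0)
  have s0: "s 0 = 0" using s(4)[OF D0, of 0] G0 \<sigma> by simp
  \<comment> \<open>The strict bound puts the graph inside the open cylinder \<open>B\<close>
    below.\<close>
  have slt: "\<bar>s t\<bar> < \<sigma>" if "t \<in> D" for t
  proof -
    have "s t \<noteq> \<sigma>" "s t \<noteq> - \<sigma>" using s(3)[OF that] d(2,3)[OF D(1)[OF that]] by auto
    then show ?thesis using s(2)[OF that] by auto
  qed
  define \<gamma> where "\<gamma> t = z + t + s t *\<^sub>R v" for t
  define k where "k t = \<psi> (\<gamma> t)" for t
  define h where "h x = (\<phi> x - z) - ((\<phi> x - z) \<bullet> v) *\<^sub>R v" for x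
  have \<gamma>B: "\<gamma> t \<in> cball z R" if "t \<in> D" for t
    unfolding \<gamma>_def using slt[OF that] d(1)[OF D(1)[OF that]] by (intro inB) auto
  have \<gamma>U: "\<gamma> t \<in> \<phi> ` U" if "t \<in> D" for t using \<gamma>B[OF that] F'(5) by blast
  have fk: "f (k t) = f p" if "t \<in> D" for t using s(3)[OF that] by (simp add: G_def k_def \<gamma>_def)
  have \<phi>k: "\<phi> (k t) = \<gamma> t" if "t \<in> D" for t unfolding k_def using chart_right[OF c \<gamma>U[OF that]] .
  have kU: "k t \<in> U" if "t \<in> D" for t unfolding k_def using chart_in[OF c \<gamma>U[OF that]] .
  have hk: "h (k t) = t" and kv: "(\<phi> (k t) - z) \<bullet> v = s t" if "t \<in> D" for t
  proof -
    have "(\<phi> (k t) - z) \<bullet> v = (t + s t *\<^sub>R v) \<bullet> v" by (simp add: \<phi>k[OF that] \<gamma>_def)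
    also have "\<dots> = s t" by (simp only: inner_add_left inner_scaleR_left inner_commute[of t v] D(2)[OF that] v0 mult_1_right add_0)
    finally show kv: "(\<phi> (k t) - z) \<bullet> v = s t" .
    show "h (k t) = t" unfolding h_def kv by (simp add: \<phi>k[OF that] \<gamma>_def)
  qed
  have k0: "k 0 = p" using s0 by (simp add: k_def \<gamma>_def \<psi>z)
  \<comment> \<open>An open cylinder about \<open>z\<close> with axis \<open>v\<close>; in the
    chart, the level of \<open>p\<close> meets it exactly in the graph.\<close>
  define B where "B = {y. norm ((y - z) - ((y - z) \<bullet> v) *\<^sub>R v) < \<delta> \<and> \<bar>(y - z) \<bullet> v\<bar> < \<sigma>}"
  have "open B" unfolding B_def by (intro open_Collect_conj open_Collect_less continuous_intros)
  define N where "N = {x \<in> U. \<phi> x \<in> B}"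
  have N: "openin M N" unfolding N_def using chart_open_preimage[OF c \<open>open B\<close>] .
  have pN: "p \<in> N" using fb(2) \<delta>(1) \<sigma> by (simp add: N_def B_def z_def)
  have c\<gamma>: "continuous_on D \<gamma>" unfolding \<gamma>_def using s(1) by (intro continuous_intros)
  have "convex D" unfolding D_def using T by (simp add: subspace_imp_convex convex_Int)
  then have "connected (\<gamma> ` D)" using c\<gamma> convex_connected connected_continuous_image by blast
  then have "connectedin M (\<psi> ` \<gamma> ` D)" using \<gamma>U by (intro chart_connected[OF c]) auto
  moreover have "p \<in> \<psi> ` \<gamma> ` D" using k0 D0 unfolding k_def by force
  moreover have "f y = f p" if "y \<in> \<psi> ` \<gamma> ` D" for y using that fk by (auto simp: k_def)
  ultimately have \<Gamma>: "\<psi> ` \<gamma> ` D \<subseteq> level_component M f p" by (rule level_component_maximal)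
  have kL: "k t \<in> level_component M f p" if "t \<in> D" for t using \<Gamma> that unfolding k_def by blast
  have kN: "k t \<in> N" if "t \<in> D" for t
  proof -
    have "norm t < \<delta>" using that by (simp add: D_def)
    then show ?thesis unfolding N_def B_def
      using kU[OF that] hk[OF that] kv[OF that] slt[OF that] unfolding h_def by simp
  qed
  have Nk: "h x \<in> D \<and> x = k (h x)" if x: "x \<in> N" "f x = f p" for x
  proof -
    have xU: "x \<in> U" "\<phi> x \<in> B" using x by (auto simp: N_def)
    have hD: "h x \<in> D" using xU v0 by (simp add: D_def T_def h_def B_def inner_diff_right inner_commute)
    define r where "r = (\<phi> x - z) \<bullet> v"
    have xe: "\<phi> x = z + h x + r *\<^sub>R v" by (simp add: h_def r_def)
    have "G (h x) r = 0" unfolding G_def xe[symmetric] using chart_left[OF c xU(1)] x by simp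
    moreover have "r \<in> {-\<sigma>..\<sigma>}" using xU(2) by (auto simp: B_def r_def)
    ultimately have "r = s (h x)" using s(4)[OF hD] by blast
    then have "k (h x) = \<psi> (\<phi> x)" unfolding k_def \<gamma>_def xe by simp
    then show ?thesis using hD chart_left[OF c xU(1)] by simp
  qed
  have sub: "{x \<in> N. f x = f p} \<subseteq> level_component M f p"
  proof
    fix x assume "x \<in> {x \<in> N. f x = f p}"
    then show "x \<in> level_component M f p" using Nk[of x] kL[of "h x"] by auto
  qed
  let ?X = "subtopology M (level_component M f p)"
  define Q where "Q = N \<inter> level_component M f p"
  have QM: "Q \<subseteq> topspace M" using openin_subset[OF N] by (auto simp: Q_def)
  have QU: "Q \<subseteq> U" by (auto simp: Q_def N_def)
  have Qf: "f x = f p" if "x \<in> Q" for x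
    using that level_component_subset[of M f p] by (auto simp: Q_def)
  have "openin ?X Q" unfolding Q_def using N by (auto simp: openin_subtopology)
  moreover have "p \<in> Q" unfolding Q_def using pN level_component_refl[OF p(1)] by blast
  moreover have "homeomorphic_maps (subtopology ?X Q) (top_of_set (T \<inter> ball 0 \<delta>)) h k"
    unfolding D_def[symmetric] homeomorphic_maps_def
  proof (intro conjI ballI)
    have e: "subtopology ?X Q = subtopology M Q"
      unfolding subtopology_subtopology by (simp add: Q_def Int_commute inf.absorb2)
    have "continuous_map (subtopology M Q) euclidean \<phi>"
      using continuous_map_from_subtopology_mono[OF chart_continuous[OF c] QU] .
    moreover have "continuous_map euclidean euclidean (\<lambda>y. (y - z) - ((y - z) \<bullet> v) *\<^sub>R v)"
      unfolding continuous_map_iff_continuous2 by (intro continuous_intros)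
    ultimately have "continuous_map (subtopology M Q) euclidean ((\<lambda>y. (y - z) - ((y - z) \<bullet> v) *\<^sub>R v) \<circ> \<phi>)"
      by (rule continuous_map_compose)
    then have ch: "continuous_map (subtopology M Q) euclidean h" by (simp add: h_def[abs_def] o_def)
    then show "continuous_map (subtopology ?X Q) (top_of_set D) h"
      unfolding e continuous_map_in_subtopology using Nk Qf QM by (auto simp: Q_def)
    have "continuous_map (top_of_set D) (top_of_set (\<phi> ` U)) \<gamma>"
      using c\<gamma> \<gamma>U by (auto simp: continuous_map_in_subtopology)
    from continuous_map_compose[OF this chart_inv_continuous[OF c]]
    have "continuous_map (top_of_set D) M k" by (simp add: k_def[abs_def] o_def)
    then show "continuous_map (top_of_set D) (subtopology ?X Q) k"
      unfolding e continuous_map_in_subtopology using kN kL by (auto simp: Q_def)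
    show "k (h x) = x" if "x \<in> topspace (subtopology ?X Q)" for x
      using that Nk[of x] Qf[of x] by (auto simp: Q_def)
    show "h (k t) = t" if "t \<in> topspace (top_of_set D)" for t using that hk by simp
  qed
  moreover have "h p = 0" by (simp add: h_def z_def)
  ultimately have "flat_at ?X p T" unfolding flat_at_def using \<delta>(1) by blast
  then show ?thesis using that[OF N pN sub _ T] by blast
qed

text \<open>Moved to 0 and reduced by its critical value, \<open>f\<close> in the chart is a
  \<open>quadratic_saddle\<close>. Its gradient has no other zero nearby, which isolates the
  critical point, and \<open>not_locally_flat\<close> excludes flat neighbourhoods in the
  component.\<close>

lemma nondegenerate_critical_local:
  assumes p: "p \<in> topspace M" "critical_point A f p" and nd: "nondegenerate_at DIM('b) A f p"
  obtains N where "openin M N" "p \<in> N" "\<And>q. q \<in> N \<Longrightarrow> critical_point A f q \<Longrightarrow> q = p"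
    "\<And>T::'b set. DIM('b) \<ge> 2 \<Longrightarrow> subspace T \<Longrightarrow> dim T = DIM('b) - 1 \<Longrightarrow>
       \<not> flat_at (subtopology M (level_component M f p)) p T"
proof -
  obtain U \<phi> f' H where U: "(U, \<phi>) \<in> A" "p \<in> U"
    and f'0: "\<And>x. x \<in> \<phi> ` U \<Longrightarrow> ((f \<circ> inv_into U \<phi>) has_derivative f' x) (at x within \<phi> ` U)"
    and H0: "\<And>v. ((\<lambda>x. f' x v) has_derivative H v) (at (\<phi> p) within \<phi> ` U)"
    and nondeg: "\<And>v. v \<noteq> 0 \<Longrightarrow> \<exists>w. H v w \<noteq> 0"
  proof -
    from nd obtain U \<phi> f' H where h: "(U, \<phi>) \<in> A" "p \<in> U"
      "\<forall>x\<in>\<phi> ` U. ((f \<circ> inv_into U \<phi>) has_derivative f' x) (at x within \<phi> ` U)"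
      "\<forall>v. ((\<lambda>x. f' x v) has_derivative H v) (at (\<phi> p) within \<phi> ` U)"
      "\<forall>v\<in>model_space DIM('b). v \<noteq> 0 \<longrightarrow> (\<exists>w\<in>model_space DIM('b). H v w \<noteq> 0)"
      unfolding nondegenerate_at_def by blast
    show ?thesis
    proof (rule that[OF h(1,2)])
      show "((f \<circ> inv_into U \<phi>) has_derivative f' x) (at x within \<phi> ` U)" if "x \<in> \<phi> ` U" for x
        using h(3) that by (rule bspec)
      show "((\<lambda>x. f' x v) has_derivative H v) (at (\<phi> p) within \<phi> ` U)" for v
        using h(4) by (rule spec)
      show "\<exists>w. H v w \<noteq> 0" if "v \<noteq> 0" for v
        using h(5) that by (auto simp: model_space_def)
    qed
  qed
  define \<psi> where "\<psi> = inv_into U \<phi>"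
  note c = U(1) \<psi>_def
  define z0 where "z0 = \<phi> p"
  have z0U: "z0 \<in> \<phi> ` U" using U by (auto simp: z0_def)
  have f': "((f \<circ> \<psi>) has_derivative f' x) (at x)" if "x \<in> \<phi> ` U" for x
    using f'0[OF that] by (simp add: \<psi>_def at_within_open[OF that chart_open[OF c]])
  have H: "((\<lambda>x. f' x v) has_derivative H v) (at z0)" for v
    using H0[of v] by (simp add: z0_def[symmetric] at_within_open[OF z0U chart_open[OF c]])
  have \<psi>z: "\<psi> z0 = p" unfolding z0_def using chart_left[OF c U(2)] .
  have "f' z0 = (\<lambda>v. 0)"
    using has_derivative_unique[OF f'[OF z0U]] critical_in_chart[OF c U(2) p(2)] unfolding z0_def by blast
  then have f'z0: "f' z0 v = 0" for v by simp
  note hess = chart_open[OF c] z0U f' H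
  have bil: "bilinear H" by (rule bilinear_hessian[OF hess])
  have sym: "H u v = H v u" for u v by (rule hessian_symmetric[OF hess])
  obtain N P m where NP: "subspace N" "subspace P" "N \<inter> P = {0}"
    "\<And>z. \<exists>x\<in>N. \<exists>y\<in>P. z = x + y" "\<And>x y. x \<in> N \<Longrightarrow> y \<in> P \<Longrightarrow> H x y = 0"
    "m > 0" "\<And>x. x \<in> N \<Longrightarrow> H x x \<le> - m * (norm x)\<^sup>2"
    "\<And>y. y \<in> P \<Longrightarrow> H y y \<ge> m * (norm y)\<^sup>2"
    by (rule nondegenerate_form_splitting[OF bil sym nondeg], assumption) (rule that)
  define g where "g z = f (\<psi> (z0 + z)) - f p" for z
  define g' where "g' z = f' (z0 + z)" for z
  have der: "(g has_derivative g' z) (at z)" if "z0 + z \<in> \<phi> ` U" for z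
  proof -
    have "((\<lambda>z. z0 + z) has_derivative (\<lambda>z. z)) (at z)" by (auto intro!: derivative_eq_intros)
    from has_derivative_compose[OF this f'[OF that]]
    have "((\<lambda>z. f (\<psi> (z0 + z))) has_derivative g' z) (at z)" by (simp add: g'_def)
    from has_derivative_diff[OF this has_derivative_const[of "f p"]] show ?thesis by (simp add: g_def[abs_def])
  qed
  interpret Q: quadratic_saddle g g' H N P m
  proof
    fix \<epsilon> :: real assume e: "\<epsilon> > 0"
    obtain r where r: "r > 0" "\<And>z. norm z < r \<Longrightarrow> z0 + z \<in> \<phi> ` U"
      "\<And>z v. norm z < r \<Longrightarrow> \<bar>f' (z0 + z) v - H v z\<bar> \<le> \<epsilon> * norm z * norm v"
      "\<And>z. norm z < r \<Longrightarrow> \<bar>(f \<circ> \<psi>) (z0 + z) - (f \<circ> \<psi>) z0 - H z z / 2\<bar> \<le> \<epsilon> * (norm z)\<^sup>2"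
      by (rule quadratic_approx[OF hess f'z0 e], assumption) (rule that)
    show "\<exists>r>0. \<forall>z. norm z < r \<longrightarrow> (g has_derivative g' z) (at z) \<and>
      (\<forall>v. \<bar>g' z v - H v z\<bar> \<le> \<epsilon> * norm z * norm v) \<and> \<bar>g z - H z z / 2\<bar> \<le> \<epsilon> * (norm z)\<^sup>2"
    proof (intro exI[of _ r] conjI allI impI)
      fix z :: 'b assume z: "norm z < r"
      show "(g has_derivative g' z) (at z)" by (rule der[OF r(2)[OF z]])
      show "\<bar>g' z v - H v z\<bar> \<le> \<epsilon> * norm z * norm v" for v
        unfolding g'_def by (rule r(3)[OF z])
      show "\<bar>g z - H z z / 2\<bar> \<le> \<epsilon> * (norm z)\<^sup>2"
        using r(4)[OF z] by (simp add: g_def \<psi>z)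
    qed (rule r(1))
  next
    show "H y x = 0" if "x \<in> N" "y \<in> P" for x y using NP(5)[OF that] sym by simp
  qed (fact bil NP)+
  obtain r1 where r1: "r1 > 0" "\<And>z. z \<noteq> 0 \<Longrightarrow> norm z < r1 \<Longrightarrow> g' z \<noteq> (\<lambda>v. 0)"
    using Q.gradient_nonzero by blast
  define N' where "N' = {x \<in> U. \<phi> x \<in> ball z0 r1}"
  show ?thesis
  proof (rule that[of N'])
    show "openin M N'" unfolding N'_def by (rule chart_open_preimage[OF c]) simp
    show "p \<in> N'" using U r1(1) by (simp add: N'_def z0_def)
    show "q = p" if "q \<in> N'" "critical_point A f q" for q
    proof (rule ccontr)
      assume ne: "q \<noteq> p"
      have q: "q \<in> U" "\<phi> q \<in> ball z0 r1" using that(1) by (auto simp: N'_def)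
      have "\<phi> q \<noteq> z0" using ne chart_left[OF c q(1)] \<psi>z by metis
      then have "g' (\<phi> q - z0) \<noteq> (\<lambda>v. 0)"
        using q(2) by (intro r1(2)) (auto simp: dist_norm norm_minus_commute)
      moreover have "f' (\<phi> q) = (\<lambda>v. 0)"
        using has_derivative_unique[OF f' critical_in_chart[OF c q(1) that(2)]] q(1) by blast
      ultimately show False by (simp add: g'_def)
    qed
    fix T :: "'b set"
    assume DIM: "DIM('b) \<ge> 2" and T: "subspace T" "dim T = DIM('b) - 1"
    let ?L = "level_component M f p"
    let ?X = "subtopology M ?L"
    show "\<not> flat_at ?X p T"
    proof
      assume flat: "flat_at ?X p T"
      show False
      proof (rule Q.not_locally_flat[OF DIM])
      fix r0 :: real assume r0: "r0 > 0"
        "\<And>Q r2 T d h k. Q \<subseteq> {z. g z = 0} \<inter> ball 0 r0 \<Longrightarrow> 0 \<in> Q \<Longrightarrow> r2 > 0 \<Longrightarrow>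
          (\<And>C. connected C \<Longrightarrow> 0 \<in> C \<Longrightarrow> C \<subseteq> {z. g z = 0} \<inter> ball 0 r2 \<Longrightarrow> C \<subseteq> Q) \<Longrightarrow>
          subspace T \<Longrightarrow> dim T = DIM('b) - 1 \<Longrightarrow> d > 0 \<Longrightarrow>
          homeomorphism Q ((T::'b set) \<inter> ball 0 d) h k \<Longrightarrow> h 0 = 0 \<Longrightarrow> False"
      define W where "W = {x \<in> U. \<phi> x \<in> ball z0 r0}"
      have W: "openin M W" unfolding W_def by (rule chart_open_preimage[OF c]) simp
      have pL: "p \<in> ?L" by (rule level_component_refl[OF p(1)])
      have LM: "?L \<subseteq> topspace M" and Lf: "f x = f p" if "x \<in> ?L" for x
        using level_component_subset[of M f p] that by auto
      have oW: "openin ?X (?L \<inter> W)" using W by (auto simp: openin_subtopology)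
      have pW: "p \<in> ?L \<inter> W" using pL U(2) r0(1) by (simp add: W_def z0_def)
      obtain Q d h k where Q: "openin ?X Q" "p \<in> Q" "Q \<subseteq> ?L \<inter> W" "d > 0"
        "homeomorphic_maps (subtopology ?X Q) (top_of_set (T \<inter> ball 0 d)) h k" "h p = 0"
        by (rule flat_at_shrink[OF flat subspace_0[OF T(1)] oW pW]) (rule that)
      obtain Y where Y: "openin M Y" "Q = Y \<inter> ?L" using Q(1) by (auto simp: openin_subtopology)
      have QU: "Q \<subseteq> U" using Q(3) by (auto simp: W_def)
      have QL: "Q \<subseteq> ?L" using Q(3) by blast
      have QM: "Q \<subseteq> topspace M" using QU chart_subset[OF c] by blast
      have QX: "subtopology ?X Q = subtopology M Q"
        unfolding subtopology_subtopology using QL by (simp add: inf.absorb2)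
      let ?D = "T \<inter> ball 0 d"
      have ch: "continuous_map (subtopology M Q) (top_of_set ?D) h"
        and ck: "continuous_map (top_of_set ?D) (subtopology M Q) k"
        and kh: "\<And>x. x \<in> Q \<Longrightarrow> k (h x) = x" and hk: "\<And>y. y \<in> ?D \<Longrightarrow> h (k y) = y"
        using Q(5) QM unfolding QX homeomorphic_maps_def by auto
      have hD: "h x \<in> ?D" if "x \<in> Q" for x
        using ch that QM by (auto simp: continuous_map_def Pi_iff)
      have kQ: "k y \<in> Q" if "y \<in> ?D" for y
        using ck that by (auto simp: continuous_map_def Pi_iff)
      define \<tau> where "\<tau> x = \<phi> x - z0" for x
      define S where "S = \<tau> ` Q"
      have \<psi>\<tau>: "\<psi> (z0 + \<tau> x) = x" if "x \<in> Q" for x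
        using chart_left[OF c] that QU by (auto simp: \<tau>_def)
      have zS: "z0 + y \<in> \<phi> ` Q" if "y \<in> S" for y using that by (auto simp: S_def \<tau>_def)
      \<comment> \<open>A ball about \<open>z0\<close> inside the image of \<open>Y\<close> lets
        \<open>Q\<close> absorb connected pieces of the zero set: they lie in the component of
        \<open>p\<close> by maximality and in \<open>Y\<close> by the choice of \<open>r2\<close>,
        so in \<open>Q = Y \<inter> ?L\<close>.\<close>
      have "open (\<phi> ` (Y \<inter> U))" by (intro chart_open_image[OF c] openin_Int Y chart_openin[OF c]) auto
        moreover have "z0 \<in> \<phi> ` (Y \<inter> U)" unfolding z0_def using Q(2) Y(2) U(2) by blast
        ultimately obtain r2 where r2: "r2 > 0" "ball z0 r2 \<subseteq> \<phi> ` (Y \<inter> U)"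
          using openE by blast
      show False
      proof (rule r0(2)[OF _ _ _ _ T(1,2) Q(4), of S r2 "\<lambda>y. h (\<psi> (z0 + y))" "\<lambda>y. \<tau> (k y)"])
        show "S \<subseteq> {z. g z = 0} \<inter> ball 0 r0"
        proof
          fix y assume "y \<in> S"
          then obtain x where x: "x \<in> Q" "y = \<tau> x" unfolding S_def by blast
          then have "x \<in> ?L" "x \<in> W" using Q(3) by blast+
          then show "y \<in> {z. g z = 0} \<inter> ball 0 r0"
            using \<psi>\<tau>[OF x(1)] Lf[of x] by (simp add: x(2) g_def) (simp add: W_def \<tau>_def dist_norm norm_minus_commute)
        qed
        show "0 \<in> S" unfolding S_def using Q(2) by (intro image_eqI[of _ \<tau> p]) (auto simp: \<tau>_def z0_def)
        show "r2 > 0" by fact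
        show "C \<subseteq> S" if C: "connected C" "0 \<in> C" "C \<subseteq> {z. g z = 0} \<inter> ball 0 r2" for C
        proof -
          define E where "E = \<psi> ` ((+) z0 ` C)"
          have inYU: "z0 + y \<in> \<phi> ` (Y \<inter> U)" if "y \<in> C" for y
          proof -
            have "z0 + y \<in> ball z0 r2" using C(3) that by (auto simp: dist_norm)
            then show ?thesis using r2(2) by blast
          qed
          have "connected ((+) z0 ` C)"
            using C(1) by (intro connected_continuous_image continuous_intros)
          then have "connectedin M E" unfolding E_def
            using inYU by (intro chart_connected[OF c]) blast+
          moreover have "p \<in> E" unfolding E_def using C(2) \<psi>z by force
          moreover have "f x = f p" if "x \<in> E" for x
            using that C(3) unfolding E_def g_def by auto
          ultimately have EL: "E \<subseteq> ?L" by (rule level_component_maximal)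
          show ?thesis
          proof
            fix y assume y: "y \<in> C"
            then obtain x where x: "x \<in> Y" "x \<in> U" "z0 + y = \<phi> x" using inYU by blast
            have "\<psi> (z0 + y) = x" using chart_left[OF c x(2)] x(3) by simp
            then have "x \<in> E" unfolding E_def using y by blast
            then have "x \<in> Q" using EL Y(2) x(1) by blast
            moreover have "y = \<tau> x" using x(3) by (simp add: \<tau>_def algebra_simps)
            ultimately show "y \<in> S" unfolding S_def by blast
          qed
        qed
        show "homeomorphism S ?D (\<lambda>y. h (\<psi> (z0 + y))) (\<lambda>y. \<tau> (k y))"
        proof (rule homeomorphismI)
          have "continuous_map (top_of_set (\<phi> ` Q)) M \<psi>"
            using continuous_map_from_subtopology_mono[OF chart_inv_continuous[OF c]] QU by blast
          moreover have "\<psi> ` \<phi> ` Q \<subseteq> Q" using chart_left[OF c] QU by auto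
          ultimately have "continuous_map (top_of_set (\<phi> ` Q)) (subtopology M Q) \<psi>"
            by (auto simp: continuous_map_in_subtopology)
          from continuous_map_compose[OF this ch]
          have "continuous_on (\<phi> ` Q) (h \<circ> \<psi>)" by (simp add: continuous_map_in_subtopology)
          then have "continuous_on S (\<lambda>y. (h \<circ> \<psi>) (z0 + y))"
            by (rule continuous_on_compose2) (use zS in \<open>auto intro!: continuous_intros\<close>)
          then show "continuous_on S (\<lambda>y. h (\<psi> (z0 + y)))" by simp
          have "continuous_map (subtopology M Q) euclidean \<phi>"
            using continuous_map_from_subtopology_mono[OF chart_continuous[OF c] QU] .
          from continuous_map_compose[OF ck this]
          have "continuous_on ?D (\<phi> \<circ> k)" by simp
          then show "continuous_on ?D (\<lambda>y. \<tau> (k y))"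
            unfolding \<tau>_def o_def by (intro continuous_intros)
          show "(\<lambda>y. h (\<psi> (z0 + y))) ` S \<subseteq> ?D"
          proof
            fix w assume "w \<in> (\<lambda>y. h (\<psi> (z0 + y))) ` S"
            then obtain x where "x \<in> Q" "w = h (\<psi> (z0 + \<tau> x))" unfolding S_def by blast
            then show "w \<in> ?D" using \<psi>\<tau> hD by simp
          qed
          show "(\<lambda>y. \<tau> (k y)) ` ?D \<subseteq> S" unfolding S_def using kQ by blast
          show "\<tau> (k (h (\<psi> (z0 + y)))) = y" if y: "y \<in> S" for y
          proof -
            obtain x where x: "x \<in> Q" "y = \<tau> x" using y unfolding S_def by blast
            then show ?thesis using \<psi>\<tau>[OF x(1)] kh[OF x(1)] by simp
          qed
          show "h (\<psi> (z0 + \<tau> (k y))) = y" if "y \<in> ?D" for y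
            using \<psi>\<tau>[OF kQ[OF that]] hk[OF that] by simp
        qed
        show "h (\<psi> (z0 + 0)) = 0" using \<psi>z Q(6) by simp
      qed
      qed
    qed
  qed
qed

end

section \<open>Tubes around regular components\<close>

text \<open>For closed \<open>C\<close> the part of the relation in \<open>X \<times> C\<close> is
  closed, and projection along a compact factor is a closed map; so preimages of closed sets are
  closed.\<close>

lemma closed_graph_continuous_map:
  assumes M: "compact_space M" "closedin (prod_topology M M) G"
    and X: "closedin M X" and Y: "closedin M Y" and t: "t \<in> X \<rightarrow> Y"
    and G: "\<And>x y. x \<in> X \<Longrightarrow> y \<in> Y \<Longrightarrow> (x, y) \<in> G \<longleftrightarrow> y = t x"
  shows "continuous_map (subtopology M X) (subtopology M Y) t"
  unfolding continuous_map_closedin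
proof (intro conjI allI impI ballI)
  have XM: "X \<subseteq> topspace M" "Y \<subseteq> topspace M" using X Y closedin_subset by blast+
  show "t \<in> topspace (subtopology M X) \<rightarrow> topspace (subtopology M Y)" using t XM by auto
  fix C assume C: "closedin (subtopology M Y) C"
  then have CM: "closedin M C" "C \<subseteq> Y" using Y closedin_trans_full closedin_subset by fastforce+
  have "closedin (prod_topology M M) (G \<inter> X \<times> C)"
    using M(2) X CM(1) by (intro closedin_Int) (simp_all add: closedin_prod_Times_iff)
  then have "closedin M (fst ` (G \<inter> X \<times> C))"
    using closed_map_fst[OF M(1)] unfolding closed_map_def by blast
  moreover have "fst ` (G \<inter> X \<times> C) = {x \<in> X. t x \<in> C}"
  proof (intro equalityI subsetI)
    fix x assume "x \<in> fst ` (G \<inter> X \<times> C)"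
    then obtain y where "(x, y) \<in> G" "x \<in> X" "y \<in> C" by auto
    then show "x \<in> {x \<in> X. t x \<in> C}" using G[of x y] CM(2) by auto
  next
    fix x assume x: "x \<in> {x \<in> X. t x \<in> C}"
    then have "(x, t x) \<in> G \<inter> X \<times> C" using G[of x "t x"] t by auto
    then show "x \<in> fst ` (G \<inter> X \<times> C)" by force
  qed
  ultimately have "closedin M {x \<in> X. t x \<in> C}" by simp
  moreover have "{x \<in> topspace (subtopology M X). t x \<in> C} = {x \<in> X. t x \<in> C}" using XM by auto
  ultimately show "closedin (subtopology M X) {x \<in> topspace (subtopology M X). t x \<in> C}"
    using closedin_subset_topspace[of M "{x \<in> X. t x \<in> C}" X] by auto
qed

text \<open>Pushing along chart lines is described by a relation, not by a formula for a map.
  Symmetry lets one closed relation supply the continuity of both directions.\<close>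

lemma closed_relation_homeomorphic_space:
  assumes M: "compact_space M" "closedin (prod_topology M M) G" and sym: "\<And>x y. (x, y) \<in> G \<Longrightarrow> (y, x) \<in> G"
    and X: "closedin M X" and Y: "closedin M Y"
    and XY: "\<And>x. x \<in> X \<Longrightarrow> \<exists>!y. y \<in> Y \<and> (x, y) \<in> G" and YX: "\<And>y. y \<in> Y \<Longrightarrow> \<exists>!x. x \<in> X \<and> (y, x) \<in> G"
  shows "subtopology M X homeomorphic_space subtopology M Y"
proof -
  obtain t where t: "\<And>x. x \<in> X \<Longrightarrow> t x \<in> Y \<and> (x, t x) \<in> G" using XY by metis
  obtain u where u: "\<And>y. y \<in> Y \<Longrightarrow> u y \<in> X \<and> (y, u y) \<in> G" using YX by metis
  have Gt: "(x, y) \<in> G \<longleftrightarrow> y = t x" if "x \<in> X" "y \<in> Y" for x y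
    using t[OF that(1)] ex1E[OF XY[OF that(1)], of "y = t x"] that(2) by metis
  have Gu: "(y, x) \<in> G \<longleftrightarrow> x = u y" if "y \<in> Y" "x \<in> X" for x y
    using u[OF that(1)] ex1E[OF YX[OF that(1)], of "x = u y"] that(2) by metis
  have ut: "u (t x) = x" if "x \<in> X" for x using Gu[of "t x" x] t[OF that] sym[of x "t x"] that by simp
  have tu: "t (u y) = y" if "y \<in> Y" for y using Gt[of "u y" y] u[OF that] sym[of y "u y"] that by simp
  have "continuous_map (subtopology M X) (subtopology M Y) t"
    using t Gt by (intro closed_graph_continuous_map[OF M X Y]) auto
  moreover have "continuous_map (subtopology M Y) (subtopology M X) u"
    using u Gu by (intro closed_graph_continuous_map[OF M Y X]) auto
  ultimately show ?thesis
    unfolding homeomorphic_space_def homeomorphic_maps_def using ut tu by auto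
qed

section \<open>Heights, bump functions and sliding along a flow box\<close>

context smooth_manifold
begin

text \<open>The admissible heights \<sigma> of the hypersurfaces
  \<open>f = c + \<epsilon> * \<sigma>\<close>. The Lipschitz condition is local and tested in
  charts, so that it makes sense without a metric on \<open>M\<close>.\<close>

definition tame :: "('a \<Rightarrow> real) \<Rightarrow> bool" where
  "tame \<sigma> \<longleftrightarrow> (\<forall>x. 0 \<le> \<sigma> x \<and> \<sigma> x \<le> 1) \<and>
     (\<forall>(U, \<phi>)\<in>A. \<forall>y\<in>\<phi> ` U. \<exists>r>0. \<exists>K. K-lipschitz_on (cball y r) (\<sigma> \<circ> inv_into U \<phi>))"

lemma tame_bounds: "tame \<sigma> \<Longrightarrow> 0 \<le> \<sigma> x" "tame \<sigma> \<Longrightarrow> \<sigma> x \<le> 1"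
  by (simp_all add: tame_def)

lemma tame_local:
  assumes "tame \<sigma>" "(U, \<phi>) \<in> A" "y \<in> \<phi> ` U"
  obtains r K where "r > 0" "K-lipschitz_on (cball y r) (\<sigma> \<circ> inv_into U \<phi>)"
proof -
  have "\<forall>(U, \<phi>)\<in>A. \<forall>y\<in>\<phi> ` U. \<exists>r>0. \<exists>K. K-lipschitz_on (cball y r) (\<sigma> \<circ> inv_into U \<phi>)"
    using assms(1) by (simp add: tame_def)
  from bspec[OF this assms(2)]
  have "\<forall>y\<in>\<phi> ` U. \<exists>r>0. \<exists>K. K-lipschitz_on (cball y r) (\<sigma> \<circ> inv_into U \<phi>)" by simp
  from bspec[OF this assms(3)] show ?thesis using that by blast
qed

lemma tame_zero: "tame (\<lambda>x. 0)"
  unfolding tame_def o_def case_prod_unfold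
  by (intro conjI allI ballI exI[of _ "1::real"] exI[of _ "0::real"]) (simp_all add: lipschitz_on_def)

text \<open>The combination is \<open>1 - (1 - \<sigma> x) * (1 - \<rho> x)\<close>: it stays in the
  unit interval, equals 1 wherever one of the two does, and agrees with \<sigma> where \<rho>
  vanishes.\<close>

lemma tame_union:
  assumes s: "tame \<sigma>" and r: "tame \<rho>" shows "tame (\<lambda>x. \<sigma> x + \<rho> x - \<sigma> x * \<rho> x)"
  unfolding tame_def
proof (intro conjI allI ballI, safe)
  fix x
  have e: "\<sigma> x + \<rho> x - \<sigma> x * \<rho> x = 1 - (1 - \<sigma> x) * (1 - \<rho> x)" by (simp add: algebra_simps)
  have "0 \<le> (1 - \<sigma> x) * (1 - \<rho> x)" "(1 - \<sigma> x) * (1 - \<rho> x) \<le> 1"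
    using tame_bounds[OF s, of x] tame_bounds[OF r, of x] by (auto intro!: mult_nonneg_nonneg mult_le_one)
  then show "0 \<le> \<sigma> x + \<rho> x - \<sigma> x * \<rho> x" "\<sigma> x + \<rho> x - \<sigma> x * \<rho> x \<le> 1" unfolding e by auto
next
  fix U \<phi> p assume U: "(U, \<phi>) \<in> A" "p \<in> U"
  then have p: "\<phi> p \<in> \<phi> ` U" by blast
  let ?\<psi> = "inv_into U \<phi>"
  obtain a K where a: "a > 0" "K-lipschitz_on (cball (\<phi> p) a) (\<sigma> \<circ> ?\<psi>)" using tame_local[OF s U(1) p] .
  obtain b L where b: "b > 0" "L-lipschitz_on (cball (\<phi> p) b) (\<rho> \<circ> ?\<psi>)" using tame_local[OF r U(1) p] .
  have "(K + L)-lipschitz_on (cball (\<phi> p) (min a b)) ((\<lambda>x. \<sigma> x + \<rho> x - \<sigma> x * \<rho> x) \<circ> ?\<psi>)"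
  proof (rule lipschitz_onI)
    show "0 \<le> K + L" using lipschitz_on_nonneg a b by (metis add_nonneg_nonneg)
    fix x y assume xy: "x \<in> cball (\<phi> p) (min a b)" "y \<in> cball (\<phi> p) (min a b)"
    define s1 s2 r1 r2 where "s1 = \<sigma> (?\<psi> x)" and "s2 = \<sigma> (?\<psi> y)" and "r1 = \<rho> (?\<psi> x)" and "r2 = \<rho> (?\<psi> y)"
    have bd: "0 \<le> s2" "s2 \<le> 1" "0 \<le> r1" "r1 \<le> 1"
      unfolding s2_def r1_def using tame_bounds s r by auto
    have 1: "\<bar>s1 - s2\<bar> \<le> K * dist x y" using lipschitz_onD[OF a(2), of x y] xy by (simp add: s1_def s2_def dist_real_def)
    have 2: "\<bar>r1 - r2\<bar> \<le> L * dist x y" using lipschitz_onD[OF b(2), of x y] xy by (simp add: r1_def r2_def dist_real_def)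
    \<comment> \<open>In this product rule both cofactors lie in the unit interval, so the Lipschitz
      constants add up.\<close>
    have "(s1 + r1 - s1 * r1) - (s2 + r2 - s2 * r2) = (s1 - s2) * (1 - r1) + (r1 - r2) * (1 - s2)"
      by (simp add: algebra_simps)
    then have "\<bar>(s1 + r1 - s1 * r1) - (s2 + r2 - s2 * r2)\<bar> \<le> \<bar>s1 - s2\<bar> * \<bar>1 - r1\<bar> + \<bar>r1 - r2\<bar> * \<bar>1 - s2\<bar>"
      by (simp add: abs_mult[symmetric] abs_triangle_ineq)
    also have "\<dots> \<le> \<bar>s1 - s2\<bar> * 1 + \<bar>r1 - r2\<bar> * 1"
      using bd by (intro add_mono mult_left_mono) auto
    also have "\<dots> \<le> (K + L) * dist x y" using 1 2 by (simp add: distrib_right)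
    finally show "dist (((\<lambda>x. \<sigma> x + \<rho> x - \<sigma> x * \<rho> x) \<circ> ?\<psi>) x) (((\<lambda>x. \<sigma> x + \<rho> x - \<sigma> x * \<rho> x) \<circ> ?\<psi>) y) \<le> (K + L) * dist x y"
      by (simp add: s1_def s2_def r1_def r2_def dist_real_def)
  qed
  moreover have "min a b > 0" using a b by simp
  ultimately show "\<exists>r>0. \<exists>K. K-lipschitz_on (cball (\<phi> p) r) ((\<lambda>x. \<sigma> x + \<rho> x - \<sigma> x * \<rho> x) \<circ> ?\<psi>)" by blast
qed

lemma tame_continuous: assumes s: "tame \<sigma>" shows "continuous_map M euclideanreal \<sigma>"
proof (rule continuous_map_from_charts)
  fix U \<phi> assume U: "(U, \<phi>) \<in> A"
  have "isCont (\<sigma> \<circ> inv_into U \<phi>) y" if y: "y \<in> \<phi> ` U" for y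
  proof -
    obtain r K where r: "r > 0" "K-lipschitz_on (cball y r) (\<sigma> \<circ> inv_into U \<phi>)" using tame_local[OF s U y] .
    have "continuous_on (cball y r) (\<sigma> \<circ> inv_into U \<phi>)" using lipschitz_on_continuous_on[OF r(2)] .
    then have "continuous_on (ball y r) (\<sigma> \<circ> inv_into U \<phi>)" using ball_subset_cball by (rule continuous_on_subset)
    then show ?thesis using r(1) continuous_on_eq_continuous_at[OF open_ball] by (metis centre_in_ball)
  qed
  then show "continuous_on (\<phi> ` U) (\<sigma> \<circ> inv_into U \<phi>)" by (intro continuous_at_imp_continuous_on) blast
qed

lemma tame_lipschitz:
  assumes s: "tame \<sigma>" and U: "(U, \<phi>) \<in> A" and C: "compact C" "C \<subseteq> \<phi> ` U"
  obtains K where "K-lipschitz_on C (\<sigma> \<circ> inv_into U \<phi>)"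
proof -
  \<comment> \<open>\<open>local_lipschitz\<close> carries a time argument, which the one-point set
    \<open>{0}\<close> fills.\<close>
  have "local_lipschitz {0::real} C (\<lambda>_. \<sigma> \<circ> inv_into U \<phi>)"
    unfolding local_lipschitz_def
  proof (intro ballI)
    fix y and t :: real assume "y \<in> C"
    then have "y \<in> \<phi> ` U" using C by blast
    then obtain r K where "r > 0" "K-lipschitz_on (cball y r) (\<sigma> \<circ> inv_into U \<phi>)" using tame_local[OF s U] by blast
    then show "\<exists>u>0. \<exists>L. \<forall>t\<in>cball t u \<inter> {0}. L-lipschitz_on (cball y u \<inter> C) (\<sigma> \<circ> inv_into U \<phi>)"
      by (meson Int_lower1 lipschitz_on_subset)
  qed
  then show ?thesis
    using local_lipschitz_compact_implies_lipschitz[where X = C and T = "{0::real}" and f = "\<lambda>_. \<sigma> \<circ> inv_into U \<phi>"]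
      C(1) that by auto
qed

text \<open>The plateau has radius \<open>R / 3\<close> and the support radius
  \<open>2 * R / 3\<close>; the remaining \<open>R / 3\<close> is how far a point of the support may
  slide along \<open>v\<close> without leaving the ball.\<close>

definition bump :: "'a set \<Rightarrow> ('a \<Rightarrow> 'b) \<Rightarrow> 'b \<Rightarrow> real \<Rightarrow> 'a \<Rightarrow> real" where
  "bump U \<phi> z R x = (if x \<in> U then max 0 (min 1 (2 - 3 * dist (\<phi> x) z / R)) else 0)"

lemma bump_one: "x \<in> U \<Longrightarrow> dist (\<phi> x) z \<le> R / 3 \<Longrightarrow> R > 0 \<Longrightarrow> bump U \<phi> z R x = 1"
  by (simp add: bump_def field_simps)

lemma bump_support:
  assumes "bump U \<phi> z R x \<noteq> 0" "R > 0" shows "x \<in> U" "dist (\<phi> x) z < 2 * R / 3"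
proof -
  show x: "x \<in> U" using assms(1) by (auto simp: bump_def split: if_splits)
  have "2 - 3 * dist (\<phi> x) z / R > 0" using assms(1) x by (auto simp: bump_def max_def split: if_splits)
  then show "dist (\<phi> x) z < 2 * R / 3" using assms(2) by (simp add: field_simps)
qed

text \<open>In a chart around a point of \<open>U\<close> the transition map is Lipschitz near that
  point. A point outside \<open>U\<close> has a neighbourhood on which the function vanishes,
  because the support lies in a compact subset of \<open>U\<close>, which is closed in
  \<open>M\<close>.\<close>

lemma tame_bump:
  assumes U: "(U, \<phi>) \<in> A" and R: "R > 0" "cball z R \<subseteq> \<phi> ` U"
  shows "tame (bump U \<phi> z R)"
  unfolding tame_def
proof (intro conjI allI ballI, safe)
  show "0 \<le> bump U \<phi> z R x" "bump U \<phi> z R x \<le> 1" for x by (simp_all add: bump_def)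
  fix V \<xi> q assume V: "(V, \<xi>) \<in> A" "q \<in> V"
  define \<theta> where "\<theta> = inv_into V \<xi>"
  define \<psi> where "\<psi> = inv_into U \<phi>"
  note cV = V(1) \<theta>_def and cU = U \<psi>_def
  have "\<exists>r>0. \<exists>K. K-lipschitz_on (cball (\<xi> q) r) (bump U \<phi> z R \<circ> \<theta>)"
  proof (cases "q \<in> U")
    case True
    obtain D where D: "open (\<xi> ` (V \<inter> U))"
      "\<And>x. x \<in> \<xi> ` (V \<inter> U) \<Longrightarrow> ((\<phi> \<circ> \<theta>) has_derivative D x) (at x)"
      "\<And>v. continuous_on (\<xi> ` (V \<inter> U)) (\<lambda>x. D x v)"
      using transition_derivative[OF cV U] by blast
    have qin: "\<xi> q \<in> \<xi> ` (V \<inter> U)" using V True by blast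
    obtain r K where r: "r > 0" "cball (\<xi> q) r \<subseteq> \<xi> ` (V \<inter> U)" "K-lipschitz_on (cball (\<xi> q) r) (\<phi> \<circ> \<theta>)"
      by (rule C1_directional_bound[OF D(1) qin D(2) D(3)], assumption) (rule that)
    have K: "K \<ge> 0" using lipschitz_on_nonneg[OF r(3)] .
    have "(3 / R * K)-lipschitz_on (cball (\<xi> q) r) (bump U \<phi> z R \<circ> \<theta>)"
    proof (rule lipschitz_onI)
      show "0 \<le> 3 / R * K" using R K by simp
      fix x y assume xy: "x \<in> cball (\<xi> q) r" "y \<in> cball (\<xi> q) r"
      have inU: "\<theta> w \<in> U" if "w \<in> cball (\<xi> q) r" for w
      proof -
        obtain p where "p \<in> V" "p \<in> U" "w = \<xi> p" using r(2) \<open>w \<in> cball (\<xi> q) r\<close> by blast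
        then show ?thesis using chart_left[OF cV] by simp
      qed
      have "\<bar>bump U \<phi> z R (\<theta> x) - bump U \<phi> z R (\<theta> y)\<bar> \<le> \<bar>3 * dist (\<phi> (\<theta> x)) z / R - 3 * dist (\<phi> (\<theta> y)) z / R\<bar>"
        using inU[OF xy(1)] inU[OF xy(2)] unfolding bump_def by (simp add: max_def min_def abs_minus_commute)
      also have "\<dots> = 3 / R * \<bar>dist (\<phi> (\<theta> x)) z - dist (\<phi> (\<theta> y)) z\<bar>"
      proof -
        have "3 * dist (\<phi> (\<theta> x)) z / R - 3 * dist (\<phi> (\<theta> y)) z / R = 3 / R * (dist (\<phi> (\<theta> x)) z - dist (\<phi> (\<theta> y)) z)"
          by (simp add: diff_divide_distrib right_diff_distrib)
        then show ?thesis using R(1) by (simp only: abs_mult) simp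
      qed
      also have "\<dots> \<le> 3 / R * dist (\<phi> (\<theta> x)) (\<phi> (\<theta> y))"
        using R(1) dist_triangle[of "\<phi> (\<theta> x)" z "\<phi> (\<theta> y)"] dist_triangle[of "\<phi> (\<theta> y)" z "\<phi> (\<theta> x)"]
        by (intro mult_left_mono) (auto simp: abs_le_iff dist_commute)
      also have "\<dots> \<le> 3 / R * (K * dist x y)"
        using R(1) lipschitz_onD[OF r(3) xy] by (intro mult_left_mono) auto
      finally show "dist ((bump U \<phi> z R \<circ> \<theta>) x) ((bump U \<phi> z R \<circ> \<theta>) y) \<le> 3 / R * K * dist x y"
        by (simp add: dist_real_def)
    qed
    then show ?thesis using r(1) by blast
  next
    case False
    define Kc where "Kc = \<psi> ` cball z (2 * R / 3)"
    have sub: "cball z (2 * R / 3) \<subseteq> \<phi> ` U" using R subset_cball[of "2 * R / 3" R z] by auto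
    have "closedin M Kc" unfolding Kc_def by (rule chart_closed[OF cU compact_cball sub])
    moreover have "q \<notin> Kc" using False chart_in[OF cU] sub unfolding Kc_def by blast
    ultimately have W: "openin M (V - Kc)" "q \<in> V - Kc" using chart_openin[OF cV] V(2) by auto
    have "open (\<xi> ` (V - Kc))" by (rule chart_open_image[OF cV W(1)]) auto
    then obtain r where r: "r > 0" "cball (\<xi> q) r \<subseteq> \<xi> ` (V - Kc)"
      using W(2) open_contains_cball by blast
    have zero: "bump U \<phi> z R (\<theta> w) = 0" if w: "w \<in> cball (\<xi> q) r" for w
    proof (rule ccontr)
      assume ne: "bump U \<phi> z R (\<theta> w) \<noteq> 0"
      obtain p where p: "p \<in> V" "p \<notin> Kc" "w = \<xi> p" using r(2) w by blast
      have \<theta>w: "\<theta> w = p" using p chart_left[OF cV] by simp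
      have "p \<in> U" "dist (\<phi> p) z < 2 * R / 3" using bump_support[OF ne R(1)] \<theta>w by simp_all
      then have "\<psi> (\<phi> p) \<in> Kc" unfolding Kc_def by (intro imageI) (simp add: dist_commute)
      then show False using p(2) chart_left[OF cU \<open>p \<in> U\<close>] by simp
    qed
    have "0-lipschitz_on (cball (\<xi> q) r) (bump U \<phi> z R \<circ> \<theta>)"
      by (rule lipschitz_onI) (use zero in auto)
    then show ?thesis using r(1) by blast
  qed
  then show "\<exists>r>0. \<exists>K. K-lipschitz_on (cball (\<xi> q) r) (bump U \<phi> z R \<circ> inv_into V \<xi>)"
    unfolding \<theta>_def .
qed

text \<open>Besides the diagonal it relates the points of the ball that lie on one line parallel to
  \<open>v\<close>: for a unit vector \<open>v\<close>, the equation says that \<open>b - a\<close>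
  is a multiple of \<open>v\<close>. Written as an equation on a compact set of pairs, this yields a
  closed relation.\<close>

definition slide :: "'a set \<Rightarrow> ('a \<Rightarrow> 'b) \<Rightarrow> 'b \<Rightarrow> 'b \<Rightarrow> real \<Rightarrow> ('a \<times> 'a) set" where
  "slide U \<phi> z v R = (\<lambda>x. (x, x)) ` topspace M \<union>
     (\<lambda>(a, b). (inv_into U \<phi> a, inv_into U \<phi> b)) `
       {(a, b). a \<in> cball z R \<and> b \<in> cball z R \<and> b - a = ((b - a) \<bullet> v) *\<^sub>R v}"

lemma slide_sym: "(x, y) \<in> slide U \<phi> z v R \<Longrightarrow> (y, x) \<in> slide U \<phi> z v R"
proof -
  assume "(x, y) \<in> slide U \<phi> z v R"
  then consider "x = y" "x \<in> topspace M"
    | a b where "x = inv_into U \<phi> a" "y = inv_into U \<phi> b" "a \<in> cball z R" "b \<in> cball z R" "b - a = ((b - a) \<bullet> v) *\<^sub>R v"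
    unfolding slide_def by auto
  then show ?thesis
  proof cases
    case (2 a b)
    have "a - b = - (b - a)" by simp
    also have "\<dots> = - (((b - a) \<bullet> v) *\<^sub>R v)" using 2(5) by simp
    also have "\<dots> = ((a - b) \<bullet> v) *\<^sub>R v" by (simp add: inner_diff_left scaleR_left_diff_distrib)
    finally have ab: "a - b = ((a - b) \<bullet> v) *\<^sub>R v" .
    have "(b, a) \<in> {(a, b). a \<in> cball z R \<and> b \<in> cball z R \<and> b - a = ((b - a) \<bullet> v) *\<^sub>R v}"
      by (simp only: mem_Collect_eq prod.case) (intro conjI 2(3,4) ab)
    then show ?thesis unfolding slide_def 2(1,2) by (intro UnI2 image_eqI[of _ _ "(b, a)"]) simp_all
  qed (simp add: slide_def)
qed

lemma slide_closed:
  assumes fb: "flow_box W U \<phi> z v R m" shows "closedin (prod_topology M M) (slide U \<phi> z v R)"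
proof -
  define \<psi> where "\<psi> = inv_into U \<phi>"
  note F = flow_boxD[OF fb \<psi>_def]
  note c = F(1) \<psi>_def
  let ?P = "{(a, b). a \<in> cball z R \<and> b \<in> cball z R \<and> b - a = ((b - a) \<bullet> v) *\<^sub>R v}"
  have e: "?P = (cball z R \<times> cball z R) \<inter> {q. snd q - fst q = ((snd q - fst q) \<bullet> v) *\<^sub>R v}"
  proof (rule set_eqI)
    show "q \<in> ?P \<longleftrightarrow> q \<in> (cball z R \<times> cball z R) \<inter> {q. snd q - fst q = ((snd q - fst q) \<bullet> v) *\<^sub>R v}" for q
      by (cases q) (simp only: mem_Collect_eq Int_iff mem_Times_iff fst_conv snd_conv prod.case conj_assoc)
  qed
  have "closed {q :: 'b \<times> 'b. snd q - fst q = ((snd q - fst q) \<bullet> v) *\<^sub>R v}"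
  proof -
    have d: "continuous_on UNIV (\<lambda>q :: 'b \<times> 'b. snd q - fst q)"
      by (rule continuous_on_diff[OF continuous_on_snd[OF continuous_on_id] continuous_on_fst[OF continuous_on_id]])
    show ?thesis
      by (rule closed_Collect_eq[OF d continuous_on_scaleR[OF continuous_on_inner[OF d continuous_on_const] continuous_on_const]])
  qed
  then have P: "compact ?P" unfolding e by (intro compact_Int_closed compact_Times compact_cball)
  have PU: "a \<in> \<phi> ` U" "b \<in> \<phi> ` U" if "(a, b) \<in> ?P" for a b using that F(5) by blast+
  have "continuous_map (top_of_set ?P) (top_of_set (\<phi> ` U)) fst" "continuous_map (top_of_set ?P) (top_of_set (\<phi> ` U)) snd"
    using PU by (auto simp: continuous_map_in_subtopology intro!: continuous_intros)
  then have "continuous_map (top_of_set ?P) M (\<psi> \<circ> fst)" "continuous_map (top_of_set ?P) M (\<psi> \<circ> snd)"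
    using continuous_map_compose chart_inv_continuous[OF c] by blast+
  then have "continuous_map (top_of_set ?P) (prod_topology M M) (\<lambda>q. ((\<psi> \<circ> fst) q, (\<psi> \<circ> snd) q))"
    by (rule continuous_map_pairedI)
  then have "compactin (prod_topology M M) ((\<lambda>q. ((\<psi> \<circ> fst) q, (\<psi> \<circ> snd) q)) ` ?P)"
    by (rule image_compactin[rotated]) (simp only: compactin_subtopology compactin_euclidean_iff P subset_refl simp_thms)
  moreover have "Hausdorff_space (prod_topology M M)" using Hausdorff_M by (simp add: Hausdorff_space_prod_topology)
  ultimately have "closedin (prod_topology M M) ((\<lambda>q. ((\<psi> \<circ> fst) q, (\<psi> \<circ> snd) q)) ` ?P)"
    using compactin_imp_closedin by blast
  moreover have "(\<lambda>q. ((\<psi> \<circ> fst) q, (\<psi> \<circ> snd) q)) ` ?P = (\<lambda>(a, b). (\<psi> a, \<psi> b)) ` ?P"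
    by (intro image_cong) auto
  ultimately show ?thesis
    unfolding slide_def \<psi>_def[symmetric]
    using Hausdorff_M by (intro closedin_Un) (simp_all add: Hausdorff_space_closedin_diagonal)
qed

lemma slide_iff:
  assumes fb: "flow_box W U \<phi> z v R m" and x: "x \<in> topspace M"
  shows "(x, y) \<in> slide U \<phi> z v R \<longleftrightarrow> y = x \<or>
    (x \<in> U \<and> \<phi> x \<in> cball z R \<and> (\<exists>s. \<phi> x + s *\<^sub>R v \<in> cball z R \<and> y = inv_into U \<phi> (\<phi> x + s *\<^sub>R v)))"
proof -
  define \<psi> where "\<psi> = inv_into U \<phi>"
  note F = flow_boxD[OF fb \<psi>_def]
  note c = F(1) \<psi>_def
  have v: "v \<bullet> v = 1" using F(2) by (simp add: norm_eq_1)
  have "(\<exists>a b. x = \<psi> a \<and> y = \<psi> b \<and> a \<in> cball z R \<and> b \<in> cball z R \<and> b - a = ((b - a) \<bullet> v) *\<^sub>R v) \<longleftrightarrow>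
    (x \<in> U \<and> \<phi> x \<in> cball z R \<and> (\<exists>s. \<phi> x + s *\<^sub>R v \<in> cball z R \<and> y = \<psi> (\<phi> x + s *\<^sub>R v)))"
    (is "?l = ?r")
  proof
    assume ?l
    then obtain a b where ab: "x = \<psi> a" "y = \<psi> b" "a \<in> cball z R" "b \<in> cball z R" "b - a = ((b - a) \<bullet> v) *\<^sub>R v" by blast
    have "a \<in> \<phi> ` U" using ab(3) F(5) by blast
    then have a: "\<phi> x = a" "x \<in> U" using chart_right[OF c] chart_in[OF c] ab(1) by simp_all
    have "a + ((b - a) \<bullet> v) *\<^sub>R v = b" using ab(5) by (metis add_diff_cancel_left' diff_add_cancel add.commute)
    then show ?r using a ab(2-4) by metis
  next
    assume ?r
    then obtain s where s: "x \<in> U" "\<phi> x \<in> cball z R" "\<phi> x + s *\<^sub>R v \<in> cball z R" "y = \<psi> (\<phi> x + s *\<^sub>R v)" by blast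
    have "x = \<psi> (\<phi> x)" using chart_left[OF c s(1)] by simp
    moreover have "\<phi> x + s *\<^sub>R v - \<phi> x = ((\<phi> x + s *\<^sub>R v - \<phi> x) \<bullet> v) *\<^sub>R v" using v by simp
    ultimately show ?l using s by blast
  qed
  then show ?thesis using x unfolding slide_def \<psi>_def[symmetric] by auto
qed

text \<open>For small \<epsilon> the functions \<open>f - \<epsilon> * \<sigma>\<close> and
  \<open>f - \<epsilon> * \<sigma>'\<close> still grow at rate at least \<open>m / 2\<close> along
  the lines of the box, so a line meets each hypersurface at most once. Points where the heights
  differ lie well inside the box and slide to the other hypersurface; all others stay put.\<close>

lemma push_step:
  assumes fb: "flow_box W U \<phi> z v R m" and WM: "W \<subseteq> topspace M"
    and s: "tame \<sigma>" and s': "tame \<sigma>'"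
    and diff: "\<And>x. \<sigma> x \<noteq> \<sigma>' x \<Longrightarrow> x \<in> U \<and> dist (\<phi> x) z < 2 * R / 3"
  obtains \<epsilon>0 where "\<epsilon>0 > 0"
    "\<And>\<epsilon> c. \<bar>\<epsilon>\<bar> \<le> \<epsilon>0 \<Longrightarrow> closedin M {x \<in> W. f x = c + \<epsilon> * \<sigma> x} \<Longrightarrow> closedin M {x \<in> W. f x = c + \<epsilon> * \<sigma>' x} \<Longrightarrow>
      subtopology M {x \<in> W. f x = c + \<epsilon> * \<sigma> x} homeomorphic_space subtopology M {x \<in> W. f x = c + \<epsilon> * \<sigma>' x}"
proof -
  define \<psi> where "\<psi> = inv_into U \<phi>"
  note F = flow_boxD[OF fb \<psi>_def]
  note ch = F(1) \<psi>_def
  obtain K1 where K1: "K1-lipschitz_on (cball z R) (\<sigma> \<circ> \<psi>)"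
    using tame_lipschitz[OF s F(1) compact_cball F(5)] unfolding \<psi>_def .
  obtain K2 where K2: "K2-lipschitz_on (cball z R) (\<sigma>' \<circ> \<psi>)"
    using tame_lipschitz[OF s' F(1) compact_cball F(5)] unfolding \<psi>_def .
  \<comment> \<open>A common Lipschitz constant; the summand 1 makes it positive.\<close>
  define K where "K = max K1 K2 + 1"
  have K: "K > 0" "K-lipschitz_on (cball z R) (\<sigma> \<circ> \<psi>)" "K-lipschitz_on (cball z R) (\<sigma>' \<circ> \<psi>)"
    using lipschitz_on_nonneg[OF K1] lipschitz_on_le[OF K1, of K] lipschitz_on_le[OF K2, of K]
    by (auto simp: K_def)
  \<comment> \<open>The first bound gives \<open>\<epsilon>0 * K \<le> m / 2\<close>, half the
    growth rate. The second equals \<open>m / 2 * (R / 3)\<close>, the change of height that a slide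
    by \<open>R / 3\<close> makes up for.\<close>
  define \<epsilon>0 where "\<epsilon>0 = min (m / (2 * K)) (m * R / 6)"
  have e0: "\<epsilon>0 > 0" "\<epsilon>0 \<le> m * R / 6" using K F(3,4) by (auto simp: \<epsilon>0_def)
  have e0K: "\<epsilon>0 * K \<le> m / 2"
  proof -
    have "\<epsilon>0 * K \<le> m / (2 * K) * K" using K unfolding \<epsilon>0_def by (intro mult_right_mono) auto
    then show ?thesis using K by simp
  qed
  define B where "B = cball z R"
  \<comment> \<open>Stated for a general pair of heights because it is used in both directions, from
    \<sigma> to \<open>\<sigma>'\<close> and back.\<close>
  have key: "\<exists>!y. y \<in> {x \<in> W. f x = c + \<epsilon> * \<tau>' x} \<and> (x, y) \<in> slide U \<phi> z v R"
    if eps: "\<bar>\<epsilon>\<bar> \<le> \<epsilon>0" and lip: "K-lipschitz_on B (\<tau>' \<circ> \<psi>)"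
      and t: "tame \<tau>" "tame \<tau>'" and diff': "\<And>x. \<tau> x \<noteq> \<tau>' x \<Longrightarrow> x \<in> U \<and> dist (\<phi> x) z < 2 * R / 3"
      and x: "x \<in> {x \<in> W. f x = c + \<epsilon> * \<tau> x}" for \<tau> \<tau>' \<epsilon> c x
  proof -
    have xW: "x \<in> W" and fx: "f x = c + \<epsilon> * \<tau> x" and xM: "x \<in> topspace M" using x WM by auto
    define h where "h y = f y - c - \<epsilon> * \<tau>' y" for y
    have mono: "m / 2 * r \<le> h (\<psi> (a + r *\<^sub>R v)) - h (\<psi> a)"
      if "0 \<le> r" "a \<in> B" "a + r *\<^sub>R v \<in> B" for a r
    proof -
      have "\<bar>\<tau>' (\<psi> (a + r *\<^sub>R v)) - \<tau>' (\<psi> a)\<bar> \<le> K * r"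
        using lipschitz_onD[OF lip that(3,2)] that(1) F(2) by (simp add: dist_real_def dist_norm)
      then have "\<bar>\<epsilon> * (\<tau>' (\<psi> (a + r *\<^sub>R v)) - \<tau>' (\<psi> a))\<bar> \<le> \<epsilon>0 * (K * r)"
        unfolding abs_mult using eps e0 by (intro mult_mono) auto
      also have "\<dots> \<le> m / 2 * r" using mult_right_mono[OF e0K that(1)] by (simp add: mult.assoc)
      finally have "\<bar>\<epsilon> * (\<tau>' (\<psi> (a + r *\<^sub>R v)) - \<tau>' (\<psi> a))\<bar> \<le> m / 2 * r" .
      moreover have "m * r \<le> f (\<psi> (a + r *\<^sub>R v)) - f (\<psi> a)" using F(8) that unfolding B_def by blast
      moreover have "m * r = m / 2 * r + m / 2 * r" by simp
      moreover have "h (\<psi> (a + r *\<^sub>R v)) - h (\<psi> a) =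
          (f (\<psi> (a + r *\<^sub>R v)) - f (\<psi> a)) - \<epsilon> * (\<tau>' (\<psi> (a + r *\<^sub>R v)) - \<tau>' (\<psi> a))"
        unfolding h_def by (simp only: right_diff_distrib)
      ultimately show ?thesis by linarith
    qed
    have uniq: "r1 = r2" if "a + r1 *\<^sub>R v \<in> B" "a + r2 *\<^sub>R v \<in> B" "h (\<psi> (a + r1 *\<^sub>R v)) = 0" "h (\<psi> (a + r2 *\<^sub>R v)) = 0" for a r1 r2
    proof -
      have *: False if "a + r1 *\<^sub>R v \<in> B" "a + r2 *\<^sub>R v \<in> B" "h (\<psi> (a + r1 *\<^sub>R v)) = 0" "h (\<psi> (a + r2 *\<^sub>R v)) = 0" "r1 < r2" for r1 r2
      proof -
        have e: "a + r1 *\<^sub>R v + (r2 - r1) *\<^sub>R v = a + r2 *\<^sub>R v" by (simp add: algebra_simps)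
        have "m / 2 * (r2 - r1) \<le> 0" using mono[of "r2 - r1" "a + r1 *\<^sub>R v", unfolded e] that by simp
        moreover have "m / 2 * (r2 - r1) > 0" using F(4) that(5) by simp
        ultimately show False by simp
      qed
      show ?thesis using *[of r1 r2] *[of r2 r1] that by (meson linorder_neqE_linordered_idom)
    qed
    have hx: "h x = \<epsilon> * (\<tau> x - \<tau>' x)" using fx by (simp add: h_def right_diff_distrib)
    have xe: "\<exists>y. y \<in> W \<and> h y = 0 \<and> (x, y) \<in> slide U \<phi> z v R"
    proof (cases "\<tau> x = \<tau>' x")
      case True
      then have "h x = 0" using hx by simp
      then show ?thesis using xW slide_iff[OF fb xM, of x] by blast
    next
      case False
      then have xU: "x \<in> U" "dist (\<phi> x) z < 2 * R / 3" using diff' by auto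
      have inB: "\<phi> x + r *\<^sub>R v \<in> B" if "\<bar>r\<bar> \<le> R / 3" for r
      proof -
        have "dist z (\<phi> x + r *\<^sub>R v) \<le> dist z (\<phi> x) + dist (\<phi> x) (\<phi> x + r *\<^sub>R v)" by (rule dist_triangle)
        also have "dist (\<phi> x) (\<phi> x + r *\<^sub>R v) = \<bar>r\<bar>" using F(2) by (simp add: dist_norm)
        finally show ?thesis using xU(2) that by (simp add: B_def dist_commute)
      qed
      have R3: "R / 3 \<ge> 0" using F(3) by simp
      have \<psi>x: "\<psi> (\<phi> x + 0 *\<^sub>R v) = x" using chart_left[OF ch xU(1)] by simp
      have "\<bar>\<tau> x - \<tau>' x\<bar> \<le> 1" using tame_bounds[OF t(1), of x] tame_bounds[OF t(2), of x] by (auto simp: abs_le_iff)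
      then have "\<bar>h x\<bar> \<le> \<epsilon>0 * 1" unfolding hx abs_mult using eps by (intro mult_mono) auto
      then have hxb: "\<bar>h x\<bar> \<le> m / 2 * (R / 3)" using e0(2) by simp
      define k where "k r = h (\<psi> (\<phi> x + r *\<^sub>R v))" for r
      have "continuous_map M euclideanreal h"
        unfolding h_def by (intro continuous_intros continuous_f tame_continuous[OF t(2)])
      then have "continuous_map (top_of_set (\<phi> ` U)) euclideanreal (h \<circ> \<psi>)"
        using continuous_map_compose chart_inv_continuous[OF ch] by blast
      then have "continuous_on (\<phi> ` U) (h \<circ> \<psi>)" by simp
      then have hB: "continuous_on B (h \<circ> \<psi>)" using F(5) unfolding B_def by (rule continuous_on_subset)
      have "continuous_on {-(R/3)..R/3} (\<lambda>r. (h \<circ> \<psi>) (\<phi> x + r *\<^sub>R v))"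
        by (rule continuous_on_compose2[OF hB]) (auto intro!: continuous_intros inB)
      then have kc: "continuous_on {-(R/3)..R/3} k" by (simp add: k_def[abs_def])
      have up: "k (R / 3) \<ge> 0"
        using mono[of "R / 3" "\<phi> x + 0 *\<^sub>R v"] inB[of 0] inB[of "R / 3"] R3 hxb \<psi>x unfolding k_def by simp
      have down: "k (- (R / 3)) \<le> 0"
        using mono[of "R / 3" "\<phi> x + (- (R / 3)) *\<^sub>R v"] inB[of 0] inB[of "- (R / 3)"] R3 hxb \<psi>x unfolding k_def by simp
      obtain r where r: "- (R / 3) \<le> r" "r \<le> R / 3" "k r = 0"
        using IVT'[OF down up _ kc] R3 by auto
      have rB: "\<phi> x + r *\<^sub>R v \<in> B" using inB r by (simp add: abs_le_iff)
      have "\<psi> (\<phi> x + r *\<^sub>R v) \<in> W" using rB F(6) unfolding B_def by blast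
      moreover have "h (\<psi> (\<phi> x + r *\<^sub>R v)) = 0" using r(3) by (simp add: k_def)
      moreover have "(x, \<psi> (\<phi> x + r *\<^sub>R v)) \<in> slide U \<phi> z v R"
        using rB inB[of 0] R3 xU(1) slide_iff[OF fb xM] unfolding B_def \<psi>_def by auto
      ultimately show ?thesis by blast
    qed
    \<comment> \<open>Inside the ball the diagonal is the slide with \<open>r = 0\<close>, so every
      partner of \<open>x\<close> lies on its line; outside, \<open>x\<close> is its own only
      partner.\<close>
    have param: "(x \<notin> U \<or> \<phi> x \<notin> B) \<and> y = x \<or> x \<in> U \<and> (\<exists>r. \<phi> x + r *\<^sub>R v \<in> B \<and> y = \<psi> (\<phi> x + r *\<^sub>R v))"
      if "(x, y) \<in> slide U \<phi> z v R" for y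
    proof (cases "x \<in> U \<and> \<phi> x \<in> B")
      case True
      then have "\<phi> x + 0 *\<^sub>R v \<in> B" "x = \<psi> (\<phi> x + 0 *\<^sub>R v)" using chart_left[OF ch] by auto
      then show ?thesis using slide_iff[OF fb xM, of y] that True unfolding B_def \<psi>_def by blast
    next
      case False
      then show ?thesis using slide_iff[OF fb xM, of y] that unfolding B_def by blast
    qed
    have xu: "y1 = y2" if "h y1 = 0" "(x, y1) \<in> slide U \<phi> z v R" "h y2 = 0" "(x, y2) \<in> slide U \<phi> z v R" for y1 y2
      using param[OF that(2)] param[OF that(4)]
    proof (elim disjE conjE exE)
      fix r1 r2 assume "\<phi> x + r1 *\<^sub>R v \<in> B" "y1 = \<psi> (\<phi> x + r1 *\<^sub>R v)" "\<phi> x + r2 *\<^sub>R v \<in> B" "y2 = \<psi> (\<phi> x + r2 *\<^sub>R v)"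
      then show ?thesis using uniq[of "\<phi> x" r1 r2] that(1,3) by simp
    next
      fix r assume "\<phi> x \<notin> B" "y1 = x" "\<phi> x + r *\<^sub>R v \<in> B" "y2 = \<psi> (\<phi> x + r *\<^sub>R v)"
      then show ?thesis using slide_iff[OF fb xM, of y2] that(4) unfolding B_def by metis
    next
      fix r assume "\<phi> x \<notin> B" "y2 = x" "\<phi> x + r *\<^sub>R v \<in> B" "y1 = \<psi> (\<phi> x + r *\<^sub>R v)"
      then show ?thesis using slide_iff[OF fb xM, of y1] that(2) unfolding B_def by metis
    qed simp_all
    have hz: "y \<in> {x \<in> W. f x = c + \<epsilon> * \<tau>' x} \<longleftrightarrow> y \<in> W \<and> h y = 0" for y by (auto simp: h_def)
    show ?thesis unfolding hz using xe xu by blast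
  qed
  show ?thesis
  proof (rule that[OF e0(1)])
    fix \<epsilon> c assume e: "\<bar>\<epsilon>\<bar> \<le> \<epsilon>0"
      and cl: "closedin M {x \<in> W. f x = c + \<epsilon> * \<sigma> x}" "closedin M {x \<in> W. f x = c + \<epsilon> * \<sigma>' x}"
    show "subtopology M {x \<in> W. f x = c + \<epsilon> * \<sigma> x} homeomorphic_space subtopology M {x \<in> W. f x = c + \<epsilon> * \<sigma>' x}"
    proof (rule closed_relation_homeomorphic_space[OF compact_M slide_closed[OF fb] slide_sym cl])
      show "\<exists>!y. y \<in> {x \<in> W. f x = c + \<epsilon> * \<sigma>' x} \<and> (x, y) \<in> slide U \<phi> z v R"
        if "x \<in> {x \<in> W. f x = c + \<epsilon> * \<sigma> x}" for x
        by (rule key[OF e _ s s' _ that]) (use K(3) diff in \<open>auto simp: B_def\<close>)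
      show "\<exists>!y. y \<in> {x \<in> W. f x = c + \<epsilon> * \<sigma> x} \<and> (x, y) \<in> slide U \<phi> z v R"
        if "x \<in> {x \<in> W. f x = c + \<epsilon> * \<sigma>' x}" for x
        by (rule key[OF e _ s' s _ that]) (use K(2) diff in \<open>auto simp: B_def\<close>)
    qed
  qed
qed

end

lemma finite_if_locally_finite:
  assumes M: "compact_space M" and C: "C \<subseteq> topspace M"
    and loc: "\<And>p. p \<in> topspace M \<Longrightarrow> \<exists>N. openin M N \<and> p \<in> N \<and> finite (N \<inter> C)"
  shows "finite C"
proof -
  obtain N where N: "\<And>p. p \<in> topspace M \<Longrightarrow> openin M (N p) \<and> p \<in> N p \<and> finite (N p \<inter> C)"
    using loc by metis
  have "compactin M (topspace M)" using M by (simp add: compact_space_def)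
  then obtain \<F> where F: "finite \<F>" "\<F> \<subseteq> N ` topspace M" "topspace M \<subseteq> \<Union>\<F>"
    using compactinD[of M "topspace M" "N ` topspace M"] N by blast
  have "C \<subseteq> (\<Union>Y\<in>\<F>. Y \<inter> C)" using F(3) C by blast
  moreover have "finite (\<Union>Y\<in>\<F>. Y \<inter> C)"
    using F(1) by (rule finite_UN_I) (use F(2) N in blast)
  ultimately show ?thesis by (rule finite_subset)
qed

section \<open>Pushing a regular component to nearby values\<close>

context smooth_manifold
begin

text \<open>Flow boxes covering the component push the level hypersurface \<open>f = c\<close> step by step to
  \<open>f = c + \<epsilon>\<close>, through the hypersurfaces \<open>f = c + \<epsilon> \<sigma>\<close> for increasing \<open>\<sigma>\<close>.\<close>

lemma push_along_boxes:
  assumes S: "finite S" and WM: "W \<subseteq> topspace M"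
    and box: "\<And>q. q \<in> S \<Longrightarrow> flow_box W (U q) (\<phi> q) (z q) (v q) (R q) (m q)"
  shows "\<exists>\<sigma> \<epsilon>0. tame \<sigma> \<and> \<epsilon>0 > 0 \<and>
    (\<forall>q\<in>S. \<forall>x\<in>U q. dist (\<phi> q x) (z q) < R q / 3 \<longrightarrow> \<sigma> x = 1) \<and>
    (\<forall>\<epsilon> c. \<bar>\<epsilon>\<bar> \<le> \<epsilon>0 \<longrightarrow> (\<forall>\<tau>. tame \<tau> \<longrightarrow> closedin M {x \<in> W. f x = c + \<epsilon> * \<tau> x}) \<longrightarrow>
       subtopology M {x \<in> W. f x = c} homeomorphic_space subtopology M {x \<in> W. f x = c + \<epsilon> * \<sigma> x})"
  using S box
proof (induction S rule: finite_induct)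
  case empty
  show ?case
    by (intro exI[of _ "\<lambda>x. 0"] exI[of _ "1::real"]) (simp add: tame_zero homeomorphic_space_refl)
next
  case (insert p S)
  have box: "flow_box W (U q) (\<phi> q) (z q) (v q) (R q) (m q)" if "q \<in> S" for q
    using insert.prems that by blast
  obtain \<sigma> \<epsilon>0 where s0: "tame \<sigma> \<and> \<epsilon>0 > 0 \<and>
    (\<forall>q\<in>S. \<forall>x\<in>U q. dist (\<phi> q x) (z q) < R q / 3 \<longrightarrow> \<sigma> x = 1) \<and>
    (\<forall>\<epsilon> c. \<bar>\<epsilon>\<bar> \<le> \<epsilon>0 \<longrightarrow> (\<forall>\<tau>. tame \<tau> \<longrightarrow> closedin M {x \<in> W. f x = c + \<epsilon> * \<tau> x}) \<longrightarrow>
       subtopology M {x \<in> W. f x = c} homeomorphic_space subtopology M {x \<in> W. f x = c + \<epsilon> * \<sigma> x})"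
    by atomize_elim (rule insert.IH[OF box])
  then have s: "tame \<sigma>" "\<epsilon>0 > 0"
    "\<And>q x. q \<in> S \<Longrightarrow> x \<in> U q \<Longrightarrow> dist (\<phi> q x) (z q) < R q / 3 \<Longrightarrow> \<sigma> x = 1"
    "\<And>\<epsilon> c. \<bar>\<epsilon>\<bar> \<le> \<epsilon>0 \<Longrightarrow> \<forall>\<tau>. tame \<tau> \<longrightarrow> closedin M {x \<in> W. f x = c + \<epsilon> * \<tau> x} \<Longrightarrow>
       subtopology M {x \<in> W. f x = c} homeomorphic_space subtopology M {x \<in> W. f x = c + \<epsilon> * \<sigma> x}"
    by simp_all
  have fb: "flow_box W (U p) (\<phi> p) (z p) (v p) (R p) (m p)" using insert.prems by blast
  note F = flow_boxD[OF fb refl]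
  define \<rho> where "\<rho> = bump (U p) (\<phi> p) (z p) (R p)"
  have r: "tame \<rho>" unfolding \<rho>_def by (rule tame_bump[OF F(1,3,5)])
  define \<sigma>' where "\<sigma>' x = \<sigma> x + \<rho> x - \<sigma> x * \<rho> x" for x
  have s': "tame \<sigma>'" unfolding \<sigma>'_def by (rule tame_union[OF s(1) r])
  have diff: "x \<in> U p \<and> dist (\<phi> p x) (z p) < 2 * R p / 3" if "\<sigma> x \<noteq> \<sigma>' x" for x
  proof -
    have "\<rho> x \<noteq> 0" using that by (auto simp: \<sigma>'_def)
    then show ?thesis using bump_support[OF _ F(3)] unfolding \<rho>_def by blast
  qed
  obtain \<epsilon>1 where e1: "\<epsilon>1 > 0"
    "\<And>\<epsilon> c. \<bar>\<epsilon>\<bar> \<le> \<epsilon>1 \<Longrightarrow> closedin M {x \<in> W. f x = c + \<epsilon> * \<sigma> x} \<Longrightarrow> closedin M {x \<in> W. f x = c + \<epsilon> * \<sigma>' x} \<Longrightarrow>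
      subtopology M {x \<in> W. f x = c + \<epsilon> * \<sigma> x} homeomorphic_space subtopology M {x \<in> W. f x = c + \<epsilon> * \<sigma>' x}"
    using push_step[OF fb WM s(1) s' diff] by blast
  show ?case
  proof (intro exI[of _ \<sigma>'] exI[of _ "min \<epsilon>0 \<epsilon>1"] conjI ballI allI impI)
    show "tame \<sigma>'" "min \<epsilon>0 \<epsilon>1 > 0" using s' s(2) e1(1) by auto
    show "\<sigma>' x = 1" if q: "q \<in> insert p S" "x \<in> U q" "dist (\<phi> q x) (z q) < R q / 3" for q x
    proof (cases "q \<in> S")
      case True
      then have "\<sigma> x = 1" using s(3) q by blast
      then show ?thesis by (simp add: \<sigma>'_def)
    next
      case False
      then have "q = p" using q(1) by blast
      then have "\<rho> x = 1" unfolding \<rho>_def using q(2,3) F(3) by (intro bump_one) auto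
      then show ?thesis by (simp add: \<sigma>'_def)
    qed
    fix \<epsilon> c assume e: "\<bar>\<epsilon>\<bar> \<le> min \<epsilon>0 \<epsilon>1"
      and cl: "\<forall>\<tau>. tame \<tau> \<longrightarrow> closedin M {x \<in> W. f x = c + \<epsilon> * \<tau> x}"
    \<comment> \<open>Closedness is assumed for every tame height because the intermediate heights
      only arise in the induction; it is passed to the induction hypothesis and used at \<sigma> and
      \<open>\<sigma>'\<close>.\<close>
    have "subtopology M {x \<in> W. f x = c} homeomorphic_space subtopology M {x \<in> W. f x = c + \<epsilon> * \<sigma> x}"
      using e cl by (intro s(4)) auto
    also have "subtopology M {x \<in> W. f x = c + \<epsilon> * \<sigma> x} homeomorphic_space subtopology M {x \<in> W. f x = c + \<epsilon> * \<sigma>' x}"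
      using e cl s(1) s' by (intro e1(2)) auto
    finally (homeomorphic_space_trans) show "subtopology M {x \<in> W. f x = c} homeomorphic_space subtopology M {x \<in> W. f x = c + \<epsilon> * \<sigma>' x}" .
  qed
qed

text \<open>The open set \<open>W\<close> separates \<open>L\<close> from the rest of its level and
  from the critical points. In the closure of \<open>W\<close>, values close to \<open>c\<close> are
  taken only on \<open>Op\<close>, where the height is 1, so pushing ends exactly on the level
  \<open>f = t\<close>. The fibre of \<open>W\<close> there is homeomorphic to \<open>L\<close>,
  hence connected, and it is a whole component because components of these levels that meet
  \<open>W\<close> cannot leave it.\<close>

lemma regular_tube:
  assumes fin: "finite {p \<in> topspace M. critical_point A f p}"
    and x0: "x0 \<in> topspace M" and reg: "\<And>p. p \<in> level_component M f x0 \<Longrightarrow> \<not> critical_point A f p"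
  obtains G a b where "x0 \<in> G" "\<And>p. p \<in> G \<Longrightarrow> \<not> critical_point A f p" "level_tube M f G a b"
proof -
  define L where "L = \<L> x0"
  define c where "c = f x0"
  define Z where "Z = {x \<in> topspace M. f x \<in> {c}}"
  define Cr where "Cr = {p \<in> topspace M. critical_point A f p}"
  have LM: "L \<subseteq> topspace M" and Lf: "\<And>x. x \<in> L \<Longrightarrow> f x = c"
    using level_component_subset[of M f x0] by (auto simp: L_def c_def)
  have x0L: "x0 \<in> L" unfolding L_def by (rule level_component_refl[OF x0])
  \<comment> \<open>By \<open>regular_level_flat\<close> every point of \<open>L\<close> has a
    neighbourhood of this kind, so \<open>L\<close> is open in its level \<open>Z\<close>, and
    \<open>Z - L\<close> is closed.\<close>
  define O0 where "O0 = \<Union>{N. openin M N \<and> {x \<in> N. f x = c} \<subseteq> L}"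
  have oO0: "openin M O0" unfolding O0_def by (rule openin_Union) blast
  have LO0: "L \<subseteq> O0"
  proof
    fix q assume q: "q \<in> L"
    then have qM: "q \<in> topspace M" using LM by blast
    have qr: "\<not> critical_point A f q" using reg q unfolding L_def by blast
    obtain N where N: "openin M N" "q \<in> N" "{x \<in> N. f x = f q} \<subseteq> \<L> q"
      using regular_level_flat[OF qM qr] by metis
    have "\<L> q = L" using level_component_cong[of q M f x0] q unfolding L_def by blast
    then show "q \<in> O0" using N Lf[OF q] unfolding O0_def by auto
  qed
  have ZL: "Z - L = Z - O0" using LO0 unfolding O0_def Z_def by blast
  have "closedin M Z" unfolding Z_def by (rule closedin_level) simp
  then have clZL: "closedin M (Z - L)" unfolding ZL using oO0 by (rule closedin_diff)
  have clCr: "closedin M Cr"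
    using fin Hausdorff_M unfolding Cr_def by (intro closedin_Hausdorff_finite) auto
  have clL: "closedin M L" unfolding L_def by (rule closedin_level_component)
  have "disjnt L (Z - L \<union> Cr)" using reg by (auto simp: disjnt_def L_def Cr_def)
  moreover have "normal_space M"
    using compact_M Hausdorff_M compact_Hausdorff_or_regular_imp_normal_space by blast
  ultimately obtain W W' where W: "openin M W" "openin M W'" "L \<subseteq> W" "Z - L \<union> Cr \<subseteq> W'" "disjnt W W'"
    using clL closedin_Un[OF clZL clCr] unfolding normal_space_def by metis
  have WM: "W \<subseteq> topspace M" using W(1) openin_subset by blast
  define CW where "CW = M closure_of W"
  have clCW: "closedin M CW" by (simp add: CW_def)
  have WCW: "W \<subseteq> CW" unfolding CW_def using WM closure_of_subset by blast
  have CWM: "CW \<subseteq> topspace M" using clCW closedin_subset by blast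
  have CWd: "CW \<inter> W' = {}"
  proof -
    have "CW \<subseteq> topspace M - W'" unfolding CW_def
      using W(2,5) WM by (intro closure_of_minimal closedin_diff) (auto simp: disjnt_def)
    then show ?thesis by blast
  qed
  have CWL: "x \<in> L" if "x \<in> CW" "f x = c" for x
    using that CWd W(4) CWM unfolding Z_def by blast
  have "\<exists>U \<phi> v R m. flow_box W U \<phi> (\<phi> q) v R m \<and> q \<in> U" if q: "q \<in> L" for q
  proof -
    have "q \<in> topspace M" "\<not> critical_point A f q" "q \<in> W" using q LM reg W(3) unfolding L_def by blast+
    then show ?thesis using flow_box_exists[OF _ _ W(1)] by metis
  qed
  then obtain U \<phi> v R m where box: "\<And>q. q \<in> L \<Longrightarrow> flow_box W (U q) (\<phi> q) (\<phi> q q) (v q) (R q) (m q) \<and> q \<in> U q"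
    by metis
  \<comment> \<open>The plateau of the bump in the box at \<open>q\<close>, where the final height
    is 1.\<close>
  define I where "I q = {x \<in> U q. \<phi> q x \<in> ball (\<phi> q q) (R q / 3)}" for q
  have I: "openin M (I q)" "q \<in> I q" "I q \<subseteq> W" if q: "q \<in> L" for q
  proof -
    have fb: "flow_box W (U q) (\<phi> q) (\<phi> q q) (v q) (R q) (m q)" and qU: "q \<in> U q" using box[OF q] by auto
    note F = flow_boxD[OF fb refl]
    show "openin M (I q)" unfolding I_def by (rule chart_open_preimage[OF F(1) refl]) simp
    show "q \<in> I q" using qU F(3) by (simp add: I_def)
    show "I q \<subseteq> W"
    proof
      fix x assume x: "x \<in> I q"
      then have "\<phi> q x \<in> cball (\<phi> q q) (R q)" using F(3) by (auto simp: I_def)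
      then have "inv_into (U q) (\<phi> q) (\<phi> q x) \<in> W" using F(6) by blast
      then show "x \<in> W" using chart_left[OF F(1) refl, of x] x by (simp add: I_def)
    qed
  qed
  have "compactin M L" using clL compact_M closedin_compact_space by blast
  then obtain \<F> where F: "finite \<F>" "\<F> \<subseteq> I ` L" "L \<subseteq> \<Union>\<F>"
    using compactinD[of M L "I ` L"] I(1,2) by blast
  obtain S where S: "S \<subseteq> L" "finite S" "\<F> = I ` S" using finite_subset_image[OF F(1,2)] by blast
  define Op where "Op = (\<Union>q\<in>S. I q)"
  have LOp: "L \<subseteq> Op" using F(3) S(3) by (simp add: Op_def)
  have oOp: "openin M Op" "Op \<subseteq> W" unfolding Op_def using I S(1) by blast+
  obtain \<sigma> \<epsilon>0 where s: "tame \<sigma>" "\<epsilon>0 > 0"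
    "\<forall>q\<in>S. \<forall>x\<in>U q. dist (\<phi> q x) (\<phi> q q) < R q / 3 \<longrightarrow> \<sigma> x = 1"
    "\<forall>\<epsilon> c. \<bar>\<epsilon>\<bar> \<le> \<epsilon>0 \<longrightarrow> (\<forall>\<tau>. tame \<tau> \<longrightarrow> closedin M {x \<in> W. f x = c + \<epsilon> * \<tau> x}) \<longrightarrow>
       subtopology M {x \<in> W. f x = c} homeomorphic_space subtopology M {x \<in> W. f x = c + \<epsilon> * \<sigma> x}"
    using push_along_boxes[OF S(2) WM, of U \<phi> "\<lambda>q. \<phi> q q" v R m] box S(1) by blast
  have sOp: "\<sigma> x = 1" if "x \<in> Op" for x
    using that s(3) unfolding Op_def I_def by (auto simp: dist_commute)
  \<comment> \<open>The value \<open>c\<close> is not taken on \<open>CW - Op\<close>, so by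
    compactness neither are the values within some \<open>\<epsilon>1\<close> of it.\<close>
  have "compact (f ` (CW - Op))"
    using clCW oOp(1) by (intro compact_image_closedin closedin_diff)
  then have "open (- f ` (CW - Op))" by (simp add: compact_imp_closed open_Compl)
  moreover have "c \<in> - f ` (CW - Op)" using CWL LOp by blast
  ultimately obtain \<epsilon>1 where e1: "\<epsilon>1 > 0" "cball c \<epsilon>1 \<subseteq> - f ` (CW - Op)"
    using open_contains_cball by blast
  have near: "x \<in> Op" if "x \<in> CW" "\<bar>f x - c\<bar> \<le> \<epsilon>1" for x
  proof (rule ccontr)
    assume "x \<notin> Op"
    then have "f x \<in> f ` (CW - Op)" using that(1) by blast
    moreover have "f x \<in> cball c \<epsilon>1" using that(2) by (simp add: dist_real_def abs_minus_commute)
    ultimately show False using e1(2) by blast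
  qed
  \<comment> \<open>Over the closed set \<open>CW\<close> the equation cuts out the same points as
    over \<open>W\<close>, since its solutions in \<open>CW\<close> lie in
    \<open>Op\<close>.\<close>
  have cl: "closedin M {x \<in> W. f x = c + \<epsilon> * \<tau> x}" if t: "tame \<tau>" and e: "\<bar>\<epsilon>\<bar> \<le> \<epsilon>1" for \<tau> \<epsilon>
  proof -
    have "continuous_map M euclideanreal (\<lambda>x. f x - \<epsilon> * \<tau> x)"
      by (intro continuous_intros continuous_f tame_continuous[OF t])
    from closedin_continuous_map_preimage[OF this, of "{c}"]
    have "closedin M (CW \<inter> {x \<in> topspace M. f x - \<epsilon> * \<tau> x \<in> {c}})" using clCW by (intro closedin_Int) auto
    moreover have "CW \<inter> {x \<in> topspace M. f x - \<epsilon> * \<tau> x \<in> {c}} = {x \<in> W. f x = c + \<epsilon> * \<tau> x}"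
    proof (intro equalityI subsetI)
      fix x assume "x \<in> CW \<inter> {x \<in> topspace M. f x - \<epsilon> * \<tau> x \<in> {c}}"
      then have x: "x \<in> CW" "f x - c = \<epsilon> * \<tau> x" by auto
      have "\<bar>\<epsilon> * \<tau> x\<bar> \<le> \<epsilon>1 * 1"
        unfolding abs_mult using e e1(1) tame_bounds[OF t, of x] by (intro mult_mono) auto
      then have "x \<in> Op" using near x by simp
      then show "x \<in> {x \<in> W. f x = c + \<epsilon> * \<tau> x}" using oOp(2) x(2) by auto
    qed (use WCW WM in auto)
    ultimately show ?thesis by simp
  qed
  define e where "e = min \<epsilon>0 \<epsilon>1"
  have e: "e > 0" "e \<le> \<epsilon>0" "e \<le> \<epsilon>1" using s(2) e1(1) by (auto simp: e_def)
  have LW: "{x \<in> W. f x = c} = L"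
    using CWL WCW W(3) Lf by blast
  have hom: "subtopology M L homeomorphic_space subtopology M {y \<in> W. f y = t}" if t: "\<bar>t - c\<bar> < e" for t
  proof -
    have e': "\<bar>t - c\<bar> \<le> \<epsilon>0" "\<bar>t - c\<bar> \<le> \<epsilon>1" using t e by auto
    have "subtopology M {x \<in> W. f x = c} homeomorphic_space subtopology M {x \<in> W. f x = c + (t - c) * \<sigma> x}"
      using s(4)[rule_format, OF e'(1)] cl[OF _ e'(2)] by blast
    \<comment> \<open>Both sides are contained in \<open>Op\<close>, where
      \<open>\<sigma> x = 1\<close> turns the condition into \<open>f x = t\<close>.\<close>
    moreover have "{x \<in> W. f x = c + (t - c) * \<sigma> x} = {y \<in> W. f y = t}"
    proof (intro equalityI subsetI)
      fix x assume x: "x \<in> {x \<in> W. f x = c + (t - c) * \<sigma> x}"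
      have "\<bar>(t - c) * \<sigma> x\<bar> \<le> \<epsilon>1 * 1"
        unfolding abs_mult using e'(2) e1(1) tame_bounds[OF s(1), of x] by (intro mult_mono) auto
      then have "x \<in> Op" using near[of x] x WCW by auto
      then show "x \<in> {y \<in> W. f y = t}" using x sOp by auto
    next
      fix x assume x: "x \<in> {y \<in> W. f y = t}"
      then have "x \<in> Op" using near[of x] WCW e'(2) by auto
      then show "x \<in> {x \<in> W. f x = c + (t - c) * \<sigma> x}" using x sOp by auto
    qed
    ultimately show ?thesis unfolding LW by simp
  qed
  define G where "G = {x \<in> W. f x \<in> {c - e<..<c + e}}"
  have GW: "G \<subseteq> W" and Ge: "\<And>x. x \<in> G \<Longrightarrow> \<bar>f x - c\<bar> < e" by (auto simp: G_def abs_less_iff)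
  have fib: "\<L> x = {y \<in> W. f y = f x}" if x: "x \<in> G" for x
  proof
    have xM: "x \<in> topspace M" using x GW WM by blast
    have "connected_space (subtopology M L)"
      using connectedin_level_component[of M f x0] unfolding L_def connectedin_def by blast
    then have "connected_space (subtopology M {y \<in> W. f y = f x})"
      using homeomorphic_connected_space[OF hom[OF Ge[OF x]]] by blast
    then have "connectedin M {y \<in> W. f y = f x}" using WM by (auto simp: connectedin_def)
    then show "{y \<in> W. f y = f x} \<subseteq> \<L> x"
      using x GW by (intro level_component_maximal) blast+
    \<comment> \<open>At values this close to \<open>c\<close> no point lies on the boundary of
      \<open>W\<close>, so a component leaving \<open>W\<close> would be separated by
      \<open>W\<close> and the complement of its closure.\<close>
    have sub: "\<L> x \<subseteq> W \<union> (topspace M - CW)"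
    proof
      fix y assume y: "y \<in> \<L> x"
      then have y': "y \<in> topspace M" "f y = f x" using level_component_subset[of M f x] by auto
      show "y \<in> W \<union> (topspace M - CW)"
      proof (cases "y \<in> CW")
        case True
        then have "y \<in> Op" using near[of y] Ge[OF x] y'(2) e(3) by simp
        then show ?thesis using oOp(2) by blast
      qed (use y' in blast)
    qed
    have "\<L> x \<inter> (topspace M - CW) = {}"
    proof (rule ccontr)
      assume "\<L> x \<inter> (topspace M - CW) \<noteq> {}"
      moreover have "x \<in> W \<inter> \<L> x" using x GW level_component_refl[OF xM, of f] by blast
      moreover have "openin M (topspace M - CW)" using clCW by blast
      ultimately show False
        using connectedinD[OF connectedin_level_component W(1), of "topspace M - CW" f x] sub WCW by blast
    qed
    then have "\<L> x \<subseteq> W" using sub by blast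
    then show "\<L> x \<subseteq> {y \<in> W. f y = f x}" using level_component_subset[of M f x] by blast
  qed
  show ?thesis
  proof (rule that[of G])
    show "x0 \<in> G" using x0L W(3) Lf[OF x0L] e(1) unfolding G_def by auto
    show "\<not> critical_point A f p" if "p \<in> G" for p
      using that GW WM W(4,5) unfolding disjnt_def Cr_def by blast
    show "level_tube M f G (c - e) (c + e)"
      unfolding level_tube_def
    proof (intro conjI ballI impI)
      have "G = W \<inter> {x \<in> topspace M. f x \<in> {c - e<..<c + e}}" using WM by (auto simp: G_def)
      moreover have "openin M (W \<inter> {x \<in> topspace M. f x \<in> {c - e<..<c + e}})"
        by (intro openin_Int W(1) openin_level open_greaterThanLessThan)
      ultimately show "openin M G" by (rule ssubst)
      show "c - e < c + e" using e(1) by simp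
      show "f ` G = {c - e<..<c + e}"
      proof
        show "{c - e<..<c + e} \<subseteq> f ` G"
        proof
          fix t assume t: "t \<in> {c - e<..<c + e}"
          then have "\<bar>t - c\<bar> < e" by auto
          from hom[OF this] obtain g where "homeomorphic_map (subtopology M L) (subtopology M {y \<in> W. f y = t}) g"
            by (auto simp: homeomorphic_space)
          then have "g ` topspace (subtopology M L) = topspace (subtopology M {y \<in> W. f y = t})"
            by (rule homeomorphic_imp_surjective_map)
          then have "g x0 \<in> {y \<in> W. f y = t}" using x0 x0L by auto
          then have "g x0 \<in> G" "f (g x0) = t" using t by (auto simp: G_def)
          then show "t \<in> f ` G" by blast
        qed
      qed (auto simp: G_def)
    next
      fix x assume x: "x \<in> G"
      show "\<L> x \<subseteq> G" unfolding fib[OF x] using x by (auto simp: G_def)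
      fix y assume y: "y \<in> G"
      show "\<L> x = \<L> y" if "f x = f y" unfolding fib[OF x] fib[OF y] that ..
      have "subtopology M (\<L> x) homeomorphic_space subtopology M L"
        unfolding fib[OF x] using hom[OF Ge[OF x]] homeomorphic_space_sym by blast
      then show "subtopology M (\<L> x) homeomorphic_space subtopology M (\<L> y)"
        unfolding fib[OF y] using hom[OF Ge[OF y]] homeomorphic_space_trans by blast
    next
      fix x assume x: "x \<in> M closure_of G" and fx: "c - e < f x \<and> f x < c + e"
      have "x \<in> CW" using x closure_of_mono[OF GW, of M] unfolding CW_def by blast
      moreover have "\<bar>f x - c\<bar> \<le> \<epsilon>1" using fx e(3) by auto
      ultimately have "x \<in> W" using near oOp(2) by blast
      then show "x \<in> G" using fx by (simp add: G_def)
    qed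
  qed
qed

end

section \<open>Morse functions as instances of \<open>reeb_space\<close>\<close>

lemma reeb_vertices_subset: "reeb_vertices M A f \<subseteq> level_components M f"
  by (auto simp: reeb_vertices_def)

lemma Union_reeb_vertices_iff:
  assumes "x \<in> topspace M"
  shows "x \<in> \<Union>(reeb_vertices M A f) \<longleftrightarrow> (\<exists>p\<in>level_component M f x. critical_point A f p)"
proof
  assume "x \<in> \<Union>(reeb_vertices M A f)"
  then obtain y p where "x \<in> level_component M f y" "p \<in> level_component M f y" "critical_point A f p"
    by (auto simp: reeb_vertices_def level_components_eq)
  then show "\<exists>p\<in>level_component M f x. critical_point A f p"
    using level_component_cong[of x M f y] by auto
next
  assume "\<exists>p\<in>level_component M f x. critical_point A f p"
  then have "level_component M f x \<in> reeb_vertices M A f"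
    using assms by (auto simp: reeb_vertices_def level_components_eq)
  then show "x \<in> \<Union>(reeb_vertices M A f)"
    using level_component_refl[OF assms] by blast
qed

lemma finite_reeb_vertices:
  assumes "finite {p \<in> topspace M. critical_point A f p}"
  shows "finite (reeb_vertices M A f)"
proof (rule finite_subset)
  show "reeb_vertices M A f \<subseteq> level_component M f ` {p \<in> topspace M. critical_point A f p}"
  proof
    fix L assume "L \<in> reeb_vertices M A f"
    then obtain x p where x: "L = level_component M f x" "p \<in> L" "critical_point A f p"
      by (auto simp: reeb_vertices_def level_components_eq)
    then have "p \<in> topspace M" "L = level_component M f p"
      using level_component_subset[of M f x] level_component_cong[of p M f x] by auto
    then show "L \<in> level_component M f ` {p \<in> topspace M. critical_point A f p}" using x(3) by blast
  qed
qed (use assms in simp)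

text \<open>The bound on the dimension enters in the comparison of components: a regular component
  is flat of dimension \<open>DIM('b) - 1\<close> at each point, flatness is preserved by
  homeomorphisms, and from dimension 2 on a critical component is not flat at its critical
  point.\<close>

lemma (in smooth_manifold) reeb_space_positive_dim:
  assumes DIM: "DIM('b) \<ge> 2" and morse: "morse_function DIM('b) M A f"
  shows "reeb_space M f (reeb_vertices M A f)"
proof
  have nd: "nondegenerate_at DIM('b) A f p" if "p \<in> topspace M" "critical_point A f p" for p
    using morse that by (simp add: morse_function_def)
  have fin: "finite {p \<in> topspace M. critical_point A f p}"
  proof (rule finite_if_locally_finite[OF compact_M])
    fix p assume p: "p \<in> topspace M"
    show "\<exists>N. openin M N \<and> p \<in> N \<and> finite (N \<inter> {p \<in> topspace M. critical_point A f p})"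
    proof (cases "critical_point A f p")
      case True
      obtain N where N: "openin M N" "p \<in> N" "\<And>q. q \<in> N \<Longrightarrow> critical_point A f q \<Longrightarrow> q = p"
        using nondegenerate_critical_local[OF p True nd[OF p True]] by metis
      then have "N \<inter> {p \<in> topspace M. critical_point A f p} \<subseteq> {p}" by blast
      then have "finite (N \<inter> {p \<in> topspace M. critical_point A f p})" by (rule finite_subset) simp
      then show ?thesis using N by blast
    next
      case False
      obtain U \<phi> v R m where fb: "flow_box (topspace M) U \<phi> (\<phi> p) v R m" "p \<in> U"
        using flow_box_exists[OF p False openin_topspace p] by blast
      note F = flow_boxD[OF fb(1) refl]
      let ?N = "{x \<in> U. \<phi> x \<in> ball (\<phi> p) R}"
      have "\<not> critical_point A f x" if "x \<in> ?N" for x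
        using F(7)[of "\<phi> x"] that chart_left[OF F(1) refl, of x] by auto
      then have "?N \<inter> {p \<in> topspace M. critical_point A f p} = {}" by blast
      moreover have "openin M ?N" by (rule chart_open_preimage[OF F(1) refl]) simp
      moreover have "p \<in> ?N" using fb(2) F(3) by simp
      ultimately show ?thesis by (metis finite.emptyI)
    qed
  qed auto
  show "finite (reeb_vertices M A f)" by (rule finite_reeb_vertices[OF fin])
  show "reeb_vertices M A f \<subseteq> level_components M f" by (rule reeb_vertices_subset)
  have regular: "\<not> critical_point A f p" if "p \<in> topspace M - \<Union>(reeb_vertices M A f)" for p
    using that Union_reeb_vertices_iff[of p M A f] level_component_refl[of p M f] by blast
  show "open (f ` U)" if "openin M U" "U \<subseteq> topspace M - \<Union>(reeb_vertices M A f)" for U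
    using that regular by (intro open_map_regular) blast+
  show "\<exists>G a b. x \<in> G \<and> G \<subseteq> topspace M - \<Union>(reeb_vertices M A f) \<and> level_tube M f G a b"
    if x: "x \<in> topspace M - \<Union>(reeb_vertices M A f)" for x
  proof -
    have xM: "x \<in> topspace M" using x by blast
    have "\<not> critical_point A f p" if "p \<in> \<L> x" for p
      using x Union_reeb_vertices_iff[OF xM] that by blast
    then obtain G a b where G: "x \<in> G" "\<And>p. p \<in> G \<Longrightarrow> \<not> critical_point A f p" "level_tube M f G a b"
      using regular_tube[OF fin xM] by metis
    have "G \<subseteq> topspace M" using G(3) openin_subset unfolding level_tube_def by blast
    moreover have "\<L> y \<subseteq> G" if "y \<in> G" for y using G(3) that unfolding level_tube_def by blast
    ultimately have "G \<subseteq> topspace M - \<Union>(reeb_vertices M A f)"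
      using G(2) Union_reeb_vertices_iff[of _ M A f] by blast
    then show ?thesis using G by blast
  qed
  show "\<not> subtopology M L homeomorphic_space subtopology M (\<L> x)"
    if L: "L \<in> reeb_vertices M A f" and x: "x \<in> topspace M - \<Union>(reeb_vertices M A f)" for L x
  proof
    assume "subtopology M L homeomorphic_space subtopology M (\<L> x)"
    then obtain a b where hom: "homeomorphic_maps (subtopology M L) (subtopology M (\<L> x)) a b"
      unfolding homeomorphic_space_def by blast
    obtain y p where y: "L = \<L> y" "p \<in> L" "critical_point A f p"
      using L by (auto simp: reeb_vertices_def level_components_eq)
    then have p: "p \<in> topspace M" "\<L> p = L"
      using level_component_subset[of M f y] level_component_cong[of p M f y] by auto
    have "a p \<in> topspace (subtopology M (\<L> x))"
      using hom p(1) y(2) by (auto simp: homeomorphic_maps_def continuous_map_def Pi_iff)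
    then have ap: "a p \<in> topspace M" "a p \<in> \<L> x" by auto
    have Lap: "\<L> (a p) = \<L> x" using level_component_cong[OF ap(2)] .
    have "\<not> critical_point A f (a p)"
      using x Union_reeb_vertices_iff[of x M A f] ap(2) by blast
    then obtain T :: "'b set" where T: "flat_at (subtopology M (\<L> x)) (a p) T" "subspace T" "dim T = DIM('b) - 1"
      using regular_level_flat[OF ap(1)] unfolding Lap by metis
    have "b (a p) = p" using hom p(1) y(2) by (auto simp: homeomorphic_maps_def)
    then have "flat_at (subtopology M (\<L> p)) p T"
      using flat_at_homeomorphic[OF homeomorphic_maps_sym[THEN iffD1, OF hom] T(1)] p(2) by simp
    then show False
      using nondegenerate_critical_local[OF p(1) y(3) nd[OF p(1) y(3)]] DIM T(2,3) by metis
  qed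
qed

text \<open>Every point is open and critical, so \<open>M\<close> is finite and discrete and no
  regular point remains. The conditions on tubes and regular components hold vacuously.\<close>

lemma reeb_space_dim_0:
  fixes A :: "('a set \<times> ('a \<Rightarrow> 'b::euclidean_space)) set"
  assumes man: "closed_manifold 0 M A"
  shows "reeb_space M f (reeb_vertices M A f)"
proof -
  have M: "Hausdorff_space M" "compact_space M" using man by (auto simp: closed_manifold_def)
  have point: "openin M {p} \<and> critical_point A f p" if p: "p \<in> topspace M" for p
  proof -
    obtain U \<phi> where U: "(U, \<phi>) \<in> A" "p \<in> U" using man p by (auto simp: closed_manifold_def)
    then have o: "openin M U" "openin (top_of_set {0}) (\<phi> ` U)"
      and hom: "homeomorphic_map (subtopology M U) (top_of_set (\<phi> ` U)) \<phi>"
      using man by (auto simp: closed_manifold_def model_space_def)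
    have im: "\<phi> ` U \<subseteq> {0}" using o(2) openin_imp_subset by blast
    have inj: "inj_on \<phi> U"
      using homeomorphic_imp_injective_map[OF hom] openin_subset[OF o(1)] by (simp add: inf.absorb2)
    have "x = p" if x: "x \<in> U" for x
    proof (rule inj_onD[OF inj _ x U(2)])
      have "\<phi> x \<in> {0}" "\<phi> p \<in> {0}" using im x U(2) by (meson image_eqI subsetD)+
      then show "\<phi> x = \<phi> p" by simp
    qed
    then have Up: "U = {p}" using U(2) by blast
    \<comment> \<open>Within a one-point set every bounded linear map is a derivative, in particular
      0.\<close>
    have "((f \<circ> inv_into U \<phi>) has_derivative (\<lambda>v. 0)) (at (\<phi> p) within {\<phi> p})"
      by (simp add: has_derivative_within_singleton_iff bounded_linear_zero)
    then have "critical_point A f p" 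
      unfolding critical_point_def by (intro bexI[OF _ U(1)]) (simp add: Up)
    then show ?thesis using o(1) Up by simp
  qed
  have fin: "finite {p \<in> topspace M. critical_point A f p}"
  proof (rule finite_if_locally_finite[OF M(2)])
    show "\<exists>N. openin M N \<and> p \<in> N \<and> finite (N \<inter> {p \<in> topspace M. critical_point A f p})" if "p \<in> topspace M" for p
      using point[OF that] by (intro exI[of _ "{p}"]) simp
  qed auto
  have empty: "topspace M - \<Union>(reeb_vertices M A f) = {}"
    using Union_reeb_vertices_iff[of _ M A f] point level_component_refl[of _ M f] by blast
  show ?thesis
  proof
    show "compact_space M" "Hausdorff_space M" by fact+
    show "continuous_map M euclideanreal f"
      unfolding continuous_map_def
    proof (intro conjI allI impI)
      show "openin M {x \<in> topspace M. f x \<in> U}" for U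
      proof (subst openin_subopen, intro ballI)
        fix p assume "p \<in> {x \<in> topspace M. f x \<in> U}"
        then show "\<exists>T. openin M T \<and> p \<in> T \<and> T \<subseteq> {x \<in> topspace M. f x \<in> U}"
          using point[of p] by (intro exI[of _ "{p}"]) auto
      qed
    qed simp
    show "finite (reeb_vertices M A f)" by (rule finite_reeb_vertices[OF fin])
    show "reeb_vertices M A f \<subseteq> level_components M f" by (rule reeb_vertices_subset)
  qed (unfold empty, auto)
qed

text \<open>An edge is a single point \<open>e\<close> of the weak element space, so its incidence
  there is read off from the closure of \<open>{e}\<close>. Disjointness of \<open>V\<close> and
  \<open>E\<close> ensures that each weak element is either a vertex or an edge, but not
  both.\<close>

theorem proposition7p10:
  fixes M :: "'a topology" and A :: "('a set \<times> ('a \<Rightarrow> 'b::euclidean_space)) set"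
    and f :: "'a \<Rightarrow> real" and n :: nat
  assumes "closed_manifold n M A"
    and "n \<noteq> 1"
    and "morse_function n M A f"
  defines "F \<equiv> level_components M f"
  defines "V \<equiv> reeb_vertices M A f" and "E \<equiv> reeb_edges M A f"
  shows "abstract_multigraph V E (reeb_incidence M A f) \<and>
         V \<inter> E = {} \<and>
         abstract_weak_element M F ` F = V \<union> E \<and>
         topspace (abstract_weak_element_space M F) = V \<union> E \<and>
         (\<forall>e\<in>E. V \<inter> abstract_weak_element_space M F closure_of {e} = reeb_incidence M A f e)"
proof -
  have "reeb_space M f V"
  proof (cases "n = 0")
    case True
    then show ?thesis using assms(1) reeb_space_dim_0 unfolding V_def by blast
  next
    case False
    then have n: "n = DIM('b)" using assms(1) by (auto simp: closed_manifold_def)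
    interpret smooth_manifold M A f
      using assms(1,3) n by unfold_locales (auto simp: morse_function_def)
    have "DIM('b) \<ge> 2" using n False assms(2) by linarith
    then show ?thesis unfolding V_def using assms(3) n by (intro reeb_space_positive_dim) auto
  qed
  then interpret reeb_space M f V .
  have E: "E = edges" unfolding Reg_def unfolding E_def reeb_edges_def V_def ..
  have inc: "reeb_incidence M A f e = V \<inter> decomposition_space M F closure_of (element_of F ` e)" for e
    unfolding reeb_incidence_def reeb_graph_def V_def F_def ..
  show ?thesis
  proof (intro conjI ballI)
    show "abstract_multigraph V E (reeb_incidence M A f)"
      unfolding abstract_multigraph_def
    proof
      fix e assume "e \<in> E"
      then have "e \<in> edges" unfolding E .
      then obtain L1 L2 where "L1 \<in> V" "L2 \<in> V" "reeb_incidence M A f e = {L1, L2}"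
        unfolding inc F_def by (rule incidence)
      then show "reeb_incidence M A f e \<in> {{x, y} | x y. x \<in> V \<and> y \<in> V}" by blast
    qed
    show "V \<inter> E = {}" unfolding E by (rule V_edges_disjoint)
    show "abstract_weak_element M F ` F = V \<union> E" unfolding E F_def by (rule weak_elements)
    show "topspace (abstract_weak_element_space M F) = V \<union> E" unfolding E F_def by (rule topspace_weak_space)
    fix e assume "e \<in> E"
    then have "e \<in> edges" unfolding E .
    then obtain L1 L2 where "reeb_incidence M A f e = {L1, L2}"
      "V \<inter> abstract_weak_element_space M F closure_of {e} = {L1, L2}"
      unfolding inc F_def by (rule incidence)
    then show "V \<inter> abstract_weak_element_space M F closure_of {e} = reeb_incidence M A f e" by simp
  qed
qed

end
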